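(* Let $\theta_1,\theta_2,\dots\ge0$ with $\theta_n\to\theta>0$ as $n\to\infty$. Then, under $\mathbb{P}_n$ as $n\to\infty$: (a) $R_1,R_2,R_3,\dots$ converge weakly to independent Poisson random variables with respective means $\theta_1,\frac{\theta_2}2,\frac{\theta_3}3,\dots$; (b) $\displaystyle\lim_{n\to\infty}\frac{\mathbb{E}_n(K)}{\log n}=\theta$; (c) the joint distribution of $\bigl(\frac{L^{(1)}}n,\frac{L^{(2)}}n,\dots\bigr)$ converges weakly to the Poisson–Dirichlet distribution with parameter $\theta$.
   Context: For $\sigma\in\mathcal{S}_n$ (permutations of $\{1,\dots,n\}$), $R_j(\sigma)$ is the number of cycles of length $j$, $K(\sigma)=\sum_jR_j(\sigma)$, and $L^{(1)}(\sigma)\ge L^{(2)}(\sigma)\ge\dots$ are the cycle lengths of $\sigma$ in nonincreasing order (padded with zeros). Given parameters $\theta_j\ge0$, $h_n=\frac1{n!}\sum_{\sigma\in\mathcal{S}_n}\prod_j\theta_j^{R_j(\sigma)}$ and $\mathbb{P}_n(\sigma)=\frac1{n!h_n}\prod_j\theta_j^{R_j(\sigma)}$, with expectation $\mathbb{E}_n$. Poisson–Dirichlet($\theta$): let $X_1,X_2,\dots$ be i.i.d. with $\mathbb{P}(X_i>s)=(1-s)^\theta$ for $0\le s\le1$ (Beta$(1,\theta)$); the sequence $(X_1,(1-X_1)X_2,(1-X_1)(1-X_2)X_3,\dots)$ rearranged in nonincreasing order has the Poisson–Dirichlet distribution with parameter $\theta$. *)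

theory Defs
  imports "HOL-Probability.Probability" "HOL-Combinatorics.Permutations" "HOL-Combinatorics.Orbits"
    "HOL-Library.Multiset"
begin

definition perms :: "nat \<Rightarrow> (nat \<Rightarrow> nat) set" where
  "perms n = {\<sigma>. \<sigma> permutes {1..n}}"

definition cycles_of :: "nat \<Rightarrow> (nat \<Rightarrow> nat) \<Rightarrow> nat set set" where
  "cycles_of n \<sigma> = (\<lambda>x. orbit \<sigma> x) ` {1..n}"

definition Rcyc :: "nat \<Rightarrow> nat \<Rightarrow> (nat \<Rightarrow> nat) \<Rightarrow> nat" where
  "Rcyc n j \<sigma> = card {c \<in> cycles_of n \<sigma>. card c = j}"

definition Kcyc :: "nat \<Rightarrow> (nat \<Rightarrow> nat) \<Rightarrow> nat" where
  "Kcyc n \<sigma> = (\<Sum>j\<in>{1..n}. Rcyc n j \<sigma>)"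

definition Lcyc :: "nat \<Rightarrow> (nat \<Rightarrow> nat) \<Rightarrow> nat \<Rightarrow> nat" where
  "Lcyc n \<sigma> i =
     (let xs = rev (sorted_list_of_multiset (image_mset card (mset_set (cycles_of n \<sigma>))))
      in if 1 \<le> i \<and> i \<le> length xs then xs ! (i - 1) else 0)"

definition wt :: "(nat \<Rightarrow> real) \<Rightarrow> nat \<Rightarrow> (nat \<Rightarrow> nat) \<Rightarrow> real" where
  "wt \<theta>s n \<sigma> = (\<Prod>j\<in>{1..n}. \<theta>s j ^ Rcyc n j \<sigma>)"

definition hn :: "(nat \<Rightarrow> real) \<Rightarrow> nat \<Rightarrow> real" where
  "hn \<theta>s n = (1 / fact n) * (\<Sum>\<sigma>\<in>perms n. wt \<theta>s n \<sigma>)"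

definition Pn :: "(nat \<Rightarrow> real) \<Rightarrow> nat \<Rightarrow> (nat \<Rightarrow> nat) measure" where
  "Pn \<theta>s n = density (count_space (perms n))
      (\<lambda>\<sigma>. ennreal (wt \<theta>s n \<sigma> / (fact n * hn \<theta>s n)))"

definition converges_weakly :: "(nat \<Rightarrow> 'a::topological_space measure) \<Rightarrow> 'a measure \<Rightarrow> bool" where
  "converges_weakly M M0 \<longleftrightarrow>
     (\<forall>f :: 'a \<Rightarrow> real. continuous_on UNIV f \<and> bounded (range f) \<longrightarrow>
        (\<lambda>n. \<integral>x. f x \<partial>M n) \<longlonglongrightarrow> (\<integral>x. f x \<partial>M0))"

text \<open>Poisson distribution with mean r >= 0 (r = 0 gives the point mass at 0).\<close>
definition poisson_measure :: "real \<Rightarrow> nat measure" where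
  "poisson_measure r = density (count_space UNIV) (\<lambda>k. ennreal (r ^ k / fact k * exp (- r)))"

text \<open>Beta(1,theta) distribution: density theta (1-s)^(theta-1) on [0,1],
  i.e. P(X > s) = (1-s)^theta.\<close>
definition beta1 :: "real \<Rightarrow> real measure" where
  "beta1 \<theta> = density lborel
      (\<lambda>s. ennreal (indicator {0..1} s * \<theta> * (1 - s) powr (\<theta> - 1)))"

definition stick :: "(nat \<Rightarrow> real) \<Rightarrow> nat \<Rightarrow> real" where
  "stick X k = X k * (\<Prod>i<k. (1 - X i))"

text \<open>Nonincreasing rearrangement (index j from 0: j-th largest value, with multiplicity;
  0 if there are at most j positive entries).\<close>
definition rearr :: "(nat \<Rightarrow> real) \<Rightarrow> nat \<Rightarrow> real" where
  "rearr v j = Sup ({0} \<union> {t. 0 < t \<and> finite {k. t \<le> v k} \<and> j < card {k. t \<le> v k}})"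

definition PD :: "real \<Rightarrow> (nat \<Rightarrow> real) measure" where
  "PD \<theta> = distr (PiM UNIV (\<lambda>_. beta1 \<theta>)) (PiM UNIV (\<lambda>_. borel)) (\<lambda>X. rearr (stick X))"

end

theory Submission
  imports Defs "HOL-Real_Asymp.Real_Asymp"
begin

text \<open>
  Removing one cycle yields the renewal equation \<open>n h\<^sub>n = \<Sum>\<^sub>j \<theta>\<^sub>j h\<^sub>n\<^sub>-\<^sub>j\<close>. With \<open>S\<^sub>n = \<Sum>\<^bsub>k<n\<^esub> h\<^sub>k\<close> the crude
  bound \<open>n h\<^sub>n \<le> C S\<^sub>n\<close> already gives \<open>n h\<^sub>n / S\<^sub>n \<rightarrow> \<theta>\<close>, so \<open>S\<close> is regularly varying of index \<open>\<theta>\<close> and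
  \<open>h\<^sub>n\<^sub>-\<^sub>j / h\<^sub>n \<rightarrow> 1\<close>.

  For (a), restricting to \<open>R\<^sub>j = r\<close> amounts to setting \<open>\<theta>\<^sub>j\<close> to zero and shifting \<open>n\<close> by \<open>j r\<close>; the
  normalization changes by \<open>exp (- \<theta>\<^sub>j / j)\<close> in the limit, because \<open>S\<close> is a Poisson-weighted sum of
  shifts of the monotone partial sums for the modified weights. For (b), \<open>E R\<^sub>j = \<theta>\<^sub>j h\<^sub>n\<^sub>-\<^sub>j / (j h\<^sub>n)\<close>.

  For (c), the removed cycle has relative length asymptotically Beta(1,\<open>\<theta>\<close>), which is the recursion
  satisfied by stick breaking. Comparing the two recursions, the discrepancy for a remaining part of
  relative length \<open>y\<close> is at most \<open>\<epsilon> + M y\<close>, and every step contracts \<open>M\<close>.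
\<close>

section \<open>Cycle types of permutations\<close>

text \<open>The sequence \<open>h\<close> need not be monotone and may vanish for small
  \<open>n\<close>, so asymptotics are proved for the monotone sums \<open>S\<close> and transferred
  through \<open>h n\<close> ~ \<open>\<theta> * S n / n\<close>. Only the limit of the parameters
  matters because they enter through Toeplitz averages in which every fixed index loses its weight.
  In (c) the removed cycle is size-biased: dividing the renewal equation by \<open>n * h n\<close>
  gives the law of the length of the cycle through a fixed point. The obstacle is that the recursion
  reaches remainders of bounded size, where no asymptotics of \<open>h\<close> hold. Such a
  remainder is short relative to the original size \<open>N\<close>, and a test function that is
  uniformly continuous on the compact cube barely sees how it is cut. Hence the scale
  \<open>N\<close> is kept apart from the current size \<open>n\<close>, and the error is linear in
  the relative length: the linear term pays for remainders that are not short. It contracts because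
  more than half of the remainder is removed with probability bounded below. Finitely many steps,
  their number depending only on the accuracy, then suffice.\<close>

definition cycle_type :: "nat \<Rightarrow> (nat \<Rightarrow> nat) \<Rightarrow> nat multiset" where
  "cycle_type n \<sigma> = image_mset card (mset_set (cycles_of n \<sigma>))"

lemma finite_cycles_of [simp]: "finite (cycles_of n \<sigma>)"
  by (simp add: cycles_of_def)

lemma count_cycle_type: "count (cycle_type n \<sigma>) j = Rcyc n j \<sigma>"
proof -
  have "count (cycle_type n \<sigma>) j = card {c \<in> cycles_of n \<sigma>. j = card c}"
    by (simp add: cycle_type_def count_image_mset Collect_conj_eq vimage_def Int_commute)
       (auto intro!: arg_cong[where f = card])
  also have "\<dots> = Rcyc n j \<sigma>"
    by (simp add: Rcyc_def eq_commute)
  finally show ?thesis .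
qed

lemma permutes_mem_orbit:
  fixes \<sigma> :: "nat \<Rightarrow> nat"
  assumes "\<sigma> permutes {1..n}"
  shows "x \<in> orbit \<sigma> x"
  using assms by (intro permutation_self_in_orbit permutation_permutes[THEN iffD2] exI[of _ "{1..n}"]) simp_all

lemma orbit_eq_of_mem:
  fixes \<sigma> :: "nat \<Rightarrow> nat"
  assumes "\<sigma> permutes {1..n}" "y \<in> orbit \<sigma> x"
  shows "orbit \<sigma> y = orbit \<sigma> x"
  by (rule orbit_cyclic_eq3[OF cyclic_on_orbit[OF assms(1) finite_atLeastAtMost] assms(2)])

lemma orbit_subset_interval:
  fixes \<sigma> :: "nat \<Rightarrow> nat"
  assumes "\<sigma> permutes {1..n}" "x \<in> {1..n}"
  shows "orbit \<sigma> x \<subseteq> {1..n}"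
  using assms by (rule permutes_orbit_subset)

lemma cycle_lengths_bounds:
  fixes \<sigma> :: "nat \<Rightarrow> nat"
  assumes "\<sigma> permutes {1..n}" "c \<in> cycles_of n \<sigma>"
  shows "1 \<le> card c" "card c \<le> n"
proof -
  obtain x where x: "x \<in> {1..n}" "c = orbit \<sigma> x"
    using assms(2) by (auto simp: cycles_of_def)
  have "c \<subseteq> {1..n}" "x \<in> c"
    using x assms(1) orbit_subset_interval permutes_mem_orbit by auto
  then show "1 \<le> card c" "card c \<le> n"
    using card_mono[of "{1..n}" c] finite_subset[of c "{1..n}"] card_gt_0_iff[of c] by auto
qed

lemma cycle_type_bounds:
  fixes \<sigma> :: "nat \<Rightarrow> nat"
  assumes "\<sigma> permutes {1..n}" "j \<in># cycle_type n \<sigma>"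
  shows "1 \<le> j" "j \<le> n"
  using assms cycle_lengths_bounds by (auto simp: cycle_type_def)

lemma Rcyc_eq_0:
  fixes \<sigma> :: "nat \<Rightarrow> nat"
  assumes "\<sigma> permutes {1..n}" "j = 0 \<or> n < j"
  shows "Rcyc n j \<sigma> = 0"
  using cycle_type_bounds[OF assms(1), of j] assms(2)
  by (auto simp: count_cycle_type[symmetric] not_in_iff[symmetric])

section \<open>Inserting a new point into a cycle\<close>

context
  fixes n :: nat and p :: "nat \<Rightarrow> nat" and i :: nat
  assumes p: "p permutes {1..n}" and i: "i \<in> {1..n}"
begin

text \<open>\<open>q\<close> splices \<open>Suc n\<close> into the cycle of \<open>i\<close> just
  before \<open>i\<close>: the former predecessor of \<open>i\<close> now goes to
  \<open>Suc n\<close>, and \<open>Suc n\<close> goes to \<open>i\<close>.\<close>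

private abbreviation "q \<equiv> Transposition.transpose (Suc n) i \<circ> p"

private lemma p_top: "p (Suc n) = Suc n"
  using p by (auto intro: permutes_not_in)

private lemma q_simps:
  "q (Suc n) = i" "x \<noteq> Suc n \<Longrightarrow> p x \<noteq> i \<Longrightarrow> q x = p x" "p x = i \<Longrightarrow> q x = Suc n"
proof -
  show "q (Suc n) = i" using p_top by simp
  show "p x = i \<Longrightarrow> q x = Suc n" by simp
  assume "x \<noteq> Suc n" "p x \<noteq> i"
  moreover have "p x \<noteq> Suc n"
    using \<open>x \<noteq> Suc n\<close> p_top p by (metis permutes_inj injD)
  ultimately show "q x = p x" by (simp add: Transposition.transpose_def)
qed

private lemma q_permutes: "q permutes {1..Suc n}"
proof -
  have "Transposition.transpose (Suc n) i permutes {1..Suc n}"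
    using i by (intro permutes_swap_id) auto
  moreover have "p permutes {1..Suc n}"
    using p by (rule permutes_subset) auto
  ultimately show ?thesis by (simp add: permutes_compose)
qed

private lemma orbit_insert_other:
  assumes "x \<in> {1..n}" "x \<notin> orbit p i"
  shows "orbit q x = orbit p x"
proof -
  have notin: "i \<notin> orbit p x" 
    using assms p orbit_eq_of_mem permutes_mem_orbit by metis
  have "orbit p x = orbit q x"
  proof (rule orbit_cong0)
    show "x \<in> orbit p x" using p by (rule permutes_mem_orbit)
    show "p \<in> orbit p x \<rightarrow> orbit p x" by (auto intro: orbit.step)
    fix y assume y: "y \<in> orbit p x"
    then have "y \<noteq> Suc n" using orbit_subset_interval[OF p assms(1)] by auto
    moreover have "p y \<noteq> i" using y notin orbit.step by metis
    ultimately show "p y = q y" using q_simps(2) by simp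
  qed
  then show ?thesis by simp
qed

private lemma orbit_insert_same: "orbit q i = insert (Suc n) (orbit p i)"
proof
  have "y \<in> insert (Suc n) (orbit p i)" if "y \<in> orbit q i" for y
    using that
  proof induction
    case base
    have "i \<noteq> Suc n" using i by auto
    then show ?case using q_simps(2,3)[of i] orbit.base[of p i] by (cases "p i = i") auto
  next
    case (step y)
    show ?case
      using step.IH q_simps(1) q_simps(2,3)[of y] orbit.step[of y p i] permutes_mem_orbit[OF p, of i]
      by (cases "p y = i"; cases "y = Suc n") auto
  qed
  then show "orbit q i \<subseteq> insert (Suc n) (orbit p i)" by blast
next
  have self: "i \<in> orbit q i"
    using q_permutes by (rule permutes_mem_orbit)
  \<comment> \<open>The only step inside this orbit that \<open>q\<close> does not share with
    \<open>p\<close> leads to \<open>i\<close>, and \<open>i\<close> already lies in its own orbit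
    under \<open>q\<close>.\<close>
  have sub: "y \<in> orbit q i" if "y \<in> orbit p i" for y
    using that
  proof induction
    case base
    have "i \<noteq> Suc n" using i by auto
    then show ?case using q_simps(2)[of i] self orbit.base[of q i]
      by (cases "p i = i") (auto simp del: o_apply)
  next
    case (step y)
    have "y \<noteq> Suc n" using step.hyps orbit_subset_interval[OF p i] by auto
    then show ?case using q_simps(2)[of y] self orbit.step[OF step.IH]
      by (cases "p y = i") (auto simp del: o_apply)
  qed
  have "i \<in> orbit p i" using p by (rule permutes_mem_orbit)
  then obtain y where y: "y \<in> orbit p i" "p y = i"
    by (metis orbit.cases permutes_mem_orbit[OF p])
  have "Suc n \<in> orbit q i"
    using orbit.step[OF sub[OF y(1)]] q_simps(3)[OF y(2)] by (simp del: o_apply)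
  then show "insert (Suc n) (orbit p i) \<subseteq> orbit q i" using sub by blast
qed

private lemma cycles_of_insert:
  "cycles_of (Suc n) q = insert (insert (Suc n) (orbit p i)) (cycles_of n p - {orbit p i})"
proof -
  have 1: "orbit q x = insert (Suc n) (orbit p i)" if "x \<in> insert (Suc n) (orbit p i)" for x
    using that orbit_insert_same orbit_eq_of_mem[OF q_permutes] by metis
  have 2: "orbit p x \<noteq> orbit p i" if "x \<notin> orbit p i" for x
    using that permutes_mem_orbit[OF p] by metis
  have 3: "orbit p x = orbit p i" if "x \<in> orbit p i" for x
    using that orbit_eq_of_mem[OF p] by metis
  have sp: "{1..Suc n} = insert (Suc n) (orbit p i) \<union> ({1..n} - orbit p i)"
    using orbit_subset_interval[OF p i] by auto
  have "cycles_of (Suc n) q = {insert (Suc n) (orbit p i)} \<union> orbit p ` ({1..n} - orbit p i)"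
    unfolding cycles_of_def sp image_Un
    using 1 orbit_insert_other by (intro arg_cong2[where f = "(\<union>)"]) (auto intro!: image_cong)
  moreover have "orbit p ` ({1..n} - orbit p i) = cycles_of n p - {orbit p i}"
    unfolding cycles_of_def using 2 3 by auto
  ultimately show ?thesis by simp
qed

lemma cycle_type_insert:
  "cycle_type (Suc n) (Transposition.transpose (Suc n) i \<circ> p) =
     cycle_type n p - {#card (orbit p i)#} + {#Suc (card (orbit p i))#}"
proof -
  let ?c = "orbit p i"
  have mem: "?c \<in> cycles_of n p" using i by (auto simp: cycles_of_def)
  have sub: "c \<subseteq> {1..n}" if "c \<in> cycles_of n p" for c
    using that orbit_subset_interval[OF p] unfolding cycles_of_def by blast
  then have new: "insert (Suc n) ?c \<notin> cycles_of n p - {?c}" by force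
  have card: "card (insert (Suc n) ?c) = Suc (card ?c)"
    using sub[OF mem] by (subst card_insert_disjoint) (auto intro: finite_subset)
  have "mset_set (cycles_of n p - {?c}) = mset_set (cycles_of n p) - {#?c#}"
    using mem by (simp add: mset_set_Diff)
  then have "cycle_type (Suc n) q =
      image_mset card (mset_set (cycles_of n p) - {#?c#}) + {#Suc (card ?c)#}"
    unfolding cycle_type_def cycles_of_insert using new card by simp
  also have "image_mset card (mset_set (cycles_of n p) - {#?c#}) = cycle_type n p - {#card ?c#}"
    using mem by (simp add: cycle_type_def image_mset_Diff)
  finally show ?thesis .
qed

end

lemma cycle_type_fixpoint:
  assumes p: "p permutes {1..n}"
  shows "cycle_type (Suc n) p = cycle_type n p + {#1#}"
proof -
  have "p (Suc n) = Suc n" using p by (auto intro: permutes_not_in)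
  then have "orbit p (Suc n) = {Suc n}" by (simp add: orbit_eq_singleton_iff)
  then have "cycles_of (Suc n) p = insert {Suc n} (cycles_of n p)"
    by (simp add: cycles_of_def atLeastAtMostSuc_conv)
  moreover have "{Suc n} \<notin> cycles_of n p"
  proof
    assume "{Suc n} \<in> cycles_of n p"
    then obtain x where "x \<in> {1..n}" "{Suc n} = orbit p x" by (auto simp: cycles_of_def)
    then show False using orbit_subset_interval[OF p, of x] by auto
  qed
  ultimately show ?thesis by (simp add: cycle_type_def)
qed

section \<open>Averages over the symmetric group and their recurrences\<close>

lemma finite_perms [simp]: "finite (perms n)"
  by (simp add: perms_def finite_permutations)

text \<open>Group the points by cycle, then the cycles by length: length \<open>l\<close> accounts
  for \<open>l\<close> points per cycle. This turns a sum over insertion places into a sum over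
  cycle lengths.\<close>

lemma sum_cycles_of:
  fixes G :: "nat \<Rightarrow> real"
  assumes p: "p permutes {1..n}"
  shows "(\<Sum>i=1..n. G (card (orbit p i))) = (\<Sum>l=1..n. real l * real (count (cycle_type n p) l) * G l)"
proof -
  have "(\<Sum>i=1..n. G (card (orbit p i))) = (\<Sum>c\<in>cycles_of n p. \<Sum>i\<in>{i\<in>{1..n}. orbit p i = c}. G (card (orbit p i)))"
    by (rule sum.group[symmetric]) (auto simp: cycles_of_def)
  also have "\<dots> = (\<Sum>c\<in>cycles_of n p. real (card c) * G (card c))"
  proof (rule sum.cong[OF refl])
    fix c assume c: "c \<in> cycles_of n p"
    have "{i\<in>{1..n}. orbit p i = c} = c"
    proof -
      obtain x where x: "x \<in> {1..n}" "c = orbit p x" using c by (auto simp: cycles_of_def)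
      show ?thesis using orbit_subset_interval[OF p x(1)] orbit_eq_of_mem[OF p] permutes_mem_orbit[OF p] x(2)
        by blast
    qed
    moreover have "(\<Sum>i\<in>{i\<in>{1..n}. orbit p i = c}. G (card (orbit p i))) =
        (\<Sum>i\<in>{i\<in>{1..n}. orbit p i = c}. G (card c))"
      by (rule sum.cong) auto
    ultimately show "(\<Sum>i\<in>{i\<in>{1..n}. orbit p i = c}. G (card (orbit p i))) = real (card c) * G (card c)"
      by (simp only: sum_constant)
  qed
  also have "\<dots> = (\<Sum>l=1..n. \<Sum>c\<in>{c\<in>cycles_of n p. card c = l}. real (card c) * G (card c))"
    using cycle_lengths_bounds[OF p] by (intro sum.group[symmetric]) auto
  also have "\<dots> = (\<Sum>l=1..n. real l * real (count (cycle_type n p) l) * G l)"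
    by (rule sum.cong[OF refl]) (simp add: count_cycle_type Rcyc_def)
  finally show ?thesis .
qed

text \<open>All statistics of interest factor through the cycle type, so everything is phrased in terms of
  averages over the symmetric group of functions of the cycle type.\<close>

definition perm_avg :: "nat \<Rightarrow> (nat multiset \<Rightarrow> real) \<Rightarrow> real" where
  "perm_avg n F = (1 / fact n) * (\<Sum>\<sigma>\<in>perms n. F (cycle_type n \<sigma>))"

lemma perm_avg_0 [simp]: "perm_avg 0 F = F {#}"
  by (simp add: perm_avg_def perms_def cycle_type_def cycles_of_def)

lemma perm_avg_sum: "perm_avg n (\<lambda>M. \<Sum>a\<in>A. F a M) = (\<Sum>a\<in>A. perm_avg n (F a))"
  unfolding perm_avg_def by (subst sum.swap) (simp add: sum_distrib_left)

lemma perm_avg_cmult: "perm_avg n (\<lambda>M. c * F M) = c * perm_avg n F"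
  unfolding perm_avg_def by (simp add: sum_distrib_left mult_ac)

lemma perm_avg_add: "perm_avg n (\<lambda>M. F M + G M) = perm_avg n F + perm_avg n G"
  unfolding perm_avg_def by (simp add: sum.distrib algebra_simps)

lemma perm_avg_diff: "perm_avg n (\<lambda>M. F M - G M) = perm_avg n F - perm_avg n G"
  unfolding perm_avg_def by (simp add: sum_subtractf algebra_simps)

lemma perm_avg_mono:
  assumes "\<And>\<sigma>. \<sigma> permutes {1..n} \<Longrightarrow> F (cycle_type n \<sigma>) \<le> G (cycle_type n \<sigma>)"
  shows "perm_avg n F \<le> perm_avg n G"
  unfolding perm_avg_def using assms by (intro mult_left_mono sum_mono) (auto simp: perms_def)

lemma perm_avg_cong:
  assumes "\<And>\<sigma>. \<sigma> permutes {1..n} \<Longrightarrow> F (cycle_type n \<sigma>) = G (cycle_type n \<sigma>)"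
  shows "perm_avg n F = perm_avg n G"
  using assms by (intro antisym perm_avg_mono) auto

text \<open>Each permutation of \<open>{1..Suc n}\<close> arises exactly once by either fixing
  \<open>Suc n\<close> or splicing it in before some \<open>i \<le> n\<close>. The first term is the
  new fixed point, the sum collects the cycles lengthened by one.\<close>

lemma perm_avg_Suc:
  "real (Suc n) * perm_avg (Suc n) F =
     perm_avg n (\<lambda>M. F (M + {#1#})) +
     (\<Sum>l=1..n. perm_avg n (\<lambda>M. real l * real (count M l) * F (M - {#l#} + {#Suc l#})))"
proof -
  have ins: "{1..Suc n} = insert (Suc n) {1..n}" by auto
  have "(\<Sum>\<sigma>\<in>perms (Suc n). F (cycle_type (Suc n) \<sigma>)) =
      (\<Sum>b\<in>{1..Suc n}. \<Sum>p\<in>perms n. F (cycle_type (Suc n) (Transposition.transpose (Suc n) b \<circ> p)))"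
    unfolding perms_def ins by (subst sum_over_permutations_insert) auto
  also have "\<dots> = (\<Sum>p\<in>perms n. \<Sum>b\<in>{1..Suc n}. F (cycle_type (Suc n) (Transposition.transpose (Suc n) b \<circ> p)))"
    by (rule sum.swap)
  also have "\<dots> = (\<Sum>p\<in>perms n. F (cycle_type n p + {#1#}) +
      (\<Sum>l=1..n. real l * real (count (cycle_type n p) l) * F (cycle_type n p - {#l#} + {#Suc l#})))"
  proof (rule sum.cong[OF refl])
    fix p assume "p \<in> perms n"
    then have p: "p permutes {1..n}" by (simp add: perms_def)
    have "(\<Sum>b\<in>{1..Suc n}. F (cycle_type (Suc n) (Transposition.transpose (Suc n) b \<circ> p))) =
        F (cycle_type (Suc n) p) + (\<Sum>b=1..n. F (cycle_type (Suc n) (Transposition.transpose (Suc n) b \<circ> p)))"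
      unfolding ins by simp
    also have "(\<Sum>b=1..n. F (cycle_type (Suc n) (Transposition.transpose (Suc n) b \<circ> p))) =
        (\<Sum>b=1..n. F (cycle_type n p - {#card (orbit p b)#} + {#Suc (card (orbit p b))#}))"
      by (rule sum.cong[OF refl]) (simp add: cycle_type_insert[OF p])
    also have "\<dots> = (\<Sum>l=1..n. real l * real (count (cycle_type n p) l) * F (cycle_type n p - {#l#} + {#Suc l#}))"
      by (rule sum_cycles_of[OF p, where G = "\<lambda>l. F (cycle_type n p - {#l#} + {#Suc l#})"])
    finally show "(\<Sum>b\<in>{1..Suc n}. F (cycle_type (Suc n) (Transposition.transpose (Suc n) b \<circ> p))) =
       F (cycle_type n p + {#1#}) +
      (\<Sum>l=1..n. real l * real (count (cycle_type n p) l) * F (cycle_type n p - {#l#} + {#Suc l#}))"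
      by (simp only: cycle_type_fixpoint[OF p])
  qed
  finally have "perm_avg (Suc n) F = 1 / fact (Suc n) * \<dots>"
    unfolding perm_avg_def by (rule arg_cong)
  then have "real (Suc n) * perm_avg (Suc n) F = 1 / fact n * (\<Sum>p\<in>perms n. F (cycle_type n p + {#1#}) +
      (\<Sum>l=1..n. real l * real (count (cycle_type n p) l) * F (cycle_type n p - {#l#} + {#Suc l#})))"
    by (simp add: field_simps del: of_nat_Suc)
  also have "\<dots> = perm_avg n (\<lambda>M. F (M + {#1#}) + (\<Sum>l=1..n. real l * real (count M l) * F (M - {#l#} + {#Suc l#})))"
    by (simp add: perm_avg_def)
  finally show ?thesis by (simp add: perm_avg_add perm_avg_sum)
qed

text \<open>The two identities are proved together: the insertion recurrence at \<open>n\<close> and the second identity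
  at \<open>n - 1\<close> give the first one at \<open>n\<close>, which in turn gives the second one at \<open>n\<close>.\<close>

lemma perm_avg_rec_and_count:
  "real n * perm_avg n F = (\<Sum>i=1..n. perm_avg (n - i) (\<lambda>M. F (M + {#i#})))"
  "1 \<le> j \<Longrightarrow> j \<le> n \<Longrightarrow>
     real j * perm_avg n (\<lambda>M. real (count M j) * F M) = perm_avg (n - j) (\<lambda>M. F (M + {#j#}))"
proof (induction n arbitrary: F j rule: less_induct)
  case (less n)
  show rec: "real n * perm_avg n F = (\<Sum>i=1..n. perm_avg (n - i) (\<lambda>M. F (M + {#i#})))" for F
  proof (cases n)
    case (Suc m)
    \<comment> \<open>The factor \<open>l * count M l\<close> is the size bias that the second
      identity removes: it takes out one cycle of length \<open>l\<close>, and \<open>F\<close> then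
      sees a cycle of length \<open>Suc l\<close> in its place.\<close>
    have "(\<Sum>l=1..m. perm_avg m (\<lambda>M. real l * real (count M l) * F (M - {#l#} + {#Suc l#}))) =
      (\<Sum>l=1..m. perm_avg (m - l) (\<lambda>M. F (M + {#Suc l#})))"
    proof (rule sum.cong[OF refl])
      fix l assume l: "l \<in> {1..m}"
      have "perm_avg m (\<lambda>M. real l * real (count M l) * F (M - {#l#} + {#Suc l#})) =
        real l * perm_avg m (\<lambda>M. real (count M l) * F (M - {#l#} + {#Suc l#}))"
        by (simp add: perm_avg_cmult mult.assoc)
      also have "\<dots> = perm_avg (m - l) (\<lambda>M. F (M + {#l#} - {#l#} + {#Suc l#}))"
        using l Suc by (intro less.IH(2)) auto
      finally show "perm_avg m (\<lambda>M. real l * real (count M l) * F (M - {#l#} + {#Suc l#})) =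
          perm_avg (m - l) (\<lambda>M. F (M + {#Suc l#}))" by simp
    qed
    then have "real (Suc m) * perm_avg (Suc m) F = perm_avg m (\<lambda>M. F (M + {#1#})) +
       (\<Sum>l=1..m. perm_avg (m - l) (\<lambda>M. F (M + {#Suc l#})))"
      by (simp only: perm_avg_Suc)
    also have "\<dots> = (\<Sum>i=1..Suc m. perm_avg (Suc m - i) (\<lambda>M. F (M + {#i#})))"
      by (subst (2) sum.atLeast_Suc_atMost) (simp_all add: sum.atLeast_Suc_atMost_Suc_shift o_def del: sum.cl_ivl_Suc)
    finally show ?thesis using Suc by simp
  qed simp
  show "real j * perm_avg n (\<lambda>M. real (count M j) * F M) = perm_avg (n - j) (\<lambda>M. F (M + {#j#}))"
    if j: "1 \<le> j" "j \<le> n" for F j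
  proof -
    \<comment> \<open>The first identity applied to \<open>count M j * F M\<close>: the added cycle
      raises the count by one exactly when \<open>i = j\<close>.\<close>
    have "real n * perm_avg n (\<lambda>M. real (count M j) * F M) =
       (\<Sum>i=1..n. perm_avg (n - i) (\<lambda>M. real (count M j) * F (M + {#i#})) +
          (if i = j then perm_avg (n - j) (\<lambda>M. F (M + {#j#})) else 0))"
      unfolding rec by (intro sum.cong refl) (auto simp: perm_avg_add algebra_simps)
    also have "\<dots> = (\<Sum>i=1..n. perm_avg (n - i) (\<lambda>M. real (count M j) * F (M + {#i#}))) +
        perm_avg (n - j) (\<lambda>M. F (M + {#j#}))"
      using j by (simp add: sum.distrib)
    \<comment> \<open>With fewer than \<open>j\<close> points left there is no cycle of length
      \<open>j\<close>; cutting off these terms makes the induction hypothesis applicable to the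
      others.\<close>
    also have "(\<Sum>i=1..n. perm_avg (n - i) (\<lambda>M. real (count M j) * F (M + {#i#}))) =
        (\<Sum>i=1..n-j. perm_avg (n - i) (\<lambda>M. real (count M j) * F (M + {#i#})))"
    proof (rule sum.mono_neutral_right)
      show "\<forall>i\<in>{1..n} - {1..n - j}. perm_avg (n - i) (\<lambda>M. real (count M j) * F (M + {#i#})) = 0"
      proof
        fix i assume "i \<in> {1..n} - {1..n - j}"
        then have "n - i < j" by auto
        then have "perm_avg (n - i) (\<lambda>M. real (count M j) * F (M + {#i#})) = perm_avg (n - i) (\<lambda>M. 0)"
          by (intro perm_avg_cong) (simp add: count_cycle_type Rcyc_eq_0)
        then show "perm_avg (n - i) (\<lambda>M. real (count M j) * F (M + {#i#})) = 0"
          by (simp add: perm_avg_def)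
      qed
    qed auto
    also have "\<dots> = (\<Sum>i=1..n-j. (1 / real j) * perm_avg (n - j - i) (\<lambda>M. F (M + {#j#} + {#i#})))"
    proof (rule sum.cong[OF refl])
      fix i assume i: "i \<in> {1..n - j}"
      have "real j * perm_avg (n - i) (\<lambda>M. real (count M j) * F (M + {#i#})) =
          perm_avg (n - i - j) (\<lambda>M. F (M + {#j#} + {#i#}))"
        using i j by (intro less.IH(2)) auto
      then show "perm_avg (n - i) (\<lambda>M. real (count M j) * F (M + {#i#})) =
          (1 / real j) * perm_avg (n - j - i) (\<lambda>M. F (M + {#j#} + {#i#}))"
        using j by (simp add: field_simps diff_commute add.commute)
    qed
    also have "\<dots> = (1 / real j) * (\<Sum>i=1..n-j. perm_avg (n - j - i) (\<lambda>M. F (M + {#i#} + {#j#})))"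
      by (simp add: sum_distrib_left add_mset_commute)
    also have "(\<Sum>i=1..n-j. perm_avg (n - j - i) (\<lambda>M. F (M + {#i#} + {#j#}))) =
        real (n - j) * perm_avg (n - j) (\<lambda>M. F (M + {#j#}))"
      using j by (intro less.IH(1)[of "n - j" "\<lambda>M. F (M + {#j#})", symmetric]) auto
    finally have "real n * perm_avg n (\<lambda>M. real (count M j) * F M) =
        (real (n - j) / real j + 1) * perm_avg (n - j) (\<lambda>M. F (M + {#j#}))"
      by (simp add: algebra_simps)
    \<comment> \<open>The first identity at \<open>n - j\<close> has reassembled the sum; what
      remains is this factor, whose \<open>n\<close> cancels against the left-hand side.\<close>
    also have "real (n - j) / real j + 1 = real n / real j"
      using j by (simp add: field_simps of_nat_diff)
    finally show ?thesis
      using j by (simp add: field_simps)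
  qed
qed

section \<open>The renewal equation\<close>

text \<open>The regularity theorem of Toeplitz for triangular arrays: finitely many columns vanish
  in the limit, and on the others \<open>x j\<close> is close to \<open>l\<close>. The total mass
  may tend to any \<open>c\<close>, so the deviation \<open>x j - l\<close> is treated apart from
  the constant part.\<close>

lemma toeplitz_tendsto:
  fixes a :: "nat \<Rightarrow> nat \<Rightarrow> real"
  assumes nonneg: "\<And>n j. 1 \<le> j \<Longrightarrow> j \<le> n \<Longrightarrow> 0 \<le> a n j"
    and total: "(\<lambda>n. \<Sum>j=1..n. a n j) \<longlonglongrightarrow> c"
    and col: "\<And>j. 1 \<le> j \<Longrightarrow> (\<lambda>n. a n j) \<longlonglongrightarrow> 0"
    and x: "x \<longlonglongrightarrow> l"
  shows "(\<lambda>n. \<Sum>j=1..n. a n j * x j) \<longlonglongrightarrow> c * l"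
proof -
  have "(\<lambda>n. \<Sum>j=1..n. a n j * (x j - l)) \<longlonglongrightarrow> 0"
  proof (rule tendstoI)
    fix e :: real assume e: "0 < e"
    \<comment> \<open>In the limit the columns beyond \<open>J\<close> contribute at most
      \<open>e' * c < e\<close>; the \<open>+ 1\<close> keeps the denominator positive when
      \<open>c = 0\<close>.\<close>
    define e' where "e' = e / (2 * (\<bar>c\<bar> + 1))"
    have e': "0 < e'" using e by (simp add: e'_def)
    have ce: "e' * c < e"
    proof -
      have "e' * c \<le> e' * (\<bar>c\<bar> + 1)" using e' by (intro mult_left_mono) auto
      also have "\<dots> = e / 2" by (simp add: e'_def field_simps)
      finally show ?thesis using e by simp
    qed
    obtain J where J: "\<And>j. J \<le> j \<Longrightarrow> \<bar>x j - l\<bar> < e'"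
      using LIMSEQ_D[OF x e'] by auto
    have "(\<lambda>n. (\<Sum>j=1..J. a n j * \<bar>x j - l\<bar>) + e' * (\<Sum>j=1..n. a n j)) \<longlonglongrightarrow> (\<Sum>j=1..J. 0 * \<bar>x j - l\<bar>) + e' * c"
      by (intro tendsto_intros total col) auto
    then have ev: "\<forall>\<^sub>F n in sequentially. (\<Sum>j=1..J. a n j * \<bar>x j - l\<bar>) + e' * (\<Sum>j=1..n. a n j) < e"
      using ce by (intro order_tendstoD(2)[where a = e]) auto
    show "\<forall>\<^sub>F n in sequentially. dist (\<Sum>j=1..n. a n j * (x j - l)) 0 < e"
      using ev eventually_ge_at_top[of J]
    proof eventually_elim
      case (elim n)
      have "\<bar>\<Sum>j=1..n. a n j * (x j - l)\<bar> \<le> (\<Sum>j=1..n. a n j * \<bar>x j - l\<bar>)"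
        by (rule order_trans[OF sum_abs]) (simp add: abs_mult nonneg)
      also have "\<dots> \<le> (\<Sum>j=1..n. (if j \<le> J then a n j * \<bar>x j - l\<bar> else 0) + e' * a n j)"
      proof (rule sum_mono)
        fix j assume j: "j \<in> {1..n}"
        have "a n j * \<bar>x j - l\<bar> \<le> e' * a n j" if "J < j"
          using that j J[of j] nonneg[of j n] by (subst mult.commute) (intro mult_right_mono, auto)
        moreover have "0 \<le> e' * a n j" using e' nonneg[of j n] j by auto
        ultimately show "a n j * \<bar>x j - l\<bar> \<le> (if j \<le> J then a n j * \<bar>x j - l\<bar> else 0) + e' * a n j"
          by auto
      qed
      also have "\<dots> = (\<Sum>j\<in>{j\<in>{1..n}. j \<le> J}. a n j * \<bar>x j - l\<bar>) + e' * (\<Sum>j=1..n. a n j)"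
        unfolding sum.distrib sum_distrib_left
        by (intro arg_cong2[where f = "(+)"] sum.inter_filter[symmetric] refl) simp
      also have "{j\<in>{1..n}. j \<le> J} = {1..J}" using elim(2) by auto
      finally show ?case using elim(1) by (simp add: dist_real_def)
    qed
  qed
  moreover have "(\<lambda>n. (\<Sum>j=1..n. a n j) * l) \<longlonglongrightarrow> c * l"
    by (intro tendsto_intros total)
  ultimately have "(\<lambda>n. (\<Sum>j=1..n. a n j * (x j - l)) + (\<Sum>j=1..n. a n j) * l) \<longlonglongrightarrow> 0 + c * l"
    by (rule tendsto_add)
  then show ?thesis by (simp add: algebra_simps sum.distrib sum_subtractf sum_distrib_left)
qed

lemma sum_reflect: "(\<Sum>j=1..n. g (n - j)) = (\<Sum>k<n. g k)" for g :: "nat \<Rightarrow> real"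
proof -
  have "(\<Sum>j=1..n. g (n - j)) = (\<Sum>i<n. g (n - Suc i))"
    by (rule sum.reindex_bij_witness[of _ Suc "\<lambda>j. j - 1"]) auto
  then show ?thesis by (simp add: sum.nat_diff_reindex)
qed

text \<open>The difference telescopes into fewer than \<open>n\<close> increments, each at most a
  small constant over \<open>m n\<close>, and \<open>n / m n\<close> stays bounded because the limit
  \<open>x\<close> is positive.\<close>

lemma slowly_varying_diff:
  fixes b :: "nat \<Rightarrow> real"
  assumes b: "(\<lambda>n. real n * (b (Suc n) - b n)) \<longlonglongrightarrow> 0"
    and le: "\<forall>\<^sub>F n in sequentially. m n \<le> n" and m: "(\<lambda>n. real (m n) / real n) \<longlonglongrightarrow> x" and x: "0 < x"
  shows "(\<lambda>n. b (m n) - b n) \<longlonglongrightarrow> 0"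
proof (rule tendstoI)
  fix e :: real assume e: "0 < e"
  \<comment> \<open>Eventually \<open>n / m n < 2 / x\<close>, so the telescoped sum is at most
    \<open>e' * 2 / x = e / 2\<close>.\<close>
  define e' where "e' = e * x / 4"
  have e': "0 < e'" using e x by (simp add: e'_def)
  obtain N where N: "\<And>n. N \<le> n \<Longrightarrow> \<bar>real n * (b (Suc n) - b n)\<bar> < e'"
    using LIMSEQ_D[OF b e'] by auto
  have half: "\<forall>\<^sub>F n in sequentially. x / 2 < real (m n) / real n"
    using m x by (intro order_tendstoD(1)[OF m]) auto
  have large: "\<forall>\<^sub>F n in sequentially. real (max N 1) < x / 2 * real n"
    using x by real_asymp
  show "\<forall>\<^sub>F n in sequentially. dist (b (m n) - b n) 0 < e"
    using le half large eventually_gt_at_top[of 0]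
  proof eventually_elim
    case (elim n)
    have mx: "x / 2 * real n < real (m n)" using elim by (simp add: field_simps)
    then have "real (max N 1) < real (m n)" using elim(3) by linarith
    then have mN: "N \<le> m n" "1 \<le> m n" by simp_all
    have step: "\<bar>b (Suc k) - b k\<bar> \<le> e' / real (m n)" if "k \<in> {m n..<n}" for k
    proof -
      have "real (m n) * \<bar>b (Suc k) - b k\<bar> \<le> real k * \<bar>b (Suc k) - b k\<bar>"
        using that by (intro mult_right_mono) auto
      also have "\<dots> \<le> e'" using N[of k] that mN by (simp add: abs_mult)
      finally show ?thesis using mN by (simp add: field_simps)
    qed
    have "\<bar>b n - b (m n)\<bar> = \<bar>\<Sum>k=m n..<n. b (Suc k) - b k\<bar>"
      using elim(1) by (simp add: sum_Suc_diff')
    also have "\<dots> \<le> (\<Sum>k=m n..<n. \<bar>b (Suc k) - b k\<bar>)" by (rule sum_abs)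
    also have "\<dots> \<le> (\<Sum>k=m n..<n. e' / real (m n))" by (intro sum_mono step)
    also have "\<dots> = real (n - m n) * e' / real (m n)" by simp
    also have "\<dots> \<le> real n * e' / real (m n)" using e' by (intro divide_right_mono mult_right_mono) auto
    also have "\<dots> < e"
    proof -
      have "real n * e' = (x / 2 * real n) * (e / 2)" by (simp add: e'_def)
      also have "\<dots> \<le> real (m n) * (e / 2)" using mx e by (intro mult_right_mono) auto
      also have "\<dots> < real (m n) * e" using e mN by simp
      finally show ?thesis using mN by (simp add: field_simps)
    qed
    finally show ?case by (simp add: dist_real_def abs_minus_commute)
  qed
qed

section \<open>Asymptotics of renewal sequences\<close>

locale renewal =
  fixes \<theta>s h :: "nat \<Rightarrow> real" and \<theta> :: real
  assumes nonneg: "\<And>j. 1 \<le> j \<Longrightarrow> 0 \<le> \<theta>s j"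
    and lim: "\<theta>s \<longlonglongrightarrow> \<theta>"
    and pos: "0 < \<theta>"
    and h_0: "h 0 = 1"
    and h_rec: "\<And>n. real n * h n = (\<Sum>j=1..n. \<theta>s j * h (n - j))"
begin

text \<open>The sum stops before \<open>n\<close>, so that it is the total of exactly the terms
  \<open>h (n - j)\<close> occurring in the equation for \<open>h n\<close>.\<close>

definition S :: "nat \<Rightarrow> real" where "S n = (\<Sum>k<n. h k)"

lemma h_nonneg: "0 \<le> h n"
proof (induction n rule: less_induct)
  case (less n)
  show ?case
  proof (cases "n = 0")
    case False
    have "0 \<le> real n * h n" unfolding h_rec using less nonneg by (intro sum_nonneg) auto
    then show ?thesis using False by (simp add: zero_le_mult_iff)
  qed (simp add: h_0)
qed

lemma S_0 [simp]: "S 0 = 0" by (simp add: S_def)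

lemma S_mono: "m \<le> n \<Longrightarrow> S m \<le> S n"
  unfolding S_def using h_nonneg by (intro sum_mono2) auto

lemma S_Suc: "S (Suc n) = S n + h n" by (simp add: S_def)

lemma S_pos: "0 < n \<Longrightarrow> 0 < S n"
  using S_mono[of 1 n] by (simp add: S_Suc h_0)

lemma S_nonneg: "0 \<le> S n"
  using S_mono[of 0 n] by simp

lemma theta_bound:
  obtains C where "0 < C" "\<And>j. \<theta>s j \<le> C"
proof -
  have "Bseq \<theta>s" using lim by (intro convergent_imp_Bseq convergentI)
  then obtain C where C: "0 < C" "\<And>j. norm (\<theta>s j) \<le> C" by (auto simp: Bseq_def)
  have "\<theta>s j \<le> C" for j using C(2)[of j] by simp
  then show thesis using that C(1) by blast
qed

lemma h_le_S:
  assumes "\<And>j. \<theta>s j \<le> C" "0 < n"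
  shows "h n \<le> C * S n / real n"
proof -
  have "real n * h n \<le> (\<Sum>j=1..n. C * h (n - j))"
    unfolding h_rec using assms h_nonneg by (intro sum_mono mult_right_mono) auto
  also have "\<dots> = C * S n"
    by (simp add: S_def sum_distrib_left[symmetric] sum_reflect[simplified])
  finally show ?thesis using assms by (simp add: field_simps)
qed

text \<open>The crude bound at \<open>n - j\<close> combined with monotonicity of \<open>S\<close>.
  It supplies the vanishing columns for the Toeplitz averages below.\<close>

lemma h_shift_over_S: "(\<lambda>n. h (n - j) / S n) \<longlonglongrightarrow> 0"
proof -
  obtain C where C: "0 < C" "\<And>j. \<theta>s j \<le> C" by (rule theta_bound) blast
  have lim0: "(\<lambda>n. C / real (n - j)) \<longlonglongrightarrow> 0" by real_asymp
  show ?thesis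
  proof (rule tendsto_sandwich[OF _ _ tendsto_const lim0])
    show "\<forall>\<^sub>F n in sequentially. 0 \<le> h (n - j) / S n"
      using h_nonneg S_nonneg by auto
    show "\<forall>\<^sub>F n in sequentially. h (n - j) / S n \<le> C / real (n - j)"
      using eventually_gt_at_top[of j]
    proof eventually_elim
      case (elim n)
      have "h (n - j) \<le> C * S (n - j) / real (n - j)" using elim C by (intro h_le_S) auto
      also have "\<dots> \<le> C * S n / real (n - j)" using C by (intro divide_right_mono mult_left_mono S_mono) auto
      finally show ?case using S_pos[of n] elim by (simp add: field_simps)
    qed
  qed
qed

text \<open>By the renewal equation the quotient is the average of the parameters
  \<open>\<theta>s j\<close> with weights \<open>h (n - j) / S n\<close>, which sum to 1.\<close>

lemma h_over_S: "(\<lambda>n. real n * h n / S n) \<longlonglongrightarrow> \<theta>"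
proof -
  have "(\<lambda>n. \<Sum>j=1..n. h (n - j) / S n * \<theta>s j) \<longlonglongrightarrow> 1 * \<theta>"
  proof (rule toeplitz_tendsto[OF _ _ h_shift_over_S lim])
    show "\<And>n j. 0 \<le> h (n - j) / S n" using h_nonneg S_nonneg by auto
    have "\<forall>\<^sub>F n in sequentially. (\<Sum>j=1..n. h (n - j) / S n) = 1"
      using eventually_gt_at_top[of 0]
    proof eventually_elim
      case (elim n)
      show ?case using S_pos[OF elim] by (simp add: sum_divide_distrib[symmetric] sum_reflect[simplified] S_def)
    qed
    then show "(\<lambda>n. \<Sum>j=1..n. h (n - j) / S n) \<longlonglongrightarrow> 1" by (rule tendsto_eventually)
  qed
  then show ?thesis
    by (simp add: h_rec sum_divide_distrib mult.commute)
qed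

text \<open>Positivity can fail at first: \<open>\<theta>s 1 = 0\<close> gives
  \<open>h 1 = 0\<close>. All later divisions by \<open>h n\<close> are therefore justified only
  eventually.\<close>

lemma eventually_h_pos: "\<forall>\<^sub>F n in sequentially. 0 < h n"
  using order_tendstoD(1)[OF h_over_S pos] eventually_gt_at_top[of 0]
  by eventually_elim (auto simp: zero_less_divide_iff zero_less_mult_iff S_pos dest: S_pos)

text \<open>Since \<open>ln (1 + h n / S n)\<close> ~ \<open>h n / S n\<close> ~
  \<open>\<theta> / n\<close>, the increments of \<open>b n = ln (S n) - \<theta> * ln n\<close> are
  o(1/n). Thus \<open>b\<close> is asymptotically constant at comparable arguments, and
  exponentiating yields the power of \<open>x\<close>.\<close>

lemma S_ratio:
  assumes le: "\<forall>\<^sub>F n in sequentially. m n \<le> n"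
    and m: "(\<lambda>n. real (m n) / real n) \<longlonglongrightarrow> x" and x: "0 < x"
  shows "(\<lambda>n. S (m n) / S n) \<longlonglongrightarrow> x powr \<theta>"
proof -
  define b where "b n = ln (S n) - \<theta> * ln (real n)" for n
  have h0: "(\<lambda>n. h n / S n) \<longlonglongrightarrow> 0" using h_shift_over_S[of 0] by simp
  have eq: "\<forall>\<^sub>F n in sequentially.
      (real n * h n / S n) * (ln (1 + h n / S n) / (h n / S n)) - \<theta> * (real n * ln (1 + 1 / real n))
      = real n * (b (Suc n) - b n)"
    using eventually_gt_at_top[of 0] eventually_h_pos
  proof eventually_elim
    case (elim n)
    have p: "0 < S n" using elim S_pos by auto
    have "ln (S (Suc n)) = ln (S n * (1 + h n / S n))"
      using p by (simp add: S_Suc distrib_left)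
    also have "\<dots> = ln (S n) + ln (1 + h n / S n)"
      using p elim by (intro ln_mult_pos) (auto intro: add_pos_pos)
    finally have 1: "ln (S (Suc n)) - ln (S n) = ln (1 + h n / S n)" by simp
    have "ln (real (Suc n)) = ln (real n * (1 + 1 / real n))"
      using elim by (simp add: distrib_left)
    also have "\<dots> = ln (real n) + ln (1 + 1 / real n)"
      using elim by (intro ln_mult_pos) (auto intro: add_pos_pos)
    finally have 2: "ln (real (Suc n)) - ln (real n) = ln (1 + 1 / real n)" by simp
    have 3: "b (Suc n) - b n = (ln (S (Suc n)) - ln (S n)) - \<theta> * (ln (real (Suc n)) - ln (real n))"
      by (simp add: b_def algebra_simps)
    show ?case unfolding 3 1 2 using elim p by (simp add: field_simps)
  qed
  have ln1: "((\<lambda>x::real. ln (1 + x) / x) \<longlongrightarrow> 1) (at_right 0)" by real_asymp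
  \<comment> \<open>The quotient \<open>ln (1 + x) / x\<close> has its limit only away from 0, so
    eventual positivity of \<open>h\<close> is required here.\<close>
  have "filterlim (\<lambda>n. h n / S n) (at_right 0) sequentially"
    unfolding filterlim_at
  proof (intro conjI h0)
    show "\<forall>\<^sub>F n in sequentially. h n / S n \<in> {0<..} \<and> h n / S n \<noteq> 0"
      using eventually_h_pos eventually_gt_at_top[of 0] by eventually_elim (auto dest: S_pos)
  qed
  from filterlim_compose[OF ln1 this]
  have "(\<lambda>n. ln (1 + h n / S n) / (h n / S n)) \<longlonglongrightarrow> 1" .
  moreover have "(\<lambda>n. real n * ln (1 + 1 / real n)) \<longlonglongrightarrow> 1" by real_asymp
  ultimately have "(\<lambda>n. (real n * h n / S n) * (ln (1 + h n / S n) / (h n / S n))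
      - \<theta> * (real n * ln (1 + 1 / real n))) \<longlonglongrightarrow> \<theta> * 1 - \<theta> * 1"
    by (intro tendsto_intros h_over_S)
  then have "(\<lambda>n. real n * (b (Suc n) - b n)) \<longlonglongrightarrow> \<theta> * 1 - \<theta> * 1"
    by (rule Lim_transform_eventually[OF _ eq])
  then have "(\<lambda>n. b (m n) - b n) \<longlonglongrightarrow> 0"
    using slowly_varying_diff[OF _ le m x] by simp
  then have "(\<lambda>n. exp (b (m n) - b n) * (real (m n) / real n) powr \<theta>) \<longlonglongrightarrow> exp 0 * x powr \<theta>"
    using x m by (intro tendsto_intros) auto
  moreover have "\<forall>\<^sub>F n in sequentially. exp (b (m n) - b n) * (real (m n) / real n) powr \<theta> = S (m n) / S n"
    using order_tendstoD(1)[OF m x] eventually_gt_at_top[of 0]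
  proof eventually_elim
    case (elim n)
    then have mp: "0 < m n" by (simp add: zero_less_divide_iff)
    have "exp (b (m n) - b n) = exp (ln (S (m n)) - ln (S n)) * exp (- \<theta> * (ln (real (m n)) - ln (real n)))"
      by (simp add: b_def exp_add[symmetric] algebra_simps)
    also have "exp (ln (S (m n)) - ln (S n)) = S (m n) / S n"
      using S_pos mp elim by (simp add: exp_diff)
    also have "exp (- \<theta> * (ln (real (m n)) - ln (real n))) = 1 / (real (m n) / real n) powr \<theta>"
      using mp elim by (simp add: powr_def ln_divide_pos exp_minus inverse_eq_divide)
    finally show ?case using mp elim by simp
  qed
  ultimately show ?thesis by (auto intro: Lim_transform_eventually)
qed

text \<open>Apply \<open>h n\<close> ~ \<open>\<theta> * S n / n\<close> at both arguments and use
  the ratio of the sums. The shift \<open>n - m n\<close> may grow as long as it is o(n), which the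
  logarithmic average below exploits.\<close>

lemma h_ratio:
  assumes le: "\<forall>\<^sub>F n in sequentially. m n \<le> n"
    and m: "(\<lambda>n. real (m n) / real n) \<longlonglongrightarrow> 1"
  shows "(\<lambda>n. h (m n) / h n) \<longlonglongrightarrow> 1"
proof -
  have half: "\<forall>\<^sub>F n in sequentially. real n / 2 \<le> real (m n)"
    using order_tendstoD(1)[OF m, of "1/2", simplified] eventually_gt_at_top[of 0]
    by eventually_elim (simp add: field_simps)
  have "filterlim (\<lambda>n. real n / 2) at_top sequentially" by real_asymp
  from filterlim_at_top_mono[OF this half]
  have "filterlim (\<lambda>n. real (m n)) at_top sequentially" .
  then have mt: "filterlim m at_top sequentially"
    by (simp add: filterlim_sequentially_iff_filterlim_real)
  have t: "(\<lambda>n. real (m n) * h (m n) / S (m n)) \<longlonglongrightarrow> \<theta>"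
    by (rule filterlim_compose[OF h_over_S mt])
  have mm: "(\<lambda>n. S (m n) / S n) \<longlonglongrightarrow> 1"
    using S_ratio[OF le m] by simp
  have "(\<lambda>n. (real (m n) * h (m n) / S (m n)) / (real n * h n / S n) * (S (m n) / S n) / (real (m n) / real n))
     \<longlonglongrightarrow> \<theta> / \<theta> * 1 / 1"
    using pos by (intro tendsto_intros t h_over_S mm m) auto
  moreover have "\<forall>\<^sub>F n in sequentially.
     (real (m n) * h (m n) / S (m n)) / (real n * h n / S n) * (S (m n) / S n) / (real (m n) / real n) = h (m n) / h n"
    using order_tendstoD(1)[OF m zero_less_one] eventually_gt_at_top[of 0] eventually_h_pos
  proof (eventually_elim)
    case (elim n)
    then have mp: "0 < m n" by (simp add: zero_less_divide_iff)
    show ?case using mp elim S_pos[OF mp] S_pos[of n] by (simp add: field_simps)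
  qed
  ultimately have "(\<lambda>n. h (m n) / h n) \<longlonglongrightarrow> \<theta> / \<theta> * 1 / 1"
    by (rule Lim_transform_eventually)
  then show ?thesis using pos by simp
qed

lemma h_shift_ratio: "(\<lambda>n. h (n - k) / h n) \<longlonglongrightarrow> 1"
proof (rule h_ratio)
  show "(\<lambda>n. real (n - k) / real n) \<longlonglongrightarrow> 1" by real_asymp
qed simp

end

section \<open>Logarithmic averages\<close>

context renewal
begin

text \<open>Split at \<open>J n\<close> ~ \<open>n / sqrt (ln n)\<close>. Below it
  \<open>h (n - j) / h n\<close> tends to 1 uniformly, as \<open>J n\<close> is o(n), and the
  harmonic sum up to \<open>J n\<close> is still asymptotic to \<open>ln n\<close>. Above it
  \<open>1 / j\<close> is at most \<open>sqrt (ln n) / n\<close>, while the ratios sum to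
  \<open>S n / h n\<close> ~ \<open>n / \<theta>\<close>; after division by \<open>ln n\<close> this
  is O(1 / sqrt (ln n)).\<close>

lemma harmonic_weighted_mean:
  "(\<lambda>n. (\<Sum>j=1..n. h (n - j) / (real j * h n * ln (real n)))) \<longlonglongrightarrow> 1"
proof -
  define J where "J n = nat \<lfloor>real n / sqrt (ln (real n))\<rfloor>" for n
  define w where "w n j = h (n - j) / h n" for n j
  have w_nonneg: "0 \<le> w n j" for n j by (simp add: w_def h_nonneg)
  have J_over: "(\<lambda>n. real (J n) / real n) \<longlonglongrightarrow> 0" unfolding J_def by real_asymp
  have J_top: "filterlim J sequentially sequentially"
    unfolding filterlim_sequentially_iff_filterlim_real J_def by real_asymp
  have ln_J: "(\<lambda>n. ln (real (J n)) / ln (real n)) \<longlonglongrightarrow> 1" unfolding J_def by real_asymp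
  have J_le: "\<forall>\<^sub>F n in sequentially. J n \<le> n"
    using order_tendstoD(2)[OF J_over zero_less_one] eventually_gt_at_top[of 0]
    by eventually_elim (simp add: field_simps)
  have harm_ln: "(\<lambda>n. harm n / ln (real n)) \<longlonglongrightarrow> (1 :: real)"
  proof -
    have "(\<lambda>n. (harm n - ln (real n)) * (1 / ln (real n)) + ln (real n) / ln (real n)) \<longlonglongrightarrow> euler_mascheroni * 0 + (1::real)"
    proof (intro tendsto_intros euler_mascheroni_LIMSEQ)
      show "(\<lambda>n. 1 / ln (real n)) \<longlonglongrightarrow> 0" by real_asymp
      show "(\<lambda>n. ln (real n) / ln (real n)) \<longlonglongrightarrow> 1" by real_asymp
    qed
    then show ?thesis by (simp add: diff_divide_distrib)
  qed
  have harm_J: "(\<lambda>n. harm (J n) / ln (real n)) \<longlonglongrightarrow> (1 :: real)"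
  proof -
    have "(\<lambda>n. harm (J n) / ln (real (J n)) * (ln (real (J n)) / ln (real n))) \<longlonglongrightarrow> 1 * (1::real)"
      by (intro tendsto_mult ln_J filterlim_compose[OF harm_ln J_top])
    moreover have "\<forall>\<^sub>F n in sequentially. harm (J n) / ln (real (J n)) * (ln (real (J n)) / ln (real n)) = harm (J n) / ln (real n)"
      using filterlim_at_top[THEN iffD1, OF J_top, rule_format, of 2]
      by eventually_elim (simp add: ln_eq_zero_iff)
    ultimately show ?thesis using Lim_transform_eventually by fastforce
  qed

  \<comment> \<open>Uniformity is obtained from a sequence: select the worst index
    \<open>js n\<close> up to \<open>J n\<close> and apply \<open>h_ratio\<close> along
    \<open>n - js n\<close>.\<close>
  have "\<forall>n. \<exists>m. m \<le> J n \<and> (\<forall>j\<le>J n. \<bar>w n j - 1\<bar> \<le> \<bar>w n m - 1\<bar>)"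
  proof
    fix n
    let ?D = "(\<lambda>j. \<bar>w n j - 1\<bar>) ` {..J n}"
    have "Max ?D \<in> ?D" by (intro Max_in) auto
    then obtain m where "m \<in> {..J n}" "Max ?D = \<bar>w n m - 1\<bar>" by blast
    moreover have "\<bar>w n j - 1\<bar> \<le> Max ?D" if "j \<le> J n" for j
      using that by (intro Max_ge) auto
    ultimately show "\<exists>m. m \<le> J n \<and> (\<forall>j\<le>J n. \<bar>w n j - 1\<bar> \<le> \<bar>w n m - 1\<bar>)"
      by (metis atMost_iff)
  qed
  then obtain js where js: "js n \<le> J n" "j \<le> J n \<Longrightarrow> \<bar>w n j - 1\<bar> \<le> \<bar>w n (js n) - 1\<bar>" for n j
    by metis
  have js_over: "(\<lambda>n. real (js n) / real n) \<longlonglongrightarrow> 0"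
    by (rule tendsto_sandwich[OF _ _ tendsto_const J_over]) (auto intro!: always_eventually divide_right_mono js(1))
  have "(\<lambda>n. h (n - js n) / h n) \<longlonglongrightarrow> 1"
  proof (rule h_ratio)
    have "(\<lambda>n. 1 - real (js n) / real n) \<longlonglongrightarrow> 1 - 0" by (intro tendsto_intros js_over)
    moreover have "\<forall>\<^sub>F n in sequentially. 1 - real (js n) / real n = real (n - js n) / real n"
      using J_le eventually_gt_at_top[of 0]
    proof eventually_elim
      case (elim n)
      then have "js n \<le> n" using js(1)[of n] by linarith
      then show ?case using elim by (simp add: of_nat_diff field_simps)
    qed
    ultimately show "(\<lambda>n. real (n - js n) / real n) \<longlonglongrightarrow> 1"
      using Lim_transform_eventually by fastforce
  qed simp
  then have "(\<lambda>n. w n (js n) - 1) \<longlonglongrightarrow> 1 - 1" unfolding w_def by (intro tendsto_intros)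
  then have dev: "(\<lambda>n. \<bar>w n (js n) - 1\<bar>) \<longlonglongrightarrow> 0" by (auto dest: tendsto_rabs)

  have head: "(\<lambda>n. (\<Sum>j=1..J n. w n j / real j) / ln (real n)) \<longlonglongrightarrow> 1"
  proof -
    have "(\<lambda>n. \<bar>w n (js n) - 1\<bar> * (harm (J n) / ln (real n))) \<longlonglongrightarrow> 0 * 1"
      by (intro tendsto_intros dev harm_J)
    then have up: "(\<lambda>n. \<bar>w n (js n) - 1\<bar> * (harm (J n) / ln (real n))) \<longlonglongrightarrow> 0" by simp
    have "(\<lambda>n. (\<Sum>j=1..J n. (w n j - 1) / real j) / ln (real n)) \<longlonglongrightarrow> 0"
    proof (rule Lim_null_comparison[OF _ up])
      show "\<forall>\<^sub>F n in sequentially. norm ((\<Sum>j=1..J n. (w n j - 1) / real j) / ln (real n))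
          \<le> \<bar>w n (js n) - 1\<bar> * (harm (J n) / ln (real n))"
        using eventually_gt_at_top[of 1]
      proof eventually_elim
        case (elim n)
        have "\<bar>\<Sum>j=1..J n. (w n j - 1) / real j\<bar> \<le> (\<Sum>j=1..J n. \<bar>w n (js n) - 1\<bar> / real j)"
          by (rule order_trans[OF sum_abs]) (auto intro!: sum_mono divide_right_mono js(2) simp: abs_divide)
        also have "\<dots> = \<bar>w n (js n) - 1\<bar> * harm (J n)"
          by (simp add: harm_def sum_distrib_left field_simps)
        finally show ?case using elim by (simp add: divide_right_mono abs_divide)
      qed
    qed
    from tendsto_add[OF this harm_J] show ?thesis
      by (simp add: harm_def add_divide_distrib[symmetric] sum.distrib[symmetric] inverse_eq_divide)
  qed
  have tail: "(\<lambda>n. (\<Sum>j=Suc (J n)..n. w n j / real j) / ln (real n)) \<longlonglongrightarrow> 0"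
  proof -
    have "(\<lambda>n. (1 / sqrt (ln (real n))) * (1 / (real n * h n / S n))) \<longlonglongrightarrow> 0 * (1 / \<theta>)"
    proof (intro tendsto_mult tendsto_divide h_over_S tendsto_const)
      show "(\<lambda>n. 1 / sqrt (ln (real n))) \<longlonglongrightarrow> 0" by real_asymp
    qed (use pos in auto)
    then have up: "(\<lambda>n. (1 / sqrt (ln (real n))) * (1 / (real n * h n / S n))) \<longlonglongrightarrow> 0" by simp
    show ?thesis
    proof (rule Lim_null_comparison[OF _ up])
      show "\<forall>\<^sub>F n in sequentially. norm ((\<Sum>j=Suc (J n)..n. w n j / real j) / ln (real n))
         \<le> (1 / sqrt (ln (real n))) * (1 / (real n * h n / S n))"
        using eventually_gt_at_top[of 1] eventually_h_pos
      proof eventually_elim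
        case (elim n)
        define L where "L = sqrt (ln (real n))"
        have L: "0 < L" "ln (real n) = L * L" using elim by (auto simp: L_def)
        have n0: "0 < real n" using elim by simp
        have Jb: "real n / L \<le> real (Suc (J n))"
          unfolding J_def L_def[symmetric] using L n0 by (simp add: floor_less_iff) linarith
        have "(\<Sum>j=Suc (J n)..n. w n j / real j) \<le> (\<Sum>j=Suc (J n)..n. w n j * (L / real n))"
        proof (rule sum_mono)
          fix j assume j: "j \<in> {Suc (J n)..n}"
          have "real n / L \<le> real j" using Jb j by (simp add: order_trans)
          then have "1 / real j \<le> L / real n" using L n0 j by (simp add: field_simps)
          then show "w n j / real j \<le> w n j * (L / real n)"
            using mult_left_mono[OF _ w_nonneg[of n j], of "1 / real j" "L / real n"] by simp
        qed
        also have "\<dots> \<le> (\<Sum>j=1..n. w n j * (L / real n))"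
          using L n0 w_nonneg by (intro sum_mono2) auto
        also have "\<dots> = S n / h n * (L / real n)"
          unfolding sum_distrib_right[symmetric] w_def sum_divide_distrib[symmetric]
          by (simp only: sum_reflect S_def)
        finally have "(\<Sum>j=Suc (J n)..n. w n j / real j) / ln (real n) \<le> S n / h n * (L / real n) / (L * L)"
          unfolding L(2) using L(1) by (intro divide_right_mono) auto
        also have "\<dots> = (1 / L) * (1 / (real n * h n / S n))"
          using L(1) by (simp add: field_simps)
        finally have 1: "(\<Sum>j=Suc (J n)..n. w n j / real j) / ln (real n) \<le> (1 / L) * (1 / (real n * h n / S n))" .
        have "0 \<le> (\<Sum>j=Suc (J n)..n. w n j / real j) / ln (real n)"
          using w_nonneg elim by (intro divide_nonneg_nonneg sum_nonneg) auto
        then show ?case using 1 by (simp add: L_def)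
      qed
    qed
  qed
  have ev: "\<forall>\<^sub>F n in sequentially. (\<Sum>j=1..J n. w n j / real j) / ln (real n) + (\<Sum>j=Suc (J n)..n. w n j / real j) / ln (real n)
      = (\<Sum>j=1..n. h (n - j) / (real j * h n * ln (real n)))"
    using J_le
  proof eventually_elim
    case (elim n)
    have "(\<Sum>j=1..n. w n j / real j) = (\<Sum>j=1..J n. w n j / real j) + (\<Sum>j=Suc (J n)..n. w n j / real j)"
      using elim sum.ub_add_nat[of 1 "J n" "\<lambda>j. w n j / real j" "n - J n"] by simp
    moreover have "(\<Sum>j=1..n. h (n - j) / (real j * h n * ln (real n))) = (\<Sum>j=1..n. w n j / real j) / ln (real n)"
      by (simp add: sum_divide_distrib w_def mult_ac)
    ultimately show ?case by (simp only: add_divide_distrib)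
  qed
  from tendsto_add[OF head tail] have "(\<lambda>n. (\<Sum>j=1..J n. w n j / real j) / ln (real n) + (\<Sum>j=Suc (J n)..n. w n j / real j) / ln (real n)) \<longlonglongrightarrow> 1"
    by simp
  then show ?thesis by (rule Lim_transform_eventually[OF _ ev])
qed

text \<open>A Toeplitz average of the parameters with the weights just treated; a fixed column
  vanishes because of the factor \<open>1 / ln n\<close>.\<close>

lemma mean_number_of_cycles:
  "(\<lambda>n. (\<Sum>j=1..n. \<theta>s j / real j * h (n - j)) / h n / ln (real n)) \<longlonglongrightarrow> \<theta>"
proof -
  have "(\<lambda>n. \<Sum>j=1..n. h (n - j) / (real j * h n * ln (real n)) * \<theta>s j) \<longlonglongrightarrow> 1 * \<theta>"
  proof (rule toeplitz_tendsto[OF _ harmonic_weighted_mean _ lim])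
    show "0 \<le> h (n - j) / (real j * h n * ln (real n))" if "1 \<le> j" "j \<le> n" for n j
      using that h_nonneg by simp
    fix j :: nat assume "1 \<le> j"
    have "(\<lambda>n. 1 / (real j * ln (real n))) \<longlonglongrightarrow> 0" using \<open>1 \<le> j\<close> by real_asymp
    from tendsto_mult[OF h_shift_ratio[of j] this]
    show "(\<lambda>n. h (n - j) / (real j * h n * ln (real n))) \<longlonglongrightarrow> 0" by (simp add: mult_ac)
  qed
  then show ?thesis by (simp add: sum_divide_distrib mult_ac)
qed

end

section \<open>Cycle counts\<close>

definition weight :: "(nat \<Rightarrow> real) \<Rightarrow> nat multiset \<Rightarrow> real" where
  "weight \<theta>s M = (\<Prod>j\<in>#M. \<theta>s j)"

lemma weight_simps [simp]:
  "weight \<theta>s {#} = 1" "weight \<theta>s (add_mset j M) = \<theta>s j * weight \<theta>s M"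
  by (simp_all add: weight_def)

lemma weight_replicate: "weight \<theta>s (M + replicate_mset r j) = \<theta>s j ^ r * weight \<theta>s M"
  by (induction r) (simp_all add: mult_ac)

text \<open>Trades the absence of length \<open>j\<close> for a change of one parameter, which
  leaves the limit \<open>\<theta>\<close> intact, so that the renewal asymptotics apply
  again.\<close>

lemma weight_zero_at: "weight (\<theta>s(j := 0)) M = of_bool (count M j = 0) * weight \<theta>s M"
proof (induction M)
  case (add x M)
  then show ?case by (cases "x = j") auto
qed simp

lemma wt_eq_weight:
  assumes "\<sigma> permutes {1..n}"
  shows "wt \<theta>s n \<sigma> = weight \<theta>s (cycle_type n \<sigma>)"
  unfolding wt_def weight_def image_prod_mset_multiplicity count_cycle_type
  using cycle_type_bounds[OF assms]
  by (intro prod.mono_neutral_right) (auto simp: count_cycle_type[symmetric] not_in_iff)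

lemma hn_eq_perm_avg: "hn \<theta>s n = perm_avg n (weight \<theta>s)"
  unfolding hn_def perm_avg_def by (simp add: wt_eq_weight perms_def)

lemma wt_nonneg:
  assumes "\<And>j. 1 \<le> j \<Longrightarrow> 0 \<le> \<theta>s j"
  shows "0 \<le> wt \<theta>s n \<sigma>"
  unfolding wt_def using assms by (intro prod_nonneg) auto

lemma hn_nonneg:
  assumes "\<And>j. 1 \<le> j \<Longrightarrow> 0 \<le> \<theta>s j"
  shows "0 \<le> hn \<theta>s n"
  unfolding hn_def using wt_nonneg[OF assms] by (intro mult_nonneg_nonneg sum_nonneg) auto

text \<open>For \<open>hn \<theta>s n = 0\<close> division by zero makes both the density and the
  right-hand side 0, so the formula may be used at every \<open>n\<close>.\<close>

lemma integral_Pn: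
  assumes nonneg: "\<And>j. 1 \<le> j \<Longrightarrow> 0 \<le> \<theta>s j"
    and G: "\<And>\<sigma>. \<sigma> permutes {1..n} \<Longrightarrow> G \<sigma> = F (cycle_type n \<sigma>)"
  shows "(\<integral>\<sigma>. G \<sigma> \<partial>Pn \<theta>s n) = perm_avg n (\<lambda>M. weight \<theta>s M * F M) / hn \<theta>s n"
proof -
  have "(\<integral>\<sigma>. G \<sigma> \<partial>Pn \<theta>s n) = (\<integral>\<sigma>. (wt \<theta>s n \<sigma> / (fact n * hn \<theta>s n)) *\<^sub>R G \<sigma> \<partial>count_space (perms n))"
    unfolding Pn_def using wt_nonneg[OF nonneg] hn_nonneg[of \<theta>s n, OF nonneg]
    by (intro integral_density) auto
  also have "\<dots> = (\<Sum>\<sigma>\<in>perms n. (wt \<theta>s n \<sigma> / (fact n * hn \<theta>s n)) * G \<sigma>)"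
    by (simp add: lebesgue_integral_count_space_finite sum_divide_distrib)
  also have "\<dots> = (\<Sum>\<sigma>\<in>perms n. weight \<theta>s (cycle_type n \<sigma>) * F (cycle_type n \<sigma>)) / (fact n * hn \<theta>s n)"
    by (simp add: sum_divide_distrib wt_eq_weight G perms_def)
  finally show ?thesis by (simp add: perm_avg_def)
qed

lemma renewal_hn:
  assumes nonneg: "\<And>j. 1 \<le> j \<Longrightarrow> 0 \<le> \<theta>s j" and lim: "\<theta>s \<longlonglongrightarrow> \<theta>" and pos: "0 < \<theta>"
  shows "renewal \<theta>s (hn \<theta>s) \<theta>"
proof
  show "hn \<theta>s 0 = 1" by (simp add: hn_eq_perm_avg)
  show "real n * hn \<theta>s n = (\<Sum>j=1..n. \<theta>s j * hn \<theta>s (n - j))" for n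
    unfolding hn_eq_perm_avg perm_avg_rec_and_count(1) by (simp add: perm_avg_cmult)
qed (use assms in auto)

text \<open>On the event of \<open>Suc r\<close> cycles of length \<open>j\<close> the factor
  \<open>count M j / Suc r\<close> equals 1; inserting it allows one such cycle to be removed at the
  cost of \<open>1 / j\<close>. Iteration produces \<open>j ^ r * fact r\<close>.\<close>

lemma perm_avg_count_eq:
  assumes j: "1 \<le> j"
  shows "perm_avg n (\<lambda>M. of_bool (count M j = r) * F M) =
    (if j * r \<le> n
     then 1 / (real j ^ r * fact r) *
       perm_avg (n - j * r) (\<lambda>M. of_bool (count M j = 0) * F (M + replicate_mset r j))
     else 0)"
proof (induction r arbitrary: n F)
  case (Suc r)
  have "perm_avg n (\<lambda>M. of_bool (count M j = Suc r) * F M) =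
      perm_avg n (\<lambda>M. (1 / real (Suc r)) * (real (count M j) * (of_bool (count M j = Suc r) * F M)))"
    by (rule perm_avg_cong) auto
  also have "\<dots> = (1 / real (Suc r)) * perm_avg n (\<lambda>M. real (count M j) * (of_bool (count M j = Suc r) * F M))"
    by (rule perm_avg_cmult)
  finally have step: "perm_avg n (\<lambda>M. of_bool (count M j = Suc r) * F M) = \<dots>" .
  show ?case
  proof (cases "j \<le> n")
    case True
    have "real j * perm_avg n (\<lambda>M. real (count M j) * (of_bool (count M j = Suc r) * F M)) =
        perm_avg (n - j) (\<lambda>M. of_bool (count M j = r) * F (M + {#j#}))"
      by (subst perm_avg_rec_and_count(2)[OF j True]) simp
    also have "\<dots> = (if j * r \<le> n - j
     then 1 / (real j ^ r * fact r) *
       perm_avg (n - j - j * r) (\<lambda>M. of_bool (count M j = 0) * F (M + replicate_mset r j + {#j#}))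
     else 0)" by (rule Suc.IH)
    finally have "perm_avg n (\<lambda>M. real (count M j) * (of_bool (count M j = Suc r) * F M)) =
      (1 / real j) * (if j * r \<le> n - j
     then 1 / (real j ^ r * fact r) *
       perm_avg (n - j - j * r) (\<lambda>M. of_bool (count M j = 0) * F (M + replicate_mset r j + {#j#}))
     else 0)" using j by (simp add: field_simps)
    then show ?thesis unfolding step using True by (auto simp: field_simps)
  next
    case False
    have "perm_avg n (\<lambda>M. real (count M j) * (of_bool (count M j = Suc r) * F M)) = perm_avg n (\<lambda>M. 0)"
      using False by (intro perm_avg_cong) (simp add: count_cycle_type Rcyc_eq_0)
    then have "perm_avg n (\<lambda>M. real (count M j) * (of_bool (count M j = Suc r) * F M)) = 0"
      by (simp add: perm_avg_def)
    then show ?thesis unfolding step using False by auto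
  qed
qed simp

lemma perm_avg_weight_count_eq:
  assumes j: "1 \<le> j" and G: "\<And>M. G (add_mset j M) = G M"
  shows "perm_avg n (\<lambda>M. weight \<theta>s M * (of_bool (count M j = r) * G M)) =
    (if j * r \<le> n
     then (\<theta>s j / real j) ^ r / fact r * perm_avg (n - j * r) (\<lambda>M. weight (\<theta>s(j := 0)) M * G M)
     else 0)"
proof -
  have G': "G (M + replicate_mset r j) = G M" for M r
    by (induction r) (simp_all add: G)
  have eq: "perm_avg m (\<lambda>M. of_bool (count M j = 0) * (\<theta>s j ^ r * weight \<theta>s M * G M)) =
      \<theta>s j ^ r * perm_avg m (\<lambda>M. weight (\<theta>s(j := 0)) M * G M)" for m
    by (simp add: weight_zero_at perm_avg_cmult[symmetric] mult_ac)
  have "perm_avg n (\<lambda>M. weight \<theta>s M * (of_bool (count M j = r) * G M)) =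
      perm_avg n (\<lambda>M. of_bool (count M j = r) * (weight \<theta>s M * G M))"
    by (simp add: mult_ac)
  also have "\<dots> = (if j * r \<le> n
     then 1 / (real j ^ r * fact r) *
       (\<theta>s j ^ r * perm_avg (n - j * r) (\<lambda>M. weight (\<theta>s(j := 0)) M * G M))
     else 0)"
    by (subst perm_avg_count_eq[OF j]) (simp only: weight_replicate G' eq)
  finally show ?thesis
    by (simp add: power_divide)
qed

lemma Rcyc_le: "Rcyc n j \<sigma> \<le> n"
proof -
  have "Rcyc n j \<sigma> \<le> card (cycles_of n \<sigma>)"
    unfolding Rcyc_def by (intro card_mono) auto
  also have "\<dots> \<le> n"
    unfolding cycles_of_def using card_image_le[of "{1..n}" "orbit \<sigma>"] by simp
  finally show ?thesis .
qed

lemma hn_remove_weight: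
  assumes j: "1 \<le> j"
  shows "hn \<theta>s n = (\<Sum>r\<le>n. if j * r \<le> n then (\<theta>s j / real j) ^ r / fact r * hn (\<theta>s(j := 0)) (n - j * r) else 0)"
proof -
  have "hn \<theta>s n = perm_avg n (\<lambda>M. \<Sum>r\<le>n. weight \<theta>s M * (of_bool (count M j = r) * 1))"
    unfolding hn_eq_perm_avg
    by (rule perm_avg_cong)
       (simp add: of_bool_def if_distrib[of "\<lambda>x. weight _ _ * x"] count_cycle_type Rcyc_le cong: if_cong)
  then show ?thesis
    unfolding perm_avg_sum
    by (simp add: perm_avg_weight_count_eq[OF j, where G = "\<lambda>_. 1", simplified] hn_eq_perm_avg cong: if_cong)
qed

text \<open>The expansion of \<open>hn_remove_weight\<close> is summed over \<open>n\<close> first: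
  ratios of the monotone sums \<open>Y.S\<close> are at most 1, which makes \<open>c\<close> a
  summable dominating sequence. Both parameter sequences share the limit \<open>\<theta>\<close>, so
  \<open>h_over_S\<close> carries the result back to \<open>hn\<close>.\<close>

lemma hn_ratio_remove_weight:
  assumes nonneg: "\<And>j. 1 \<le> j \<Longrightarrow> 0 \<le> \<theta>s j" and lim: "\<theta>s \<longlonglongrightarrow> \<theta>" and pos: "0 < \<theta>"
    and j: "1 \<le> j"
  shows "(\<lambda>n. hn (\<theta>s(j := 0)) n / hn \<theta>s n) \<longlonglongrightarrow> exp (- (\<theta>s j / real j))"
proof -
  define \<theta>' where "\<theta>' = \<theta>s(j := 0)"
  interpret X: renewal \<theta>s "hn \<theta>s" \<theta> by (rule renewal_hn[OF nonneg lim pos])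
  have lim': "\<theta>' \<longlonglongrightarrow> \<theta>"
  proof (rule Lim_transform_eventually[OF lim])
    show "\<forall>\<^sub>F i in sequentially. \<theta>s i = \<theta>' i"
      using eventually_gt_at_top[of j] by eventually_elim (simp add: \<theta>'_def)
  qed
  interpret Y: renewal \<theta>' "hn \<theta>'" \<theta> by (rule renewal_hn[OF _ lim' pos]) (simp add: \<theta>'_def nonneg)
  define c where "c r = (\<theta>s j / real j) ^ r / fact r" for r
  have c_nonneg: "0 \<le> c r" for r using nonneg[OF j] by (simp add: c_def)
  have c_sums: "c sums exp (\<theta>s j / real j)"
    using exp_converges[of "\<theta>s j / real j"] by (simp add: c_def[abs_def] field_simps)
  \<comment> \<open>Truncated subtraction and \<open>S 0 = 0\<close> remove all terms with
    \<open>j * r \<ge> n\<close>, so the finite sum can be written as a series whose range is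
    independent of \<open>n\<close>.\<close>
  have XS: "X.S n = (\<Sum>r. c r * Y.S (n - j * r))" for n
  proof -
    have "X.S n = (\<Sum>k<n. \<Sum>r\<le>k. if j * r \<le> k then c r * hn \<theta>' (k - j * r) else 0)"
      unfolding X.S_def c_def \<theta>'_def by (intro sum.cong refl hn_remove_weight[OF j])
    also have "\<dots> = (\<Sum>k<n. \<Sum>r<n. if j * r \<le> k then c r * hn \<theta>' (k - j * r) else 0)"
    proof (rule sum.cong[OF refl])
      fix k assume k: "k \<in> {..<n}"
      have "(if j * r \<le> k then c r * hn \<theta>' (k - j * r) else 0) = 0" if "r \<in> {..<n} - {..k}" for r
      proof -
        have "k < 1 * r" using that by auto
        also have "\<dots> \<le> j * r" using j by (intro mult_right_mono) auto
        finally show ?thesis by simp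
      qed
      then show "(\<Sum>r\<le>k. if j * r \<le> k then c r * hn \<theta>' (k - j * r) else 0) =
          (\<Sum>r<n. if j * r \<le> k then c r * hn \<theta>' (k - j * r) else 0)"
        using k by (intro sum.mono_neutral_left) auto
    qed
    also have "\<dots> = (\<Sum>r<n. \<Sum>k<n. if j * r \<le> k then c r * hn \<theta>' (k - j * r) else 0)"
      by (rule sum.swap)
    also have "\<dots> = (\<Sum>r<n. c r * Y.S (n - j * r))"
    proof (rule sum.cong[OF refl])
      fix r
      have "(\<Sum>k<n. if j * r \<le> k then c r * hn \<theta>' (k - j * r) else 0) =
          (\<Sum>k\<in>{k\<in>{..<n}. j * r \<le> k}. c r * hn \<theta>' (k - j * r))"
        by (rule sum.inter_filter[symmetric]) simp
      also have "\<dots> = (\<Sum>k<n - j * r. c r * hn \<theta>' k)"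
        by (rule sum.reindex_bij_witness[of _ "\<lambda>k. k + j * r" "\<lambda>k. k - j * r"]) auto
      finally show "(\<Sum>k<n. if j * r \<le> k then c r * hn \<theta>' (k - j * r) else 0) = c r * Y.S (n - j * r)"
        by (simp add: Y.S_def sum_distrib_left)
    qed
    also have "\<dots> = (\<Sum>r. c r * Y.S (n - j * r))"
    proof (rule suminf_finite[symmetric])
      fix r assume "r \<notin> {..<n}"
      then have "n \<le> 1 * r" by auto
      also have "\<dots> \<le> j * r" using j by (intro mult_right_mono) auto
      finally show "c r * Y.S (n - j * r) = 0" by simp
    qed simp
    finally show ?thesis .
  qed
  have "(\<lambda>n. \<Sum>r. c r * (Y.S (n - j * r) / Y.S n)) \<longlonglongrightarrow> (\<Sum>r. c r * 1)"
  proof (rule tannerys_theorem[THEN conjunct2, THEN conjunct2])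
    show "(\<lambda>n. c r * (Y.S (n - j * r) / Y.S n)) \<longlonglongrightarrow> c r * 1" for r
    proof (intro tendsto_mult tendsto_const)
      have "(\<lambda>n. real (n - j * r) / real n) \<longlonglongrightarrow> 1" by real_asymp
      from Y.S_ratio[OF _ this] show "(\<lambda>n. Y.S (n - j * r) / Y.S n) \<longlonglongrightarrow> 1" by simp
    qed
    have "norm (c k * (Y.S (n - j * k) / Y.S n)) \<le> c k" for k n
    proof -
      have "Y.S (n - j * k) / Y.S n \<le> 1"
        using Y.S_mono[of "n - j * k" n] Y.S_nonneg[of n] by (cases "Y.S n = 0") (auto simp: divide_le_eq)
      then show ?thesis
        using c_nonneg[of k] Y.S_nonneg[of n] Y.S_nonneg[of "n - j * k"]
          mult_left_mono[of "Y.S (n - j * k) / Y.S n" 1 "c k"] by (simp add: abs_mult)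
    qed
    then show "\<forall>\<^sub>F (k, n) in at_top \<times>\<^sub>F sequentially. norm (c k * (Y.S (n - j * k) / Y.S n)) \<le> c k"
      by (intro always_eventually) auto
    show "summable c" using c_sums by (rule sums_summable)
  qed simp
  moreover have "(\<Sum>r. c r * (Y.S (n - j * r) / Y.S n)) = X.S n / Y.S n" for n
  proof -
    have "summable (\<lambda>r. c r * Y.S (n - j * r))"
    proof (rule summable_finite[of "{..<n}"])
      fix r assume "r \<notin> {..<n}"
      then have "n \<le> 1 * r" by auto
      also have "\<dots> \<le> j * r" using j by (intro mult_right_mono) auto
      finally show "c r * Y.S (n - j * r) = 0" by simp
    qed simp
    from suminf_divide[OF this, of "Y.S n"] show ?thesis by (simp add: XS)
  qed
  ultimately have XY: "(\<lambda>n. X.S n / Y.S n) \<longlonglongrightarrow> exp (\<theta>s j / real j)"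
    using sums_unique[OF c_sums] by simp
  have "(\<lambda>n. (real n * hn \<theta>' n / Y.S n) / (real n * hn \<theta>s n / X.S n) / (X.S n / Y.S n))
      \<longlonglongrightarrow> \<theta> / \<theta> / exp (\<theta>s j / real j)"
    using pos by (intro tendsto_divide Y.h_over_S X.h_over_S XY) auto
  moreover have "\<forall>\<^sub>F n in sequentially. (real n * hn \<theta>' n / Y.S n) / (real n * hn \<theta>s n / X.S n) / (X.S n / Y.S n)
      = hn \<theta>' n / hn \<theta>s n"
    using eventually_gt_at_top[of 0]
    by eventually_elim (use X.S_pos Y.S_pos in \<open>simp add: field_simps less_imp_neq[symmetric]\<close>)
  ultimately have "(\<lambda>n. hn \<theta>' n / hn \<theta>s n) \<longlonglongrightarrow> \<theta> / \<theta> / exp (\<theta>s j / real j)"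
    by (rule Lim_transform_eventually)
  then show ?thesis using pos by (simp add: \<theta>'_def exp_minus inverse_eq_divide)
qed

text \<open>Prescribing the count of \<open>j\<close> replaces \<open>\<theta>s j\<close> by 0 and
  leaves the same problem for the other lengths, hence the induction over \<open>I\<close> with
  varying parameters. The product form obtained this way is the asymptotic independence.\<close>

lemma cycle_counts_joint_limit:
  assumes "finite I" "\<And>j. j \<in> I \<Longrightarrow> 1 \<le> j"
    and "\<And>j. 1 \<le> j \<Longrightarrow> 0 \<le> \<theta>s j" and "\<theta>s \<longlonglongrightarrow> \<theta>" and pos: "0 < \<theta>"
  shows "(\<lambda>n. perm_avg n (\<lambda>M. weight \<theta>s M * (\<Prod>j\<in>I. of_bool (count M j = r j))) / hn \<theta>s n)
     \<longlonglongrightarrow> (\<Prod>j\<in>I. (\<theta>s j / real j) ^ r j / fact (r j) * exp (- (\<theta>s j / real j)))"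
  using assms(1-4)
proof (induction I arbitrary: \<theta>s rule: finite_induct)
  case empty
  interpret X: renewal \<theta>s "hn \<theta>s" \<theta> by (rule renewal_hn[OF empty(2,3) pos])
  have "\<forall>\<^sub>F n in sequentially. 1 = perm_avg n (\<lambda>M. weight \<theta>s M) / hn \<theta>s n"
    using X.eventually_h_pos by eventually_elim (simp add: hn_eq_perm_avg)
  then show ?case by (auto intro: Lim_transform_eventually[OF tendsto_const])
next
  case (insert j I)
  define \<theta>' where "\<theta>' = \<theta>s(j := 0)"
  have j: "1 \<le> j" using insert.prems(1) by simp
  have nonneg': "0 \<le> \<theta>' i" if "1 \<le> i" for i using insert.prems(2) that by (simp add: \<theta>'_def)
  have lim': "\<theta>' \<longlonglongrightarrow> \<theta>"
  proof (rule Lim_transform_eventually[OF insert.prems(3)])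
    show "\<forall>\<^sub>F i in sequentially. \<theta>s i = \<theta>' i"
      using eventually_gt_at_top[of j] by eventually_elim (simp add: \<theta>'_def)
  qed
  interpret Y: renewal \<theta>' "hn \<theta>'" \<theta> by (rule renewal_hn[OF nonneg' lim' pos])
  define G :: "nat multiset \<Rightarrow> real" where "G M = (\<Prod>i\<in>I. of_bool (count M i = r i))" for M
  define E where "E n = perm_avg n (\<lambda>M. weight \<theta>' M * G M) / hn \<theta>' n" for n
  have G: "G (add_mset j M) = G M" for M
    unfolding G_def using insert.hyps by (intro prod.cong refl) auto
  have "E \<longlonglongrightarrow> (\<Prod>i\<in>I. (\<theta>' i / real i) ^ r i / fact (r i) * exp (- (\<theta>' i / real i)))"
    unfolding E_def G_def using insert.prems(1) nonneg' lim' by (intro insert.IH) auto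
  also have "(\<Prod>i\<in>I. (\<theta>' i / real i) ^ r i / fact (r i) * exp (- (\<theta>' i / real i))) =
      (\<Prod>i\<in>I. (\<theta>s i / real i) ^ r i / fact (r i) * exp (- (\<theta>s i / real i)))"
    using insert.hyps by (intro prod.cong refl) (auto simp: \<theta>'_def)
  finally have "E \<longlonglongrightarrow> (\<Prod>i\<in>I. (\<theta>s i / real i) ^ r i / fact (r i) * exp (- (\<theta>s i / real i)))" .
  moreover have sh: "filterlim (\<lambda>n. n - j * r j) sequentially sequentially"
    by (rule filterlim_minus_const_nat_at_top)
  ultimately have "(\<lambda>n. E (n - j * r j)) \<longlonglongrightarrow> (\<Prod>i\<in>I. (\<theta>s i / real i) ^ r i / fact (r i) * exp (- (\<theta>s i / real i)))"
    by (rule filterlim_compose)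
  \<comment> \<open>Two changes of normalization: shifting \<open>n\<close> by
    \<open>j * r j\<close> costs nothing in the limit, and restoring the parameter at
    \<open>j\<close> produces the exponential factor.\<close>
  then have "(\<lambda>n. (\<theta>s j / real j) ^ r j / fact (r j) * ((hn \<theta>' (n - j * r j) / hn \<theta>' n) * (hn \<theta>' n / hn \<theta>s n)) * E (n - j * r j))
      \<longlonglongrightarrow> (\<theta>s j / real j) ^ r j / fact (r j) * (1 * exp (- (\<theta>s j / real j))) *
        (\<Prod>i\<in>I. (\<theta>s i / real i) ^ r i / fact (r i) * exp (- (\<theta>s i / real i)))"
    unfolding \<theta>'_def using Y.h_shift_ratio[unfolded \<theta>'_def]
      hn_ratio_remove_weight[OF insert.prems(2,3) pos j]
    by (intro tendsto_mult tendsto_const) auto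
  moreover have "\<forall>\<^sub>F n in sequentially.
     (\<theta>s j / real j) ^ r j / fact (r j) * ((hn \<theta>' (n - j * r j) / hn \<theta>' n) * (hn \<theta>' n / hn \<theta>s n)) * E (n - j * r j)
     = perm_avg n (\<lambda>M. weight \<theta>s M * (\<Prod>j\<in>insert j I. of_bool (count M j = r j))) / hn \<theta>s n"
    using eventually_ge_at_top[of "j * r j"] Y.eventually_h_pos
      sh[unfolded filterlim_iff, rule_format, OF Y.eventually_h_pos]
  proof eventually_elim
    case (elim n)
    have "perm_avg n (\<lambda>M. weight \<theta>s M * (\<Prod>j\<in>insert j I. of_bool (count M j = r j))) =
        perm_avg n (\<lambda>M. weight \<theta>s M * (of_bool (count M j = r j) * G M))"
      using insert.hyps by (simp add: G_def)
    also have "\<dots> = (\<theta>s j / real j) ^ r j / fact (r j) * perm_avg (n - j * r j) (\<lambda>M. weight \<theta>' M * G M)"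
      using elim perm_avg_weight_count_eq[OF j, where G = G, OF G] by (simp add: \<theta>'_def)
    finally show ?case using elim by (simp add: E_def)
  qed
  ultimately show ?case using insert.hyps by (auto intro: Lim_transform_eventually)
qed

section \<open>Weak convergence for sequences of natural numbers\<close>

lemma sets_PiM_count_space_eq_borel:
  "sets (PiM UNIV (\<lambda>_. count_space UNIV) :: (nat \<Rightarrow> nat) measure) = sets borel"
proof -
  have "sets (PiM UNIV (\<lambda>_. count_space UNIV) :: (nat \<Rightarrow> nat) measure) = sets (PiM UNIV (\<lambda>_. borel))"
    by (rule sets_PiM_cong) (simp_all add: sets_borel_eq_count_space)
  then show ?thesis by (simp add: sets_PiM_equal_borel)
qed

lemma cylinder_sets_PiM:
  "{x. \<forall>i<k. x i = r i} \<in> sets (PiM UNIV (\<lambda>_. count_space UNIV) :: (nat \<Rightarrow> nat) measure)"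
proof -
  have "{x \<in> space (PiM UNIV (\<lambda>_. count_space UNIV)). \<forall>i<k. x i = r i}
      \<in> sets (PiM UNIV (\<lambda>_. count_space UNIV) :: (nat \<Rightarrow> nat) measure)"
    by measurable
  then show ?thesis by (simp add: space_PiM)
qed

text \<open>A nonnegative continuous function is approximated from below by functions that depend on
  finitely many coordinates and take finitely many nonzero values: the infimum over the cylinder,
  restricted to a finite set of cylinders. No tightness is needed.\<close>

lemma liminf_integral_of_cylinder_convergence:
  fixes M :: "nat \<Rightarrow> (nat \<Rightarrow> nat) measure" and f :: "(nat \<Rightarrow> nat) \<Rightarrow> real"
  assumes sets: "\<And>n. sets (M n) = sets (PiM UNIV (\<lambda>_. count_space UNIV))"
    and sets_L: "sets L = sets (PiM UNIV (\<lambda>_. count_space UNIV))"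
    and prob: "\<forall>\<^sub>F n in sequentially. prob_space (M n)" and "prob_space L"
    and conv: "\<And>k r. (\<lambda>n. measure (M n) {x. \<forall>i<k. x i = r i}) \<longlonglongrightarrow> measure L {x. \<forall>i<k. x i = r i}"
    and cont: "continuous_on UNIV f" and f: "\<And>x. 0 \<le> f x" "\<And>x. f x \<le> B"
    and e: "0 < e"
  shows "\<forall>\<^sub>F n in sequentially. (\<integral>x. f x \<partial>L) - e < (\<integral>x. f x \<partial>M n)"
proof -
  interpret L: prob_space L by fact
  define T where "T k x = map x [0..<k]" for k and x :: "nat \<Rightarrow> nat"
  define c where "c k l = Inf (f ` {y. T k y = l})" for k l
  have T_eq: "T k x = l \<longleftrightarrow> length l = k \<and> (\<forall>i<k. x i = l ! i)" for k x l
    unfolding T_def list_eq_iff_nth_eq by auto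
  have T_sets: "{x. T k x = l} \<in> sets (PiM UNIV (\<lambda>_. count_space UNIV))" for k l
    unfolding T_eq by (cases "length l = k") (simp_all add: cylinder_sets_PiM)
  have T_meas: "T k \<in> measurable N (count_space UNIV)"
    if "sets N = sets (PiM UNIV (\<lambda>_. count_space UNIV))" for N k
  proof -
    have "T k -` {l} \<inter> space N \<in> sets N" for l
      using T_sets[of k l] sets_eq_imp_space_eq[OF that] that by (simp add: vimage_def space_PiM)
    then show ?thesis by (subst measurable_count_space_eq2_countable) auto
  qed
  have f_meas: "f \<in> borel_measurable N" if "sets N = sets (PiM UNIV (\<lambda>_. count_space UNIV))" for N
    using borel_measurable_continuous_onI[OF cont] that sets_PiM_count_space_eq_borel
    by (simp cong: measurable_cong_sets)
  have bdd: "bdd_below (f ` X)" for X using f(1) by (auto intro!: bdd_belowI[of _ 0])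
  have c_le: "c k (T k x) \<le> f x" for k x
    unfolding c_def using bdd by (intro cInf_lower) auto
  have c_nonneg: "0 \<le> c k (T k x)" for k x
    unfolding c_def using f(1) by (intro cInf_greatest) auto
  have c_tendsto: "(\<lambda>k. c k (T k x)) \<longlonglongrightarrow> f x" for x
  \<comment> \<open>A basic neighbourhood in the product topology restricts finitely many
    coordinates; a cylinder fixing all of them lies inside it. Half of \<open>d\<close> is used
    since an infimum preserves only the weak inequality.\<close>
  proof (rule LIMSEQ_I)
    fix d :: real assume d: "0 < d"
    have "open (f -` {f x - d / 2<..})"
      using cont by (intro open_vimage) auto
    moreover have "x \<in> f -` {f x - d / 2<..}" using d by simp
    ultimately obtain X where X: "x \<in> Pi\<^sub>E UNIV X" "\<And>i. open (X i)" "finite {i. X i \<noteq> UNIV}"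
        "Pi\<^sub>E UNIV X \<subseteq> f -` {f x - d / 2<..}"
      using product_topology_open_contains_basis[of "\<lambda>_. euclidean" UNIV "f -` {f x - d / 2<..}" x]
      unfolding open_fun_def by auto
    obtain K where K: "{i. X i \<noteq> UNIV} \<subseteq> {..<K}"
      using X(3) by (metis finite_nat_iff_bounded)
    have "norm (c k (T k x) - f x) < d" if "K \<le> k" for k
    proof -
      have "f x - d / 2 \<le> c k (T k x)"
        unfolding c_def
      proof (rule cInf_greatest)
        fix u assume "u \<in> f ` {y. T k y = T k x}"
        then obtain y where y: "u = f y" "T k y = T k x" by auto
        have "y i = x i" if "i < k" for i using y(2) that by (simp add: T_def)
        moreover have "X i = UNIV" if "\<not> i < k" for i using K that \<open>K \<le> k\<close> by auto
        ultimately have "y \<in> Pi\<^sub>E UNIV X" using X(1) by (auto simp: PiE_iff) (metis UNIV_I)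
        then show "f x - d / 2 \<le> u" using X(4) y(1) by auto
      qed auto
      then show ?thesis using c_le[of k x] d by (simp add: abs_if)
    qed
    then show "\<exists>K. \<forall>k\<ge>K. norm (c k (T k x) - f x) < d" by blast
  qed
  note [measurable] = f_meas[OF sets_L] T_meas[OF sets_L]
  have c_B: "\<bar>c k (T k x)\<bar> \<le> B" for k x
    using c_le[of k x] c_nonneg[of k x] f(2)[of x] by linarith
  have cT_meas: "(\<lambda>x. c k (T k x)) \<in> borel_measurable L" for k
    using measurable_compose[OF T_meas[OF sets_L], of "c k" borel k] by simp
  have "(\<lambda>k. \<integral>x. c k (T k x) \<partial>L) \<longlonglongrightarrow> (\<integral>x. f x \<partial>L)"
    using c_tendsto c_B cT_meas
    by (intro integral_dominated_convergence[where w = "\<lambda>_. B"]) auto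
  then have "\<forall>\<^sub>F k in sequentially. (\<integral>x. f x \<partial>L) - e < (\<integral>x. c k (T k x) \<partial>L)"
    using e by (intro order_tendstoD(1)) auto
  then obtain k where k: "(\<integral>x. f x \<partial>L) - e < (\<integral>x. c k (T k x) \<partial>L)"
    by (auto simp: eventually_sequentially)
  \<comment> \<open>Finitely many prefixes make the integral a finite combination of cylinder
    probabilities. The loss is controlled under \<open>L\<close> alone; under \<open>M n\<close>
    only \<open>u m \<le> f\<close> is used.\<close>
  define A where "A m = {l :: nat list. set l \<subseteq> {..m} \<and> length l = k}" for m
  define u where "u m x = of_bool (T k x \<in> A m) * c k (T k x)" for m x
  have u_meas: "u m \<in> borel_measurable L" for m
    unfolding u_def using measurable_compose[OF T_meas[OF sets_L], of "\<lambda>l. of_bool (l \<in> A m) * c k l" borel k] by simp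
  have "(\<lambda>m. \<integral>x. u m x \<partial>L) \<longlonglongrightarrow> (\<integral>x. c k (T k x) \<partial>L)"
  proof (rule integral_dominated_convergence[where w = "\<lambda>_. B"])
    show "AE x in L. (\<lambda>m. u m x) \<longlonglongrightarrow> c k (T k x)"
    proof (rule AE_I2)
      fix x
      have "\<forall>\<^sub>F m in sequentially. u m x = c k (T k x)"
        using eventually_ge_at_top[of "Max (insert 0 (set (T k x)))"]
      proof eventually_elim
        case (elim m)
        have "set (T k x) \<subseteq> {..m}"
        proof
          fix y assume "y \<in> set (T k x)"
          then show "y \<in> {..m}" using elim by auto
        qed
        then show ?case by (simp add: u_def A_def T_def)
      qed
      then show "(\<lambda>m. u m x) \<longlonglongrightarrow> c k (T k x)" by (rule tendsto_eventually)
    qed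
    have "0 \<le> B" using f[of undefined] by linarith
    then show "AE x in L. norm (u m x) \<le> B" for m
      using c_B by (auto simp: u_def)
  qed (use u_meas cT_meas in auto)
  then have "\<forall>\<^sub>F m in sequentially. (\<integral>x. f x \<partial>L) - e < (\<integral>x. u m x \<partial>L)"
    using k by (intro order_tendstoD(1)) auto
  then obtain m where m: "(\<integral>x. f x \<partial>L) - e < (\<integral>x. u m x \<partial>L)"
    by (auto simp: eventually_sequentially)
  have fin: "finite (A m)" unfolding A_def by (rule finite_lists_length_eq) simp
  have u_sum: "u m x = (\<Sum>l\<in>A m. c k l * indicator {x. T k x = l} x)" for x
  proof -
    have "(\<Sum>l\<in>A m. c k l * indicator {x. T k x = l} x) = (\<Sum>l\<in>A m. if T k x = l then c k l else 0)"
      by (intro sum.cong) (auto simp: indicator_def)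
    then show ?thesis using fin by (simp add: u_def)
  qed
  have int_u: "(\<integral>x. u m x \<partial>N) = (\<Sum>l\<in>A m. c k l * measure N {x. T k x = l})"
    if "prob_space N" and N: "sets N = sets (PiM UNIV (\<lambda>_. count_space UNIV))" for N
  proof -
    interpret prob_space N by fact
    have sp: "space N = UNIV" using sets_eq_imp_space_eq[OF N] by (simp add: space_PiM)
    have S: "{x. T k x = l} \<in> sets N" for l using T_sets N by simp
    have "integrable N (indicator {x. T k x = l} :: _ \<Rightarrow> real)" for l
      using S by (intro integrable_real_indicator) (auto simp: emeasure_eq_measure)
    then show ?thesis
      unfolding u_sum by (subst Bochner_Integration.integral_sum) (auto simp: sp)
  qed
  have "(\<lambda>n. \<Sum>l\<in>A m. c k l * measure (M n) {x. T k x = l}) \<longlonglongrightarrow> (\<Sum>l\<in>A m. c k l * measure L {x. T k x = l})"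
  proof (intro tendsto_sum tendsto_mult tendsto_const)
    fix l assume "l \<in> A m"
    then have "{x. T k x = l} = {x. \<forall>i<k. x i = l ! i}" by (auto simp: T_eq A_def)
    then show "(\<lambda>n. measure (M n) {x. T k x = l}) \<longlonglongrightarrow> measure L {x. T k x = l}"
      using conv[of k "\<lambda>i. l ! i"] by simp
  qed
  then have "\<forall>\<^sub>F n in sequentially. (\<integral>x. f x \<partial>L) - e < (\<Sum>l\<in>A m. c k l * measure (M n) {x. T k x = l})"
    using m int_u[OF \<open>prob_space L\<close> sets_L] by (intro order_tendstoD(1)) auto
  with prob show ?thesis
  proof eventually_elim
    case (elim n)
    interpret prob_space "M n" by fact
    have "(\<integral>x. u m x \<partial>M n) \<le> (\<integral>x. f x \<partial>M n)"
    proof (rule integral_mono_AE')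
      show "integrable (M n) f"
        using f f_meas[OF sets] by (intro integrable_const_bound[of _ B]) auto
      show "AE x in M n. u m x \<le> f x" using c_le f(1) by (auto simp: u_def)
      show "AE x in M n. 0 \<le> f x" using f(1) by simp
    qed
    then show ?case using elim int_u[OF elim(1) sets] by simp
  qed
qed

text \<open>The one-sided estimate is applied to \<open>f + B\<close> and to \<open>- f + B\<close>,
  both with values between 0 and \<open>2 * B\<close>.\<close>

lemma converges_weakly_of_cylinder_convergence:
  fixes M :: "nat \<Rightarrow> (nat \<Rightarrow> nat) measure"
  assumes sets: "\<And>n. sets (M n) = sets (PiM UNIV (\<lambda>_. count_space UNIV))"
    and sets_L: "sets L = sets (PiM UNIV (\<lambda>_. count_space UNIV))"
    and prob: "\<forall>\<^sub>F n in sequentially. prob_space (M n)" and prob_L: "prob_space L"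
    and conv: "\<And>k r. (\<lambda>n. measure (M n) {x. \<forall>i<k. x i = r i}) \<longlonglongrightarrow> measure L {x. \<forall>i<k. x i = r i}"
  shows "converges_weakly M L"
  unfolding converges_weakly_def
proof (intro allI impI, elim conjE)
  fix f :: "(nat \<Rightarrow> nat) \<Rightarrow> real"
  assume cont: "continuous_on UNIV f" and "bounded (range f)"
  then obtain B where B: "\<And>x. \<bar>f x\<bar> \<le> B" unfolding bounded_iff by auto
  have int: "integrable N f" if "prob_space N" "sets N = sets (PiM UNIV (\<lambda>_. count_space UNIV))" for N
  proof -
    interpret prob_space N by fact
    have "f \<in> borel_measurable N"
      using borel_measurable_continuous_onI[OF cont] that(2) sets_PiM_count_space_eq_borel
      by (simp cong: measurable_cong_sets)
    then show ?thesis using B by (intro integrable_const_bound[of _ B]) auto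
  qed
  have shift: "(\<integral>x. s * f x + B \<partial>N) = s * (\<integral>x. f x \<partial>N) + B"
    if "prob_space N" "sets N = sets (PiM UNIV (\<lambda>_. count_space UNIV))" for N s
  proof -
    interpret prob_space N by fact
    show ?thesis using int[OF that] by (simp add: prob_space)
  qed
  have one_sided: "\<forall>\<^sub>F n in sequentially. s * (\<integral>x. f x \<partial>L) - e < s * (\<integral>x. f x \<partial>M n)"
    if s: "s = 1 \<or> s = - 1" and e: "0 < e" for s e
  proof -
    have "\<forall>\<^sub>F n in sequentially. (\<integral>x. s * f x + B \<partial>L) - e < (\<integral>x. s * f x + B \<partial>M n)"
    proof (rule liminf_integral_of_cylinder_convergence[OF sets sets_L prob prob_L conv _ _ _ e])
      show "continuous_on UNIV (\<lambda>x. s * f x + B)" by (intro continuous_intros cont)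
      show "0 \<le> s * f x + B" "s * f x + B \<le> 2 * B" for x
        using B[of x] s by (auto simp: abs_le_iff)
    qed
    with prob show ?thesis
      by eventually_elim (simp add: shift[OF prob_L sets_L] shift[OF _ sets])
  qed
  show "(\<lambda>n. \<integral>x. f x \<partial>M n) \<longlonglongrightarrow> (\<integral>x. f x \<partial>L)"
  proof (rule tendstoI)
    fix e :: real assume "0 < e"
    from one_sided[OF _ this, of 1, simplified] one_sided[OF _ this, of "-1", simplified]
    show "\<forall>\<^sub>F n in sequentially. dist (\<integral>x. f x \<partial>M n) (\<integral>x. f x \<partial>L) < e"
      by eventually_elim (simp add: dist_real_def abs_less_iff)
  qed
qed

section \<open>Poisson products and the limits (a) and (b)\<close>

lemma sets_poisson_measure [simp, measurable_cong]: "sets (poisson_measure r) = sets (count_space UNIV)"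
  and space_poisson_measure [simp]: "space (poisson_measure r) = UNIV"
  by (simp_all add: poisson_measure_def)

lemma emeasure_poisson_measure: "emeasure (poisson_measure r) {k} = ennreal (r ^ k / fact k * exp (- r))"
  unfolding poisson_measure_def by (subst emeasure_density) (simp_all add: nn_integral_count_space_indicator[symmetric] nn_integral_count_space_finite)

lemma prob_space_poisson_measure:
  assumes "0 \<le> r"
  shows "prob_space (poisson_measure r)"
proof
  have "(\<lambda>k. r ^ k / fact k) sums exp r"
    using exp_converges[of r] by (simp add: field_simps)
  then have "(\<lambda>k. r ^ k / fact k * exp (- r)) sums (exp r * exp (- r))" by (rule sums_mult2)
  then have s: "(\<lambda>k. r ^ k / fact k * exp (- r)) sums 1" by (simp add: exp_minus)
  have "emeasure (poisson_measure r) (space (poisson_measure r)) = (\<Sum>k. ennreal (r ^ k / fact k * exp (- r)))"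
    unfolding poisson_measure_def by (simp add: emeasure_density nn_integral_count_space_nat)
  also have "\<dots> = ennreal (\<Sum>k. r ^ k / fact k * exp (- r))"
    using s assms by (intro suminf_ennreal2) (auto simp: sums_iff)
  also have "\<dots> = 1" using s by (simp add: sums_iff)
  finally show "emeasure (poisson_measure r) (space (poisson_measure r)) = 1" .
qed

lemma measure_PiM_poisson_cylinder:
  fixes m :: "nat \<Rightarrow> real"
  assumes "\<And>i. 0 \<le> m i"
  shows "measure (PiM UNIV (\<lambda>i. poisson_measure (m i))) {x. \<forall>i<k. x i = r i} =
    (\<Prod>i<k. m i ^ r i / fact (r i) * exp (- m i))"
proof -
  interpret Q: prob_space "poisson_measure (m i)" for i
    by (rule prob_space_poisson_measure[OF assms])
  interpret product_prob_space "\<lambda>i. poisson_measure (m i)" UNIV ..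
  have "{x. \<forall>i<k. x i = r i} =
      {x \<in> space (PiM UNIV (\<lambda>i. poisson_measure (m i))). \<forall>i\<in>{..<k}. x i \<in> {r i}}"
    by (simp add: space_PiM lessThan_iff Ball_def)
  also have "emeasure (PiM UNIV (\<lambda>i. poisson_measure (m i))) \<dots> =
      (\<Prod>i<k. emeasure (poisson_measure (m i)) {r i})"
    by (rule emeasure_PiM_Collect) simp_all
  also have "\<dots> = ennreal (\<Prod>i<k. m i ^ r i / fact (r i) * exp (- m i))"
    unfolding emeasure_poisson_measure using assms by (intro prod_ennreal) auto
  finally show ?thesis using assms by (simp add: measure_def prod_nonneg)
qed

lemma space_Pn [simp]: "space (Pn \<theta>s n) = perms n"
  and sets_Pn [simp]: "sets (Pn \<theta>s n) = Pow (perms n)"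
  by (simp_all add: Pn_def)

lemma measurable_Pn: "space N = UNIV \<Longrightarrow> T \<in> measurable (Pn \<theta>s n) N"
  by (auto simp: measurable_def)

lemma prob_space_Pn:
  assumes nonneg: "\<And>j. 1 \<le> j \<Longrightarrow> 0 \<le> \<theta>s j" and pos: "0 < hn \<theta>s n"
  shows "prob_space (Pn \<theta>s n)"
proof
  have "emeasure (Pn \<theta>s n) (space (Pn \<theta>s n)) =
      (\<Sum>\<sigma>\<in>perms n. ennreal (wt \<theta>s n \<sigma> / (fact n * hn \<theta>s n)))"
    unfolding Pn_def by (simp add: emeasure_density nn_integral_count_space_finite)
  also have "\<dots> = ennreal (\<Sum>\<sigma>\<in>perms n. wt \<theta>s n \<sigma> / (fact n * hn \<theta>s n))"
    using pos wt_nonneg[OF nonneg] by (intro sum_ennreal) auto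
  also have "(\<Sum>\<sigma>\<in>perms n. wt \<theta>s n \<sigma> / (fact n * hn \<theta>s n)) = 1"
    using pos by (auto simp add: sum_divide_distrib[symmetric] hn_def)
  finally show "emeasure (Pn \<theta>s n) (space (Pn \<theta>s n)) = 1" by simp
qed

lemma cycle_counts_converge:
  assumes nonneg: "\<And>j. 1 \<le> j \<Longrightarrow> 0 \<le> \<theta>s j" and lim: "\<theta>s \<longlonglongrightarrow> \<theta>" and pos: "0 < \<theta>"
  shows "converges_weakly (\<lambda>n. distr (Pn \<theta>s n) (PiM UNIV (\<lambda>_. count_space UNIV)) (\<lambda>\<sigma> j. Rcyc n (Suc j) \<sigma>))
        (PiM UNIV (\<lambda>j. poisson_measure (\<theta>s (Suc j) / real (Suc j))))"
proof (rule converges_weakly_of_cylinder_convergence)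
  interpret X: renewal \<theta>s "hn \<theta>s" \<theta> by (rule renewal_hn[OF nonneg lim pos])
  let ?P = "PiM UNIV (\<lambda>_. count_space UNIV) :: (nat \<Rightarrow> nat) measure"
  let ?T = "\<lambda>n \<sigma> j. Rcyc n (Suc j) \<sigma>"
  have T_meas: "?T n \<in> measurable (Pn \<theta>s n) ?P" for n
    by (rule measurable_Pn) (simp add: space_PiM)
  show "sets (PiM UNIV (\<lambda>j. poisson_measure (\<theta>s (Suc j) / real (Suc j)))) = sets ?P"
    by (rule sets_PiM_cong) auto
  show "\<forall>\<^sub>F n in sequentially. prob_space (distr (Pn \<theta>s n) ?P (?T n))"
    using X.eventually_h_pos
    by eventually_elim (intro prob_space.prob_space_distr prob_space_Pn nonneg T_meas, auto)
  show "prob_space (PiM UNIV (\<lambda>j. poisson_measure (\<theta>s (Suc j) / real (Suc j))))"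
    by (intro prob_space_PiM prob_space_poisson_measure divide_nonneg_nonneg nonneg) auto
  fix k r
  have "measure (distr (Pn \<theta>s n) ?P (?T n)) {x. \<forall>i<k. x i = r i} =
     perm_avg n (\<lambda>M. weight \<theta>s M * (\<Prod>j\<in>Suc ` {..<k}. of_bool (count M j = r (j - 1)))) / hn \<theta>s n" for n
  proof -
    let ?C = "{x. \<forall>i<k. x i = r i}"
    have "measure (distr (Pn \<theta>s n) ?P (?T n)) ?C = (\<integral>x. indicator ?C x \<partial>distr (Pn \<theta>s n) ?P (?T n))"
      by (simp add: space_PiM)
    also have "\<dots> = (\<integral>\<sigma>. indicator ?C (?T n \<sigma>) \<partial>Pn \<theta>s n)"
      by (rule integral_distr[OF T_meas]) (simp add: cylinder_sets_PiM)
    also have "\<dots> = perm_avg n (\<lambda>M. weight \<theta>s M * (\<Prod>j\<in>Suc ` {..<k}. of_bool (count M j = r (j - 1)))) / hn \<theta>s n"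
      by (rule integral_Pn[OF nonneg])
         (auto simp: prod.reindex count_cycle_type indicator_def of_bool_def)
    finally show ?thesis .
  qed
  moreover have "(\<lambda>n. perm_avg n (\<lambda>M. weight \<theta>s M * (\<Prod>j\<in>Suc ` {..<k}. of_bool (count M j = r (j - 1)))) / hn \<theta>s n)
     \<longlonglongrightarrow> (\<Prod>j\<in>Suc ` {..<k}. (\<theta>s j / real j) ^ r (j - 1) / fact (r (j - 1)) * exp (- (\<theta>s j / real j)))"
    by (rule cycle_counts_joint_limit[OF _ _ nonneg lim pos, where r = "\<lambda>j. r (j - 1)"]) auto
  moreover have "measure (PiM UNIV (\<lambda>j. poisson_measure (\<theta>s (Suc j) / real (Suc j)))) {x. \<forall>i<k. x i = r i} =
     (\<Prod>j\<in>Suc ` {..<k}. (\<theta>s j / real j) ^ r (j - 1) / fact (r (j - 1)) * exp (- (\<theta>s j / real j)))"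
    using nonneg by (subst measure_PiM_poisson_cylinder) (simp_all add: prod.reindex)
  ultimately show "(\<lambda>n. measure (distr (Pn \<theta>s n) ?P (?T n)) {x. \<forall>i<k. x i = r i}) \<longlonglongrightarrow>
     measure (PiM UNIV (\<lambda>j. poisson_measure (\<theta>s (Suc j) / real (Suc j)))) {x. \<forall>i<k. x i = r i}"
    by simp
qed simp

lemma mean_cycle_number_asymp:
  assumes nonneg: "\<And>j. 1 \<le> j \<Longrightarrow> 0 \<le> \<theta>s j" and lim: "\<theta>s \<longlonglongrightarrow> \<theta>" and pos: "0 < \<theta>"
  shows "(\<lambda>n. (\<integral>\<sigma>. real (Kcyc n \<sigma>) \<partial>Pn \<theta>s n) / ln (real n)) \<longlonglongrightarrow> \<theta>"
proof -
  interpret X: renewal \<theta>s "hn \<theta>s" \<theta> by (rule renewal_hn[OF nonneg lim pos])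
  have "(\<integral>\<sigma>. real (Kcyc n \<sigma>) \<partial>Pn \<theta>s n) = (\<Sum>j=1..n. \<theta>s j / real j * hn \<theta>s (n - j)) / hn \<theta>s n" for n
  proof -
    have "(\<integral>\<sigma>. real (Kcyc n \<sigma>) \<partial>Pn \<theta>s n) =
        perm_avg n (\<lambda>M. weight \<theta>s M * (\<Sum>j=1..n. real (count M j))) / hn \<theta>s n"
      by (rule integral_Pn[OF nonneg, where F = "\<lambda>M. \<Sum>j=1..n. real (count M j)"])
         (simp_all add: Kcyc_def count_cycle_type)
    also have "perm_avg n (\<lambda>M. weight \<theta>s M * (\<Sum>j=1..n. real (count M j))) =
        (\<Sum>j=1..n. perm_avg n (\<lambda>M. real (count M j) * weight \<theta>s M))"
      unfolding perm_avg_sum[symmetric] by (simp add: sum_distrib_left mult.commute)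
    also have "\<dots> = (\<Sum>j=1..n. \<theta>s j / real j * hn \<theta>s (n - j))"
    proof (rule sum.cong[OF refl])
      fix j assume "j \<in> {1..n}"
      then have "real j * perm_avg n (\<lambda>M. real (count M j) * weight \<theta>s M) = \<theta>s j * hn \<theta>s (n - j)" "0 < j"
        using perm_avg_rec_and_count(2)[of j n "weight \<theta>s"] by (simp_all add: perm_avg_cmult hn_eq_perm_avg)
      then show "perm_avg n (\<lambda>M. real (count M j) * weight \<theta>s M) = \<theta>s j / real j * hn \<theta>s (n - j)"
        by (simp add: field_simps)
    qed
    finally show ?thesis .
  qed
  then show ?thesis using X.mean_number_of_cycles by simp
qed

section \<open>Ranked sequences and stick breaking\<close>

text \<open>The second conjunct is convergence to 0, phrased by level sets because
  \<open>rearr\<close> counts these: an infinite level set would have \<open>card\<close> 0 and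
  distort the ranking.\<close>

definition unit_null :: "(nat \<Rightarrow> real) \<Rightarrow> bool" where
  "unit_null v \<longleftrightarrow> (\<forall>k. 0 \<le> v k \<and> v k \<le> 1) \<and> (\<forall>t>0. finite {k. t \<le> v k})"

lemma unit_nullD:
  assumes "unit_null v"
  shows "0 \<le> v k" "v k \<le> 1" "0 < t \<Longrightarrow> finite {k. t \<le> v k}"
  using assms by (auto simp: unit_null_def)

text \<open>Since \<^term>\<open>card\<close> of an infinite set is 0, the finiteness condition in the definition of
  \<^const>\<open>rearr\<close> is implied by the cardinality condition.\<close>

lemma rearr_eq_Sup: "rearr v j = Sup (insert 0 {t. 0 < t \<and> j < card {k. t \<le> v k}})"
proof -
  have "{t. 0 < t \<and> finite {k. t \<le> v k} \<and> j < card {k. t \<le> v k}} = {t. 0 < t \<and> j < card {k. t \<le> v k}}"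
    by (auto intro: card_ge_0_finite)
  then show ?thesis by (simp add: rearr_def)
qed

text \<open>Once some level \<open>s\<close> is reached by a positive finite number of entries, any
  higher level is reached only among these, hence is at most their maximum.\<close>

lemma bdd_above_rearr:
  fixes v :: "nat \<Rightarrow> real"
  shows "bdd_above (insert 0 {t. 0 < t \<and> j < card {k. t \<le> v k}})"
proof (cases "{t. 0 < t \<and> j < card {k. t \<le> v k}} = {}")
  case True
  show ?thesis unfolding True by simp
next
  case False
  then obtain s where s: "0 < s" "j < card {k. s \<le> v k}" by auto
  then have fin: "finite {k. s \<le> v k}" by (intro card_ge_0_finite) simp
  have "t \<le> max s (Max (v ` {k. s \<le> v k}))" if t: "t \<in> insert 0 {t. 0 < t \<and> j < card {k. t \<le> v k}}" for t
  proof (cases "t \<le> s")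
    case False
    then have "j < card {k. t \<le> v k}" using t s(1) by auto
    then have "{k. t \<le> v k} \<noteq> {}" by (metis card.empty not_less0)
    then obtain k where k: "t \<le> v k" by auto
    then have "v k \<le> Max (v ` {k. s \<le> v k})" using False fin by (intro Max_ge) auto
    then show ?thesis using k by simp
  qed simp
  then show ?thesis by (rule bdd_aboveI)
qed

lemma rearr_nonneg: "0 \<le> rearr v j"
  unfolding rearr_eq_Sup by (intro cSup_upper bdd_above_rearr) auto

lemma rearr_le_1:
  assumes "unit_null v"
  shows "rearr v j \<le> 1"
  unfolding rearr_eq_Sup
proof (rule cSup_least)
  fix t assume t: "t \<in> insert 0 {t. 0 < t \<and> j < card {k. t \<le> v k}}"
  show "t \<le> 1"
  proof (cases "t = 0")
    case False
    then have "j < card {k. t \<le> v k}" using t by auto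
    then have "{k. t \<le> v k} \<noteq> {}" by (metis card.empty not_less0)
    then show ?thesis using unit_nullD(2)[OF assms] by (auto intro: order_trans)
  qed simp
qed simp

lemma rearr_cong:
  assumes "\<And>t. 0 < t \<Longrightarrow> card {k. t \<le> v k} = card {k. t \<le> w k}"
  shows "rearr v = rearr w"
proof
  fix j
  have "{t. 0 < t \<and> j < card {k. t \<le> v k}} = {t. 0 < t \<and> j < card {k. t \<le> w k}}"
    using assms by auto
  then show "rearr v j = rearr w j" by (simp add: rearr_eq_Sup)
qed

lemma rearr_le_add:
  assumes w: "unit_null w" and vw: "\<And>k. v k - w k \<le> d" and d: "0 \<le> d"
  shows "rearr v j \<le> rearr w j + d"
  unfolding rearr_eq_Sup[of v]
proof (rule cSup_least)
  fix t assume t: "t \<in> insert 0 {t. 0 < t \<and> j < card {k. t \<le> v k}}"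
  show "t \<le> rearr w j + d"
  proof (cases "t \<le> d")
    case True
    then show ?thesis using rearr_nonneg[of w j] by linarith
  next
    case False
    have sub: "{k. t \<le> v k} \<subseteq> {k. t - d \<le> w k}"
    proof
      fix k assume "k \<in> {k. t \<le> v k}"
      then show "k \<in> {k. t - d \<le> w k}" using vw[of k] by simp
    qed
    have fin: "finite {k. t - d \<le> w k}"
      using False unit_nullD(3)[OF w, of "t - d"] by simp
    have "j < card {k. t \<le> v k}" using t False d by auto
    also have "\<dots> \<le> card {k. t - d \<le> w k}" by (intro card_mono fin sub)
    finally have "t - d \<le> rearr w j"
      unfolding rearr_eq_Sup using False by (intro cSup_upper bdd_above_rearr) auto
    then show ?thesis by simp
  qed
qed simp

text \<open>Lowering a level by \<open>d\<close> catches at least as many entries of the other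
  sequence. Ranking is thus 1-Lipschitz for the supremum distance, which lets block-by-block
  estimates pass through \<open>rearr\<close>.\<close>

lemma rearr_lipschitz:
  assumes "unit_null v" "unit_null w" "\<And>k. \<bar>v k - w k\<bar> \<le> d"
  shows "\<bar>rearr v j - rearr w j\<bar> \<le> d"
proof -
  have d: "0 \<le> d" using assms(3)[of 0] by linarith
  have "rearr v j \<le> rearr w j + d" using assms(3) by (intro rearr_le_add assms(2) d) (simp add: abs_le_iff)
  moreover have "w k - v k \<le> d" for k using assms(3)[of k] by linarith
  then have "rearr w j \<le> rearr v j + d" by (intro rearr_le_add assms(1) d)
  ultimately show ?thesis by linarith
qed

lemma rearr_antimono_eq:
  assumes v: "\<And>i k. i \<le> k \<Longrightarrow> v k \<le> v i" "\<And>k. 0 \<le> v k" "\<And>t. 0 < t \<Longrightarrow> finite {k. t \<le> v k}"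
  shows "rearr v j = v j"
proof -
  have "j < card {k. t \<le> v k} \<longleftrightarrow> t \<le> v j" if "0 < t" for t
  proof
    assume "t \<le> v j"
    then have "{..j} \<subseteq> {k. t \<le> v k}" using v(1) by (auto intro: order_trans)
    from card_mono[OF v(3)[OF that] this] show "j < card {k. t \<le> v k}" by simp
  next
    assume c: "j < card {k. t \<le> v k}"
    show "t \<le> v j"
    proof (rule ccontr)
      assume nt: "\<not> t \<le> v j"
      have "{k. t \<le> v k} \<subseteq> {..<j}"
      proof
        fix k assume "k \<in> {k. t \<le> v k}"
        then show "k \<in> {..<j}" using v(1)[of j k] nt by (cases "k < j") auto
      qed
      from card_mono[OF _ this] c show False by simp
    qed
  qed
  then have "insert 0 {t. 0 < t \<and> j < card {k. t \<le> v k}} = {0..v j}"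
    using v(2)[of j] by auto
  then show ?thesis using v(2)[of j] by (simp add: rearr_eq_Sup)
qed

text \<open>A level \<open>t\<close> can be raised to the smallest entry above it without changing
  the count. This replaces uncountably many levels by the countably many \<open>v k\<close>, as
  measurability requires.\<close>

lemma less_rearr_iff:
  assumes "0 \<le> a"
  shows "a < rearr v j \<longleftrightarrow> (\<exists>k. a < v k \<and> j < card {i. v k \<le> v i})"
proof -
  have "a < rearr v j \<longleftrightarrow> (\<exists>t\<in>insert 0 {t. 0 < t \<and> j < card {k. t \<le> v k}}. a < t)"
    unfolding rearr_eq_Sup by (rule less_cSup_iff[OF _ bdd_above_rearr]) simp
  also have "\<dots> \<longleftrightarrow> (\<exists>k. a < v k \<and> j < card {i. v k \<le> v i})"
  proof
    assume "\<exists>t\<in>insert 0 {t. 0 < t \<and> j < card {k. t \<le> v k}}. a < t"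
    then obtain t where t: "a < t" "j < card {k. t \<le> v k}" using assms by auto
    let ?A = "{k. t \<le> v k}"
    have fin: "finite ?A" using t(2) by (intro card_ge_0_finite) simp
    have "?A \<noteq> {}" using t(2) by (metis card.empty not_less0)
    then have "Min (v ` ?A) \<in> v ` ?A" using fin by (intro Min_in) auto
    then obtain k where k: "t \<le> v k" "Min (v ` ?A) = v k" by auto
    have "{i. v k \<le> v i} = ?A"
    proof safe
      fix i assume "v k \<le> v i" then show "t \<le> v i" using k(1) by simp
    next
      fix i assume "t \<le> v i"
      then show "v k \<le> v i" unfolding k(2)[symmetric] using fin by (intro Min_le) auto
    qed
    then show "\<exists>k. a < v k \<and> j < card {i. v k \<le> v i}" using t k by (intro exI[of _ k]) auto
  next
    assume "\<exists>k. a < v k \<and> j < card {i. v k \<le> v i}"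
    then obtain k where "a < v k" "j < card {i. v k \<le> v i}" by blast
    then show "\<exists>t\<in>insert 0 {t. 0 < t \<and> j < card {k. t \<le> v k}}. a < t"
      using assms by (intro bexI[of _ "v k"]) auto
  qed
  finally show ?thesis .
qed

lemma measurable_rearr: "rearr \<in> measurable (PiM UNIV (\<lambda>_. borel)) (PiM UNIV (\<lambda>_. borel))"
proof -
  have "(\<lambda>v. rearr v j) \<in> borel_measurable (PiM UNIV (\<lambda>_. borel))" for j
    unfolding borel_measurable_iff_greater
  proof
    fix a :: real
    show "{v \<in> space (PiM UNIV (\<lambda>_. borel)). a < rearr v j} \<in> sets (PiM UNIV (\<lambda>_. borel))"
    proof (cases "0 \<le> a")
      case True
      have [measurable]: "(\<lambda>v :: nat \<Rightarrow> real. card {i. v k \<le> v i}) \<in> measurable (PiM UNIV (\<lambda>_. borel :: real measure)) (count_space UNIV)" for k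
        by (intro measurable_card borel_measurable_le measurable_component_singleton) auto
      have "{v \<in> space (PiM UNIV (\<lambda>_. borel :: real measure)). \<exists>k :: nat. a < v k \<and> j < card {i. v k \<le> v i}}
          \<in> sets (PiM UNIV (\<lambda>_. borel))"
        by measurable
      then show ?thesis by (simp add: less_rearr_iff[OF True])
    next
      case False
      then have "{v \<in> space (PiM UNIV (\<lambda>_. borel)). a < rearr v j} = space (PiM UNIV (\<lambda>_. borel))"
        using less_le_trans[OF _ rearr_nonneg, of a _ j] by auto
      then show ?thesis by simp
    qed
  qed
  then show ?thesis by (intro measurable_PiM_single'[where f = "\<lambda>j v. rearr v j", simplified]) (auto simp: space_PiM)
qed

section \<open>Splitting off finitely many blocks\<close>

definition append_seq :: "real list \<Rightarrow> (nat \<Rightarrow> real) \<Rightarrow> nat \<Rightarrow> real" where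
  "append_seq a v k = (if k < length a then a ! k else v (k - length a))"

lemma append_seq_Nil [simp]: "append_seq [] v = v"
  by (auto simp: append_seq_def)

lemma append_seq_snoc: "append_seq (a @ [x]) v = append_seq a (case_nat x v)"
  by (auto simp: append_seq_def fun_eq_iff nth_append split: nat.split)
     (metis Suc_diff_Suc diff_Suc_Suc linorder_neqE_nat not_less_eq Suc_lessI diff_self_eq_0 nat.inject zero_less_diff)

lemma Collect_append_seq:
  "{k. t \<le> append_seq a v k} = {k. k < length a \<and> t \<le> a ! k} \<union> (\<lambda>k. k + length a) ` {k. t \<le> v k}"
proof (rule set_eqI)
  fix k
  show "k \<in> {k. t \<le> append_seq a v k} \<longleftrightarrow>
      k \<in> {k. k < length a \<and> t \<le> a ! k} \<union> (\<lambda>k. k + length a) ` {k. t \<le> v k}"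
  proof (cases "k < length a")
    case False
    then have "k = (k - length a) + length a" by simp
    then show ?thesis
      using False by (auto simp: append_seq_def intro!: image_eqI[of _ _ "k - length a"])
  qed (auto simp: append_seq_def)
qed

lemma card_append_seq:
  assumes "finite {k. t \<le> v k}"
  shows "card {k. t \<le> append_seq a v k} = length (filter (\<lambda>x. t \<le> x) a) + card {k. t \<le> v k}"
  unfolding Collect_append_seq
proof (subst card_Un_disjoint)
  show "finite ((\<lambda>k. k + length a) ` {k. t \<le> v k})" using assms by simp
  show "card {k. k < length a \<and> t \<le> a ! k} + card ((\<lambda>k. k + length a) ` {k. t \<le> v k}) =
      length (filter (\<lambda>x. t \<le> x) a) + card {k. t \<le> v k}"
    by (simp add: length_filter_conv_card card_image)
qed auto

lemma unit_null_append_seq: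
  assumes a: "set a \<subseteq> {0..1}" and v: "unit_null v" and c: "0 \<le> c" "c \<le> 1"
  shows "unit_null (append_seq a (\<lambda>k. c * v k))"
  unfolding unit_null_def
proof (intro conjI allI impI)
  have cv: "c * v k \<le> v k" "0 \<le> c * v k" for k
    using c unit_nullD(1)[OF v, of k] by (simp_all add: mult_left_le_one_le)
  have an: "k < length a \<Longrightarrow> a ! k \<in> {0..1}" for k using a nth_mem by blast
  show "0 \<le> append_seq a (\<lambda>k. c * v k) k" for k
    using an[of k] cv(2) by (simp add: append_seq_def)
  show "append_seq a (\<lambda>k. c * v k) k \<le> 1" for k
    using an[of k] order_trans[OF cv(1) unit_nullD(2)[OF v]] by (simp add: append_seq_def)
  fix t :: real assume "0 < t"
  have "{k. t \<le> c * v k} \<subseteq> {k. t \<le> v k}" using cv(1) by (auto intro: order_trans)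
  then have "finite {k. t \<le> c * v k}"
    using unit_nullD(3)[OF v \<open>0 < t\<close>] by (rule finite_subset)
  then show "finite {k. t \<le> append_seq a (\<lambda>k. c * v k) k}"
    unfolding Collect_append_seq by simp
qed

lemma append_seq_measurable:
  "(\<lambda>v. append_seq a v) \<in> measurable (PiM UNIV (\<lambda>_. borel)) (PiM UNIV (\<lambda>_. borel))"
proof -
  have "(\<lambda>v. append_seq a v k) \<in> borel_measurable (PiM UNIV (\<lambda>_. borel))" for k
    unfolding append_seq_def by (cases "k < length a") simp_all
  then show ?thesis
    by (intro measurable_PiM_single'[where f = "\<lambda>j v. append_seq a v j", simplified]) (auto simp: space_PiM)
qed

definition mset_seq :: "nat multiset \<Rightarrow> nat \<Rightarrow> real" where
  "mset_seq M = append_seq (map real (rev (sorted_list_of_multiset M))) (\<lambda>_. 0)"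

lemma card_mset_seq:
  assumes "0 < t" "0 < N"
  shows "finite {k. t \<le> mset_seq M k / N}"
    and "card {k. t \<le> mset_seq M k / N} = size (filter_mset (\<lambda>x. t \<le> real x / N) M)"
proof -
  let ?xs = "map real (rev (sorted_list_of_multiset M))"
  have eq: "{k. t \<le> mset_seq M k / N} = {k. t * N \<le> append_seq ?xs (\<lambda>_. 0) k}"
    using assms by (simp add: mset_seq_def field_simps)
  have e: "{k :: nat. t * N \<le> 0} = {}" using assms by (simp add: mult_le_0_iff)
  show "finite {k. t \<le> mset_seq M k / N}"
    unfolding eq Collect_append_seq using e by simp
  have "card {k. t \<le> mset_seq M k / N} = length (filter (\<lambda>x. t * N \<le> x) ?xs)"
    unfolding eq using mult_pos_pos[OF assms] by (subst card_append_seq) (simp_all add: not_le[symmetric])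
  also have "\<dots> = length (filter (\<lambda>x. t \<le> real x / N) (sorted_list_of_multiset M))"
    using assms by (simp add: filter_map o_def rev_filter[symmetric] field_simps)
  also have "\<dots> = size (filter_mset (\<lambda>x. t \<le> real x / N) M)"
    by (metis mset_filter mset_sorted_list_of_multiset size_mset)
  finally show "card {k. t \<le> mset_seq M k / N} = size (filter_mset (\<lambda>x. t \<le> real x / N) M)" .
qed

text \<open>Ranking depends only on the counts at positive levels, so a cycle may move from the
  multiset to the list of removed blocks. This makes the cycle side recursive.\<close>

lemma rearr_append_mset_seq:
  assumes N: "0 < N"
  shows "rearr (append_seq a (\<lambda>k. mset_seq (add_mset j M) k / N)) =
    rearr (append_seq (a @ [real j / N]) (\<lambda>k. mset_seq M k / N))"
  by (rule rearr_cong) (simp add: card_append_seq card_mset_seq N)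

lemma mset_seq_bounds:
  assumes "\<And>x. x \<in># M \<Longrightarrow> x \<le> n"
  shows "0 \<le> mset_seq M k" "mset_seq M k \<le> real n"
proof -
  let ?xs = "rev (sorted_list_of_multiset M)"
  have mem: "?xs ! k \<in># M" if "k < length ?xs"
    using that nth_mem[of k ?xs] by (metis set_rev set_sorted_list_of_multiset)
  show "0 \<le> mset_seq M k" by (simp add: mset_seq_def append_seq_def del: length_rev)
  show "mset_seq M k \<le> real n"
    using assms[OF mem] by (simp add: mset_seq_def append_seq_def del: length_rev)
qed

lemma unit_null_mset_seq:
  assumes "\<And>x. x \<in># M \<Longrightarrow> x \<le> n" "real n \<le> N" "0 < N"
  shows "unit_null (\<lambda>k. mset_seq M k / N)"
  unfolding unit_null_def using mset_seq_bounds[of M n, OF assms(1)] card_mset_seq(1)[OF _ assms(3)] assms(2,3)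
  by (auto intro: order_trans)

lemma mset_seq_antimono: "i \<le> k \<Longrightarrow> mset_seq M k \<le> mset_seq M i"
proof -
  assume ik: "i \<le> k"
  let ?xs = "rev (sorted_list_of_multiset M)"
  have s: "sorted (rev ?xs)" by simp
  show ?thesis
  proof (cases "k < length ?xs")
    case True
    then have "?xs ! k \<le> ?xs ! i" using s ik by (intro sorted_rev_nth_mono) auto
    then show ?thesis using True ik by (simp add: mset_seq_def append_seq_def del: length_rev)
  next
    case False
    then show ?thesis by (simp add: mset_seq_def append_seq_def del: length_rev)
  qed
qed

lemma rearr_mset_seq:
  assumes "0 < N"
  shows "rearr (\<lambda>k. mset_seq M k / N) j = mset_seq M j / N"
  using assms mset_seq_antimono[of _ _ M] card_mset_seq(1)[OF _ assms]
  by (intro rearr_antimono_eq divide_right_mono)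
     (auto simp: mset_seq_def append_seq_def intro!: divide_nonneg_nonneg)

lemma Lcyc_eq_mset_seq: "real (Lcyc n \<sigma> (Suc i)) = mset_seq (cycle_type n \<sigma>) i"
  unfolding Lcyc_def cycle_type_def[symmetric] Let_def mset_seq_def append_seq_def by auto

section \<open>Stick breaking and the cube of sequences\<close>

lemma stick_Suc: "stick (case_nat s X) = case_nat s (\<lambda>k. (1 - s) * stick X k)"
proof
  fix k
  show "stick (case_nat s X) k = case_nat s (\<lambda>k. (1 - s) * stick X k) k"
    by (cases k) (simp_all add: stick_def prod.lessThan_Suc_shift del: prod.lessThan_Suc)
qed

lemma sum_stick: "(\<Sum>i<k. stick X i) = 1 - (\<Prod>i<k. 1 - X i)"
  by (induction k) (simp_all add: stick_def algebra_simps)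

lemma unit_null_stick:
  assumes X: "\<And>i. 0 \<le> X i \<and> X i \<le> 1"
  shows "unit_null (stick X)"
proof -
  have nn: "0 \<le> stick X k" for k
    unfolding stick_def using X by (intro mult_nonneg_nonneg prod_nonneg) auto
  have le: "(\<Sum>i<k. stick X i) \<le> 1" for k
    unfolding sum_stick using X by (simp add: prod_nonneg)
  have "stick X \<longlonglongrightarrow> 0"
    by (rule summable_LIMSEQ_zero[OF summableI_nonneg_bounded[OF nn le]])
  then have "finite {k. t \<le> stick X k}" if "0 < t" for t
    using order_tendstoD(2)[OF \<open>stick X \<longlonglongrightarrow> 0\<close> that]
    unfolding cofinite_eq_sequentially[symmetric] eventually_cofinite by (simp add: not_less)
  moreover have "stick X k \<le> 1" for k
    using le[of "Suc k"] sum_nonneg[of "{..<k}" "stick X"] nn by simp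
  ultimately show ?thesis using nn by (simp add: unit_null_def)
qed

text \<open>The cube is compact by Tychonoff, so \<open>f\<close> is uniformly continuous there.
  Closeness in supremum distance controls the weighted sum that defines the metric.\<close>

lemma continuous_uniform_on_cube:
  fixes f :: "(nat \<Rightarrow> real) \<Rightarrow> real"
  assumes f: "continuous_on UNIV f" and e: "0 < e"
  obtains d where "0 < d"
    "\<And>x y. (\<And>i. 0 \<le> x i \<and> x i \<le> 1) \<Longrightarrow> (\<And>i. 0 \<le> y i \<and> y i \<le> 1) \<Longrightarrow> (\<And>i. \<bar>x i - y i\<bar> \<le> d) \<Longrightarrow> \<bar>f x - f y\<bar> \<le> e"
proof -
  define K :: "(nat \<Rightarrow> real) set" where "K = Pi\<^sub>E UNIV (\<lambda>_. {0..1})"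
  have "compactin (product_topology (\<lambda>_. euclidean) UNIV) K"
    unfolding K_def compactin_PiE by (simp add: compactin_euclidean_iff)
  then have "compact K" by (simp add: euclidean_product_topology compactin_euclidean_iff)
  then have "uniformly_continuous_on K f"
    using f by (intro compact_uniformly_continuous) (auto intro: continuous_on_subset)
  then obtain d where d: "0 < d" "\<And>x y. x \<in> K \<Longrightarrow> y \<in> K \<Longrightarrow> dist y x < d \<Longrightarrow> dist (f y) (f x) < e"
    unfolding uniformly_continuous_on_def using e by metis
  have "\<bar>f x - f y\<bar> \<le> e"
    if x: "\<And>i. 0 \<le> x i \<and> x i \<le> 1" and y: "\<And>i. 0 \<le> y i \<and> y i \<le> 1" and xy: "\<And>i. \<bar>x i - y i\<bar> \<le> d / 4" for x y
  proof -
    \<comment> \<open>The weights of the metric sum to 2, so coordinatewise distance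
      \<open>d / 4\<close> gives distance at most \<open>d / 2 < d\<close>.\<close>
    have geo: "(\<lambda>n. (1 / 2 :: real) ^ n * (d / 4)) sums (2 * (d / 4))"
      using sums_mult2[OF geometric_sums[of "1 / 2 :: real"], of "d / 4"] by simp
    have le: "(1 / 2) ^ n * min (dist (x (from_nat n)) (y (from_nat n))) 1 \<le> (1 / 2) ^ n * (d / 4)" for n
      using xy[of "from_nat n"] by (intro mult_left_mono order_trans[OF min.cobounded1]) (auto simp: dist_real_def)
    have "summable (\<lambda>n. (1 / 2) ^ n * min (dist (x (from_nat n)) (y (from_nat n))) 1)"
      using le by (intro summable_comparison_test'[OF sums_summable[OF geo]]) auto
    then have "dist x y \<le> (\<Sum>n. (1 / 2) ^ n * (d / 4))"
      unfolding dist_fun_def using le sums_summable[OF geo] by (intro suminf_le) auto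
    also have "\<dots> = d / 2" using geo by (simp add: sums_iff)
    finally have "dist x y < d" using d(1) by simp
    moreover have "x \<in> K" "y \<in> K" using x y by (auto simp: K_def PiE_iff)
    ultimately have "dist (f x) (f y) < e" using d(2)[of y x] by simp
    then show ?thesis by (simp add: dist_real_def)
  qed
  then show thesis using d(1) by (intro that[of "d / 4"]) auto
qed

section \<open>The Beta distribution and step functions\<close>

lemma sets_beta1 [simp, measurable_cong]: "sets (beta1 \<theta>) = sets borel"
  and space_beta1 [simp]: "space (beta1 \<theta>) = UNIV"
  by (simp_all add: beta1_def)

text \<open>For \<open>\<theta> < 1\<close> the density is unbounded at 1, while its antiderivative
  stays continuous; hence the fundamental theorem with derivatives in the interior only.\<close>

lemma beta1_density_has_integral:
  fixes s \<theta> :: real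
  assumes s: "0 \<le> s" "s \<le> 1" and \<theta>: "0 < \<theta>"
  shows "((\<lambda>x. \<theta> * (1 - x) powr (\<theta> - 1)) has_integral (1 - s) powr \<theta>) {s..1}"
proof -
  have "((\<lambda>x. \<theta> * (1 - x) powr (\<theta> - 1)) has_integral (- ((1 - 1) powr \<theta>) - - ((1 - s) powr \<theta>))) {s..1}"
  proof (rule fundamental_theorem_of_calculus_interior[OF s(2)])
    show "continuous_on {s..1} (\<lambda>x. - ((1 - x) powr \<theta>))"
      using \<theta> by (intro continuous_on_minus continuous_on_powr' continuous_intros) auto
    fix x assume "x \<in> {s<..<1}"
    then have "((\<lambda>x. - ((1 - x) powr \<theta>)) has_real_derivative \<theta> * (1 - x) powr (\<theta> - 1)) (at x)"
      by (auto intro!: derivative_eq_intros)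
    then show "((\<lambda>x. - ((1 - x) powr \<theta>)) has_vector_derivative \<theta> * (1 - x) powr (\<theta> - 1)) (at x)"
      by (simp add: has_real_derivative_iff_has_vector_derivative)
  qed
  then show ?thesis by simp
qed

lemma emeasure_beta1_greater:
  assumes s: "0 \<le> s" "s \<le> 1" and \<theta>: "0 < \<theta>"
  shows "emeasure (beta1 \<theta>) {s<..} = ennreal ((1 - s) powr \<theta>)"
proof -
  define g where "g x = (if x \<in> {s..1} then \<theta> * (1 - x) powr (\<theta> - 1) else 0)" for x
  have "emeasure (beta1 \<theta>) {s<..} =
      (\<integral>\<^sup>+x. ennreal (indicator {0..1} x * \<theta> * (1 - x) powr (\<theta> - 1)) * indicator {s<..} x \<partial>lborel)"
    unfolding beta1_def by (rule emeasure_density) auto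
  also have "\<dots> = (\<integral>\<^sup>+x. ennreal (g x) \<partial>lborel)"
  proof (rule nn_integral_cong_AE)
    show "AE x in lborel. ennreal (indicator {0..1} x * \<theta> * (1 - x) powr (\<theta> - 1)) * indicator {s<..} x = ennreal (g x)"
      using AE_lborel_singleton[of s]
      by eventually_elim (use s in \<open>auto simp: g_def indicator_def\<close>)
  qed
  also have "\<dots> = ennreal ((1 - s) powr \<theta>)"
  proof (rule nn_integral_has_integral_lborel)
    show "g \<in> borel_measurable borel" unfolding g_def by measurable
    show "0 \<le> g x" for x using \<theta> by (simp add: g_def)
    show "(g has_integral (1 - s) powr \<theta>) UNIV"
      unfolding g_def has_integral_restrict_UNIV by (rule beta1_density_has_integral[OF assms])
  qed
  finally show ?thesis .
qed

lemma AE_beta1: "AE x in beta1 \<theta>. 0 < x \<and> x \<le> 1"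
proof -
  have "AE x in lborel. 0 < ennreal (indicator {0..1} x * \<theta> * (1 - x) powr (\<theta> - 1)) \<longrightarrow> 0 < x \<and> x \<le> 1"
    using AE_lborel_singleton[of 0]
    by eventually_elim (auto simp: indicator_def split: if_splits)
  then show ?thesis unfolding beta1_def by (subst AE_density) auto
qed

lemma prob_space_beta1:
  assumes "0 < \<theta>"
  shows "prob_space (beta1 \<theta>)"
proof
  have "emeasure (beta1 \<theta>) UNIV = emeasure (beta1 \<theta>) {0<..}"
    using AE_beta1[of \<theta>] by (intro emeasure_eq_AE) (auto elim: eventually_mono)
  then show "emeasure (beta1 \<theta>) (space (beta1 \<theta>)) = 1"
    using emeasure_beta1_greater[of 0 \<theta>] assms by simp
qed

lemma integral_beta1_greater:
  assumes "0 \<le> s" "s \<le> 1" "0 < \<theta>"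
  shows "(\<integral>x. of_bool (s < x) \<partial>beta1 \<theta>) = (1 - s) powr \<theta>"
proof -
  have "(\<integral>x. of_bool (s < x) \<partial>beta1 \<theta>) = (\<integral>x. indicator {s<..} x \<partial>beta1 \<theta>)"
    by (intro Bochner_Integration.integral_cong) (auto simp: indicator_def)
  also have "\<dots> = measure (beta1 \<theta>) {s<..}" by simp
  also have "\<dots> = (1 - s) powr \<theta>" by (simp add: measure_def emeasure_beta1_greater assms)
  finally show ?thesis .
qed

text \<open>A step function with right-endpoint values on the cells
  \<open>(real (i - 1) / real m, real i / real m]\<close>, written through tails because these are
  what \<open>p_tail\<close> and \<open>integral_beta1_greater\<close> evaluate. It is 0 at
  \<open>s = 0\<close>, a null point of \<open>beta1\<close>.\<close>

definition step_approx :: "nat \<Rightarrow> (real \<Rightarrow> real) \<Rightarrow> real \<Rightarrow> real" where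
  "step_approx m \<Psi> s = (\<Sum>i=1..m. \<Psi> (real i / real m) *
     (of_bool (real (i - 1) / real m < s) - of_bool (real i / real m < s)))"

lemma step_approx_error:
  assumes m: "0 < m" "1 / real m \<le> d" and s: "0 < s" "s \<le> 1"
    and \<Psi>: "\<And>s t. s \<in> {0..1} \<Longrightarrow> t \<in> {0..1} \<Longrightarrow> \<bar>s - t\<bar> \<le> d \<Longrightarrow> \<bar>\<Psi> s - \<Psi> t\<bar> \<le> e"
  shows "\<bar>\<Psi> s - step_approx m \<Psi> s\<bar> \<le> e"
proof -
  \<comment> \<open>The ceiling selects the half-open cell containing \<open>s\<close>.\<close>
  define i where "i = nat \<lceil>real m * s\<rceil>"
  have ms: "0 < real m * s" "real m * s \<le> real m" using m s by (auto simp: mult_left_le)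
  then have c: "0 < \<lceil>real m * s\<rceil>" "\<lceil>real m * s\<rceil> \<le> int m" by (simp_all add: ceiling_le_iff)
  have ii: "int i = \<lceil>real m * s\<rceil>" unfolding i_def by (rule nat_0_le[OF less_imp_le[OF c(1)]])
  then have i: "i \<in> {1..m}" using c unfolding atLeastAtMost_iff by linarith
  have ri: "real i = of_int \<lceil>real m * s\<rceil>" by (simp add: ii[symmetric])
  have up: "real m * s \<le> real i" "real i < real m * s + 1" unfolding ri by linarith+
  have "(of_bool (real (k - 1) / real m < s) - of_bool (real k / real m < s) :: real) = of_bool (k = i)"
    if k: "k \<in> {1..m}" for k
  proof -
    have "real (k - 1) / real m < s \<longleftrightarrow> k \<le> i"
    proof -
      have "real (k - 1) / real m < s \<longleftrightarrow> real k - 1 < real m * s"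
        using m k by (simp add: field_simps of_nat_diff)
      also have "\<dots> \<longleftrightarrow> k \<le> i" using up by linarith
      finally show ?thesis .
    qed
    moreover have "real k / real m < s \<longleftrightarrow> k < i"
    proof -
      have "real k / real m < s \<longleftrightarrow> real k < real m * s" using m by (simp add: field_simps)
      also have "\<dots> \<longleftrightarrow> k < i" using up by linarith
      finally show ?thesis .
    qed
    ultimately show ?thesis by (auto simp: of_bool_def)
  qed
  then have "step_approx m \<Psi> s = (\<Sum>k=1..m. \<Psi> (real k / real m) * of_bool (k = i))"
    unfolding step_approx_def by (intro sum.cong refl) simp
  also have "\<dots> = (\<Sum>k=1..m. if k = i then \<Psi> (real k / real m) else 0)"
    by (intro sum.cong refl) simp
  also have "\<dots> = \<Psi> (real i / real m)" using i by simp
  finally have eq: "step_approx m \<Psi> s = \<Psi> (real i / real m)" .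
  have "\<bar>s - real i / real m\<bar> \<le> 1 / real m"
  proof -
    have "real m * s / real m \<le> real i / real m" "real i / real m \<le> (real m * s + 1) / real m"
      using up by (intro divide_right_mono; simp)+
    then show ?thesis using m by (simp add: add_divide_distrib abs_if)
  qed
  then show ?thesis unfolding eq using i m s by (intro \<Psi>) auto
qed

section \<open>Length of the removed cycle\<close>

context renewal
begin

text \<open>For \<open>h = hn \<theta>s\<close>, with \<open>h n\<close> and \<open>n\<close>
  positive, this is the probability that the cycle through a fixed point has length
  \<open>j\<close>.\<close>

definition p :: "nat \<Rightarrow> nat \<Rightarrow> real" where
  "p n j = \<theta>s j * h (n - j) / (real n * h n)"

lemma p_nonneg: "1 \<le> j \<Longrightarrow> 0 \<le> p n j"
  unfolding p_def using nonneg h_nonneg by simp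

lemma p_sum: "0 < n \<Longrightarrow> 0 < h n \<Longrightarrow> (\<Sum>j=1..n. p n j) = 1"
  unfolding p_def sum_divide_distrib[symmetric] h_rec[symmetric] by simp

text \<open>Without the parameters the weights beyond \<open>s * n\<close> add up to
  \<open>S (n - m n) / (n * h n)\<close>, which tends to
  \<open>(1 - s) powr \<theta> / \<theta>\<close>; the Toeplitz average restores the factor
  \<open>\<theta>\<close>. The case \<open>s = 1\<close> is separate because \<open>S_ratio\<close>
  asks for a positive limiting ratio.\<close>

lemma p_tail:
  assumes s: "0 \<le> s" "s \<le> 1"
  shows "(\<lambda>n. \<Sum>j=1..n. p n j * of_bool (s < real j / real n)) \<longlonglongrightarrow> (1 - s) powr \<theta>"
proof (cases "s = 1")
  case True
  have "(\<Sum>j=1..n. p n j * of_bool (s < real j / real n)) = 0" for n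
    unfolding True by (intro sum.neutral) (auto simp: field_simps)
  then show ?thesis using True by simp
next
  case False
  define m where "m n = nat \<lfloor>s * real n\<rfloor>" for n
  have m: "real (m n) \<le> s * real n" "s * real n < real (m n) + 1" for n
    using s by (simp_all add: m_def)
  have m_le: "m n \<le> n" for n
  proof -
    have "s * real n \<le> real n" using s by (simp add: mult_left_le_one_le)
    then show ?thesis using m(1)[of n] by linarith
  qed
  define a where "a n j = h (n - j) * of_bool (s < real j / real n) / (real n * h n)" for n j
  have "(\<lambda>n. \<Sum>j=1..n. a n j * \<theta>s j) \<longlonglongrightarrow> ((1 - s) powr \<theta> / \<theta>) * \<theta>"
  proof (rule toeplitz_tendsto[OF _ _ _ lim])
    show "0 \<le> a n j" for n j using h_nonneg by (simp add: a_def)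
    fix j :: nat
    have "(\<lambda>n. (h (n - j) / S n) / (real n * h n / S n)) \<longlonglongrightarrow> 0 / \<theta>"
      using pos by (intro tendsto_divide h_shift_over_S h_over_S) auto
    then have up: "(\<lambda>n. (h (n - j) / S n) / (real n * h n / S n)) \<longlonglongrightarrow> 0" by simp
    show "(\<lambda>n. a n j) \<longlonglongrightarrow> 0"
    proof (rule Lim_null_comparison[OF _ up])
      show "\<forall>\<^sub>F n in sequentially. norm (a n j) \<le> (h (n - j) / S n) / (real n * h n / S n)"
        using eventually_gt_at_top[of 0]
      proof eventually_elim
        case (elim n)
        then have eq: "(h (n - j) / S n) / (real n * h n / S n) = h (n - j) / (real n * h n)"
          using S_pos[OF elim] by simp
        show ?case unfolding eq using h_nonneg by (simp add: a_def)
      qed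
    qed
  next
    have "(\<lambda>n. real (n - m n) / real n) \<longlonglongrightarrow> 1 - s"
    proof (rule LIM_zero_cancel, rule Lim_null_comparison[where g = "\<lambda>n. 1 / real n"])
      show "\<forall>\<^sub>F n in sequentially. norm (real (n - m n) / real n - (1 - s)) \<le> 1 / real n"
        using eventually_gt_at_top[of 0]
      proof eventually_elim
        case (elim n)
        have "real (n - m n) / real n - (1 - s) = (s * real n - real (m n)) / real n"
          using elim m_le[of n] by (simp add: of_nat_diff field_simps)
        then show ?case using m[of n] elim by (simp add: abs_le_iff divide_right_mono)
      qed
      show "(\<lambda>n. 1 / real n) \<longlonglongrightarrow> 0" by real_asymp
    qed
    then have "(\<lambda>n. S (n - m n) / S n) \<longlonglongrightarrow> (1 - s) powr \<theta>"
      using s False by (intro S_ratio) auto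
    then have "(\<lambda>n. (S (n - m n) / S n) / (real n * h n / S n)) \<longlonglongrightarrow> (1 - s) powr \<theta> / \<theta>"
      using pos by (intro tendsto_divide h_over_S) auto
    moreover have "\<forall>\<^sub>F n in sequentially. (S (n - m n) / S n) / (real n * h n / S n) = (\<Sum>j=1..n. a n j)"
      using eventually_gt_at_top[of 0]
    proof eventually_elim
      case (elim n)
      have iff: "s < real j / real n \<longleftrightarrow> m n < j" for j
      proof -
        have "s < real j / real n \<longleftrightarrow> s * real n < real j" using elim by (simp add: field_simps)
        also have "\<dots> \<longleftrightarrow> m n < j" using m[of n] by linarith
        finally show ?thesis .
      qed
      have "(\<Sum>j=1..n. h (n - j) * of_bool (s < real j / real n)) = (\<Sum>j=1..n. if m n < j then h (n - j) else 0)"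
        unfolding iff by (intro sum.cong) auto
      also have "\<dots> = (\<Sum>j\<in>{j\<in>{1..n}. m n < j}. h (n - j))"
        by (rule sum.inter_filter[symmetric]) simp
      also have "\<dots> = S (n - m n)"
        unfolding S_def
        by (rule sum.reindex_bij_witness[of _ "\<lambda>k. n - k" "\<lambda>j. n - j"]) auto
      finally have "(\<Sum>j=1..n. a n j) = S (n - m n) / (real n * h n)"
        by (simp add: a_def sum_divide_distrib[symmetric])
      then show ?case using S_pos[OF elim] by simp
    qed
    ultimately show "(\<lambda>n. \<Sum>j=1..n. a n j) \<longlonglongrightarrow> (1 - s) powr \<theta> / \<theta>"
      by (rule Lim_transform_eventually)
  qed
  then show ?thesis using pos by (simp add: a_def p_def mult_ac)
qed

text \<open>Eventually \<open>j > n / 2\<close> has probability at least \<open>q / 2\<close>, and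
  there at least half of the length is lost. The mean remaining fraction is therefore at most
  \<open>1 - q / 4\<close>.\<close>

lemma p_contraction:
  obtains \<rho> where "0 < \<rho>" "\<rho> < 1"
    "\<forall>\<^sub>F n in sequentially. (\<Sum>j=1..n. p n j * (1 - real j / real n)) \<le> \<rho>"
proof -
  define q where "q = (1 / 2 :: real) powr \<theta>"
  have q: "0 < q" "q \<le> 1" using pos by (auto simp: q_def powr_le1)
  have "(\<lambda>n. \<Sum>j=1..n. p n j * of_bool (1 / 2 < real j / real n)) \<longlonglongrightarrow> q"
    using p_tail[of "1 / 2"] by (simp add: q_def)
  then have "\<forall>\<^sub>F n in sequentially. q / 2 < (\<Sum>j=1..n. p n j * of_bool (1 / 2 < real j / real n))"
    using q by (intro order_tendstoD(1)) auto
  then have "\<forall>\<^sub>F n in sequentially. (\<Sum>j=1..n. p n j * (1 - real j / real n)) \<le> 1 - q / 4"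
    using eventually_gt_at_top[of 0] eventually_h_pos
  proof eventually_elim
    case (elim n)
    have "(\<Sum>j=1..n. p n j * (1 - real j / real n)) \<le>
        (\<Sum>j=1..n. p n j - (1 / 2) * (p n j * of_bool (1 / 2 < real j / real n)))"
    proof (rule sum_mono)
      fix j assume j: "j \<in> {1..n}"
      have "1 - real j / real n \<le> 1 - (1 / 2) * of_bool (1 / 2 < real j / real n)"
        by (auto simp: of_bool_def)
      then have "p n j * (1 - real j / real n) \<le> p n j * (1 - (1 / 2) * of_bool (1 / 2 < real j / real n))"
        using p_nonneg[of j n] j by (intro mult_left_mono) auto
      then show "p n j * (1 - real j / real n) \<le> p n j - (1 / 2) * (p n j * of_bool (1 / 2 < real j / real n))"
        by (simp add: algebra_simps)
    qed
    also have "\<dots> = 1 - (1 / 2) * (\<Sum>j=1..n. p n j * of_bool (1 / 2 < real j / real n))"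
      unfolding sum_subtractf sum_distrib_left[symmetric] using p_sum[of n] elim by simp
    also have "\<dots> \<le> 1 - q / 4" using elim(1) by simp
    finally show ?case .
  qed
  then show thesis using q by (intro that[of "1 - q / 4"]) auto
qed

text \<open>Uniformity in \<Psi> is essential, since the function used later depends on the removed
  blocks and on the scale. The mesh depends on \<open>d\<close> alone, so finitely many tail limits
  serve all \<Psi>. The three errors are the two step approximations and the comparison of
  tails.\<close>

lemma sampling_uniform:
  assumes e: "0 < e" and d: "0 < d"
  shows "\<forall>\<^sub>F n in sequentially. \<forall>\<Psi>. \<Psi> \<in> borel_measurable borel \<longrightarrow> (\<forall>s. \<bar>\<Psi> s\<bar> \<le> B) \<longrightarrow>
      (\<forall>s\<in>{0..1}. \<forall>t\<in>{0..1}. \<bar>s - t\<bar> \<le> d \<longrightarrow> \<bar>\<Psi> s - \<Psi> t\<bar> \<le> e) \<longrightarrow>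
      \<bar>(\<Sum>j=1..n. p n j * \<Psi> (real j / real n)) - (\<integral>s. \<Psi> s \<partial>beta1 \<theta>)\<bar> \<le> 3 * e"
proof -
  interpret \<beta>: prob_space "beta1 \<theta>" by (rule prob_space_beta1[OF pos])
  obtain m :: nat where m: "0 < m" "1 / real m \<le> d"
    using reals_Archimedean[OF d] by (metis inverse_eq_divide less_imp_le zero_less_Suc)
  define T where "T n s = (\<Sum>j=1..n. p n j * of_bool (s < real j / real n))" for n s
  define D where "D n i = (T n (real (i - 1) / real m) - T n (real i / real m)) -
      ((1 - real (i - 1) / real m) powr \<theta> - (1 - real i / real m) powr \<theta>)" for n i
  have "(\<lambda>n. B * (\<Sum>i=1..m. \<bar>D n i\<bar>)) \<longlonglongrightarrow> B * (\<Sum>i=1..m. \<bar>0\<bar>)"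
  proof (intro tendsto_mult tendsto_const tendsto_sum tendsto_rabs)
    fix i assume i: "i \<in> {1..m}"
    have "(\<lambda>n. D n i) \<longlonglongrightarrow>
        (((1 - real (i - 1) / real m) powr \<theta> - (1 - real i / real m) powr \<theta>) -
        ((1 - real (i - 1) / real m) powr \<theta> - (1 - real i / real m) powr \<theta>))"
      unfolding D_def T_def using i m by (intro tendsto_diff tendsto_const p_tail) (auto simp: field_simps)
    then show "(\<lambda>n. D n i) \<longlonglongrightarrow> 0" by simp
  qed
  then have "\<forall>\<^sub>F n in sequentially. B * (\<Sum>i=1..m. \<bar>D n i\<bar>) < e"
    using e by (intro order_tendstoD(2)) auto
  then show ?thesis
    using eventually_gt_at_top[of 0] eventually_h_pos
  proof eventually_elim
    case (elim n)
    show ?case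
    proof (intro allI impI)
      fix \<Psi> :: "real \<Rightarrow> real"
      assume meas: "\<Psi> \<in> borel_measurable borel" and bound: "\<forall>s. \<bar>\<Psi> s\<bar> \<le> B"
        and mod: "\<forall>s\<in>{0..1}. \<forall>t\<in>{0..1}. \<bar>s - t\<bar> \<le> d \<longrightarrow> \<bar>\<Psi> s - \<Psi> t\<bar> \<le> e"
      have err: "\<bar>\<Psi> s - step_approx m \<Psi> s\<bar> \<le> e" if "0 < s" "s \<le> 1" for s
        using mod by (intro step_approx_error[OF m that]) auto
      have step_meas: "step_approx m \<Psi> \<in> borel_measurable borel"
        unfolding step_approx_def[abs_def] by measurable
      have of_bool_int: "integrable (beta1 \<theta>) (\<lambda>x. of_bool (s < x) :: real)" for s
        by (rule \<beta>.integrable_const_bound[of _ 1]) auto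
      have step_int: "integrable (beta1 \<theta>) (step_approx m \<Psi>)"
        unfolding step_approx_def[abs_def] using of_bool_int by (intro Bochner_Integration.integrable_sum) auto
      have "\<bar>(\<Sum>j=1..n. p n j * \<Psi> (real j / real n)) - (\<Sum>j=1..n. p n j * step_approx m \<Psi> (real j / real n))\<bar>
          = \<bar>\<Sum>j=1..n. p n j * (\<Psi> (real j / real n) - step_approx m \<Psi> (real j / real n))\<bar>"
        by (simp add: sum_subtractf[symmetric] algebra_simps)
      also have "\<dots> \<le> (\<Sum>j=1..n. p n j * e)"
      proof (rule order_trans[OF sum_abs], rule sum_mono)
        fix j assume j: "j \<in> {1..n}"
        have "\<bar>\<Psi> (real j / real n) - step_approx m \<Psi> (real j / real n)\<bar> \<le> e"
          using j by (intro err) auto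
        then show "\<bar>p n j * (\<Psi> (real j / real n) - step_approx m \<Psi> (real j / real n))\<bar> \<le> p n j * e"
          using p_nonneg[of j n] j by (simp add: abs_mult mult_left_mono)
      qed
      also have "\<dots> = e" using p_sum[of n] elim by (simp add: sum_distrib_right[symmetric])
      finally have 1: "\<bar>(\<Sum>j=1..n. p n j * \<Psi> (real j / real n)) - (\<Sum>j=1..n. p n j * step_approx m \<Psi> (real j / real n))\<bar> \<le> e" .
      have 2: "(\<Sum>j=1..n. p n j * step_approx m \<Psi> (real j / real n)) =
          (\<Sum>i=1..m. \<Psi> (real i / real m) * (T n (real (i - 1) / real m) - T n (real i / real m)))"
        unfolding step_approx_def T_def sum_subtractf[symmetric] sum_distrib_left
        by (subst sum.swap) (intro sum.cong refl, simp add: algebra_simps)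
      have 3: "(\<integral>s. step_approx m \<Psi> s \<partial>beta1 \<theta>) =
          (\<Sum>i=1..m. \<Psi> (real i / real m) *
            ((1 - real (i - 1) / real m) powr \<theta> - (1 - real i / real m) powr \<theta>))"
      proof -
        have "(\<integral>s. c * (of_bool (a < s) - of_bool (b < s)) \<partial>beta1 \<theta>) = c * ((1 - a) powr \<theta> - (1 - b) powr \<theta>)"
          if "0 \<le> a" "a \<le> 1" "0 \<le> b" "b \<le> 1" for a b c
          using of_bool_int[of a] of_bool_int[of b] that pos by (simp add: integral_beta1_greater)
        moreover have "0 \<le> real (i - 1) / real m" "real (i - 1) / real m \<le> 1"
            "0 \<le> real i / real m" "real i / real m \<le> 1" if "i \<in> {1..m}" for i
          using that by (auto simp: divide_le_eq_1)
        ultimately show ?thesis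
          unfolding step_approx_def
          by (subst Bochner_Integration.integral_sum)
             (intro integrable_mult_right Bochner_Integration.integrable_diff of_bool_int sum.cong refl | simp)+
      qed
      have "(\<Sum>j=1..n. p n j * step_approx m \<Psi> (real j / real n)) - (\<integral>s. step_approx m \<Psi> s \<partial>beta1 \<theta>)
          = (\<Sum>i=1..m. \<Psi> (real i / real m) * D n i)"
        unfolding 2 3 D_def sum_subtractf[symmetric] by (simp add: algebra_simps)
      also have "\<bar>\<dots>\<bar> \<le> (\<Sum>i=1..m. B * \<bar>D n i\<bar>)"
        using bound by (intro order_trans[OF sum_abs] sum_mono) (simp add: abs_mult mult_right_mono)
      also have "\<dots> < e" using elim(1) by (simp add: sum_distrib_left)
      finally have 4: "\<bar>(\<Sum>j=1..n. p n j * step_approx m \<Psi> (real j / real n)) - (\<integral>s. step_approx m \<Psi> s \<partial>beta1 \<theta>)\<bar> \<le> e"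
        by simp
      have \<Psi>_int: "integrable (beta1 \<theta>) \<Psi>"
        using meas bound by (intro \<beta>.integrable_const_bound[of _ B]) auto
      have "\<bar>(\<integral>s. \<Psi> s \<partial>beta1 \<theta>) - (\<integral>s. step_approx m \<Psi> s \<partial>beta1 \<theta>)\<bar> =
          \<bar>\<integral>s. \<Psi> s - step_approx m \<Psi> s \<partial>beta1 \<theta>\<bar>"
        using \<Psi>_int step_int by simp
      also have "\<dots> \<le> (\<integral>s. \<bar>\<Psi> s - step_approx m \<Psi> s\<bar> \<partial>beta1 \<theta>)"
        by (rule integral_abs_bound)
      also have "\<dots> \<le> (\<integral>s. e \<partial>beta1 \<theta>)"
        using \<Psi>_int step_int AE_beta1[of \<theta>] err
        by (intro integral_mono_AE) (auto elim: eventually_mono)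
      also have "\<dots> = e" by (simp add: \<beta>.prob_space[simplified])
      finally show "\<bar>(\<Sum>j=1..n. p n j * \<Psi> (real j / real n)) - (\<integral>s. \<Psi> s \<partial>beta1 \<theta>)\<bar> \<le> 3 * e"
        using 1 4 by linarith
    qed
  qed
qed

end

section \<open>Ranked cycle lengths\<close>

lemma sequence_space_beta1:
  assumes "0 < \<theta>"
  shows "sequence_space (beta1 \<theta>)"
proof -
  interpret \<beta>: prob_space "beta1 \<theta>" by (rule prob_space_beta1[OF assms])
  show ?thesis ..
qed

lemma stick_measurable:
  "(\<lambda>X k. c * stick X k) \<in> measurable (PiM UNIV (\<lambda>_. beta1 \<theta>)) (PiM UNIV (\<lambda>_. borel))"
proof -
  have [measurable]: "(\<lambda>X. X i) \<in> borel_measurable (PiM UNIV (\<lambda>_ :: nat. beta1 \<theta>))" for i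
  proof -
    have "(\<lambda>X. X i) \<in> measurable (PiM UNIV (\<lambda>_ :: nat. beta1 \<theta>)) (beta1 \<theta>)"
      by (rule measurable_component_singleton) simp
    then show ?thesis by (simp cong: measurable_cong_sets)
  qed
  have "(\<lambda>X. c * stick X k) \<in> borel_measurable (PiM UNIV (\<lambda>_. beta1 \<theta>))" for k
    unfolding stick_def by measurable
  then show ?thesis
    by (intro measurable_PiM_single'[where f = "\<lambda>k X. c * stick X k", simplified]) (auto simp: space_PiM)
qed

lemma AE_unit_null_stick:
  assumes "0 < \<theta>"
  shows "AE X in PiM UNIV (\<lambda>_. beta1 \<theta>). unit_null (stick X)"
proof -
  have "AE X in PiM UNIV (\<lambda>_ :: nat. beta1 \<theta>). 0 < X i \<and> X i \<le> 1" for i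
    using prob_space_beta1[OF assms] AE_beta1 by (intro AE_PiM_component) auto
  then have "AE X in PiM UNIV (\<lambda>_ :: nat. beta1 \<theta>). \<forall>i. 0 < X i \<and> X i \<le> 1"
    unfolding AE_all_countable by blast
  then show ?thesis
    by eventually_elim (auto intro!: unit_null_stick intro: less_imp_le)
qed

section \<open>Comparison of the two recursions\<close>

locale ranked_test = 
  fixes \<theta>s :: "nat \<Rightarrow> real" and \<theta> :: real and f :: "(nat \<Rightarrow> real) \<Rightarrow> real" and B :: real
  assumes \<theta>s_nonneg: "\<And>j. 1 \<le> j \<Longrightarrow> 0 \<le> \<theta>s j" and \<theta>s_lim: "\<theta>s \<longlonglongrightarrow> \<theta>" and \<theta>_pos: "0 < \<theta>"
    and f_cont: "continuous_on UNIV f" and f_bound: "\<And>x. \<bar>f x\<bar> \<le> B"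

sublocale ranked_test \<subseteq> renewal \<theta>s "hn \<theta>s" \<theta>
  using \<theta>s_nonneg \<theta>s_lim \<theta>_pos by (rule renewal_hn)

sublocale ranked_test \<subseteq> \<beta>: prob_space "beta1 \<theta>"
  using \<theta>_pos by (rule prob_space_beta1)

sublocale ranked_test \<subseteq> \<beta>s: prob_space "PiM UNIV (\<lambda>_ :: nat. beta1 \<theta>)"
  by (rule prob_space_PiM) (rule \<beta>.prob_space_axioms)

context ranked_test
begin

abbreviation "h \<equiv> hn \<theta>s"

text \<open>To run the induction, both sides are evaluated at a list of blocks already removed, followed by
  the rescaled cycle lengths of what remains (\<open>Q\<close>), respectively by a rescaled stick-breaking
  sequence (\<open>R\<close>). \<open>Q\<close> is not normalized, so that nothing has to be assumed about
  \<^term>\<open>hn \<theta>s n\<close>, which may vanish for small \<open>n\<close>.\<close>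

definition cyc :: "real list \<Rightarrow> real \<Rightarrow> nat multiset \<Rightarrow> real" where
  "cyc a N M = f (rearr (append_seq a (\<lambda>k. mset_seq M k / N)))"

definition Q :: "nat \<Rightarrow> real list \<Rightarrow> real \<Rightarrow> real" where
  "Q n a N = perm_avg n (\<lambda>M. weight \<theta>s M * cyc a N M)"

definition brk :: "real list \<Rightarrow> real \<Rightarrow> (nat \<Rightarrow> real) \<Rightarrow> real" where
  "brk a c X = f (rearr (append_seq a (\<lambda>k. c * stick X k)))"

definition R :: "real list \<Rightarrow> real \<Rightarrow> real" where
  "R a c = (\<integral>X. brk a c X \<partial>PiM UNIV (\<lambda>_. beta1 \<theta>))"

lemma B_nonneg: "0 \<le> B"
  using f_bound[of undefined] by linarith

lemma f_measurable: "f \<in> borel_measurable (PiM UNIV (\<lambda>_. borel))"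
  using borel_measurable_continuous_onI[OF f_cont]
  by (simp add: sets_PiM_equal_borel cong: measurable_cong_sets)

lemma brk_measurable: "brk a c \<in> borel_measurable (PiM UNIV (\<lambda>_. beta1 \<theta>))"
  unfolding brk_def[abs_def]
  by (rule measurable_compose[OF _ f_measurable], rule measurable_compose[OF _ measurable_rearr],
      rule measurable_compose[OF _ append_seq_measurable], rule stick_measurable)

lemma brk_bound: "\<bar>brk a c X\<bar> \<le> B"
  by (simp add: brk_def f_bound)

lemma brk_integrable: "integrable (PiM UNIV (\<lambda>_. beta1 \<theta>)) (brk a c)"
  by (rule \<beta>s.integrable_const_bound[of _ B]) (simp_all add: brk_bound brk_measurable)

lemma R_bound: "\<bar>R a c\<bar> \<le> B"
proof -
  have "\<bar>R a c\<bar> \<le> (\<integral>X. \<bar>brk a c X\<bar> \<partial>PiM UNIV (\<lambda>_. beta1 \<theta>))"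
    unfolding R_def by (rule integral_abs_bound)
  also have "\<dots> \<le> (\<integral>X. B \<partial>PiM UNIV (\<lambda>_ :: nat. beta1 \<theta>))"
    using brk_integrable by (intro integral_mono) (auto simp: brk_bound)
  also have "\<dots> = B" using \<beta>s.prob_space by simp
  finally show ?thesis .
qed

lemma R_diff_le:
  assumes "AE X in PiM UNIV (\<lambda>_. beta1 \<theta>). \<bar>brk a c X - g X\<bar> \<le> e"
    and g: "integrable (PiM UNIV (\<lambda>_. beta1 \<theta>)) g"
  shows "\<bar>R a c - (\<integral>X. g X \<partial>PiM UNIV (\<lambda>_. beta1 \<theta>))\<bar> \<le> e"
proof -
  have "\<bar>R a c - (\<integral>X. g X \<partial>PiM UNIV (\<lambda>_. beta1 \<theta>))\<bar> = \<bar>\<integral>X. brk a c X - g X \<partial>PiM UNIV (\<lambda>_. beta1 \<theta>)\<bar>"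
    unfolding R_def using brk_integrable g by simp
  also have "\<dots> \<le> (\<integral>X. \<bar>brk a c X - g X\<bar> \<partial>PiM UNIV (\<lambda>_. beta1 \<theta>))"
    by (rule integral_abs_bound)
  also have "\<dots> \<le> (\<integral>X. e \<partial>PiM UNIV (\<lambda>_ :: nat. beta1 \<theta>))"
    using brk_integrable g assms(1) by (intro integral_mono_AE) auto
  also have "\<dots> = e" using \<beta>s.prob_space by simp
  finally show ?thesis .
qed

text \<open>The first identity of \<open>perm_avg_rec_and_count\<close>, with the removed cycle
  moved into the list. The scale \<open>N\<close> stays fixed while \<open>n\<close>
  decreases.\<close>

lemma Q_step:
  assumes "0 < N"
  shows "real n * Q n a N = (\<Sum>j=1..n. \<theta>s j * Q (n - j) (a @ [real j / N]) N)"
  unfolding Q_def perm_avg_rec_and_count(1)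
  by (simp add: cyc_def rearr_append_mset_seq[OF assms] mult.assoc perm_avg_cmult)

text \<open>Self-similarity: after the first break at fraction \<open>s\<close>, the remainder of
  length \<open>c * (1 - s)\<close> is broken by the remaining variables.\<close>

lemma brk_case_nat: "brk a c (case_nat s X) = brk (a @ [c * s]) (c * (1 - s)) X"
proof -
  have "(\<lambda>k. c * stick (case_nat s X) k) = case_nat (c * s) (\<lambda>k. c * (1 - s) * stick X k)"
    by (auto simp: stick_Suc fun_eq_iff split: nat.split)
  then show ?thesis by (simp add: brk_def append_seq_snoc)
qed

text \<open>An i.i.d. sequence is a first coordinate followed by an independent copy of the whole
  sequence, so Fubini isolates the first break. The measurability is what
  \<open>sampling_uniform\<close> asks of its test function.\<close>

lemma R_step:
  "R a c = (\<integral>s. R (a @ [c * s]) (c * (1 - s)) \<partial>beta1 \<theta>)"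
  and R_step_measurable: "(\<lambda>s. R (a @ [c * s]) (c * (1 - s))) \<in> borel_measurable borel"
proof -
  let ?S = "PiM UNIV (\<lambda>_ :: nat. beta1 \<theta>)"
  interpret SS: sequence_space "beta1 \<theta>" by (rule sequence_space_beta1[OF \<theta>_pos])
  interpret PP: pair_prob_space "beta1 \<theta>" ?S ..
  let ?T = "\<lambda>(s, X). case_nat s X"
  have T: "?T \<in> measurable (beta1 \<theta> \<Otimes>\<^sub>M ?S) ?S"
    by measurable
  have meas: "(\<lambda>(s, X). brk a c (case_nat s X)) \<in> borel_measurable (beta1 \<theta> \<Otimes>\<^sub>M ?S)"
    using measurable_compose[OF T brk_measurable[of a c]] by (simp add: case_prod_beta')
  have int: "integrable (beta1 \<theta> \<Otimes>\<^sub>M ?S) (\<lambda>(s, X). brk a c (case_nat s X))"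
    by (rule PP.integrable_const_bound[of _ B]) (auto simp: brk_bound meas)
  have "R a c = (\<integral>X. brk a c X \<partial>distr (beta1 \<theta> \<Otimes>\<^sub>M ?S) ?S ?T)"
    unfolding R_def SS.PiM_iter ..
  also have "\<dots> = (\<integral>z. brk a c (?T z) \<partial>(beta1 \<theta> \<Otimes>\<^sub>M ?S))"
    by (rule integral_distr[OF T brk_measurable])
  also have "\<dots> = (\<integral>z. (\<lambda>(s, X). brk a c (case_nat s X)) z \<partial>(beta1 \<theta> \<Otimes>\<^sub>M ?S))"
    by (intro Bochner_Integration.integral_cong) auto
  also have "\<dots> = (\<integral>s. \<integral>X. brk a c (case_nat s X) \<partial>?S \<partial>beta1 \<theta>)"
    using PP.integral_fst'[OF int] by simp
  finally show "R a c = (\<integral>s. R (a @ [c * s]) (c * (1 - s)) \<partial>beta1 \<theta>)"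
    by (simp add: R_def brk_case_nat)
  have "(\<lambda>s. \<integral>X. brk a c (case_nat s X) \<partial>?S) \<in> borel_measurable (beta1 \<theta>)"
    using meas by (rule \<beta>s.borel_measurable_lebesgue_integral)
  then show "(\<lambda>s. R (a @ [c * s]) (c * (1 - s))) \<in> borel_measurable borel"
    by (simp add: R_def brk_case_nat cong: measurable_cong_sets)
qed

lemma f_rearr_modulus:
  assumes "0 < e"
  obtains d where "0 < d"
    "\<And>v w. unit_null v \<Longrightarrow> unit_null w \<Longrightarrow> (\<And>k. \<bar>v k - w k\<bar> \<le> d) \<Longrightarrow> \<bar>f (rearr v) - f (rearr w)\<bar> \<le> e"
proof -
  obtain d where d: "0 < d" "\<And>x y. (\<And>i. 0 \<le> x i \<and> x i \<le> 1) \<Longrightarrow> (\<And>i. 0 \<le> y i \<and> y i \<le> 1) \<Longrightarrow>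
      (\<And>i. \<bar>x i - y i\<bar> \<le> d) \<Longrightarrow> \<bar>f x - f y\<bar> \<le> e"
    by (rule continuous_uniform_on_cube[OF f_cont assms]) blast
  have "\<bar>f (rearr v) - f (rearr w)\<bar> \<le> e"
    if "unit_null v" "unit_null w" "\<And>k. \<bar>v k - w k\<bar> \<le> d" for v w
    using that by (intro d(2) conjI rearr_nonneg rearr_le_1 rearr_lipschitz)
  then show thesis using d(1) that by blast
qed

text \<open>Moving the break point from \<open>s\<close> to \<open>t\<close> changes every block by
  at most the distance of \<open>s\<close> and \<open>t\<close>, as \<open>c\<close> and the stick
  pieces are at most 1. The modulus thus serves all \<open>a\<close> and \<open>c\<close> at
  once.\<close>

lemma R_modulus:
  assumes "0 < e"
  obtains d where "0 < d"
    "\<And>a c s t. set a \<subseteq> {0..1} \<Longrightarrow> 0 \<le> c \<Longrightarrow> c \<le> 1 \<Longrightarrow> s \<in> {0..1} \<Longrightarrow> t \<in> {0..1} \<Longrightarrow> \<bar>s - t\<bar> \<le> d \<Longrightarrow>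
      \<bar>R (a @ [c * s]) (c * (1 - s)) - R (a @ [c * t]) (c * (1 - t))\<bar> \<le> e"
proof -
  obtain d where d: "0 < d"
    "\<And>v w. unit_null v \<Longrightarrow> unit_null w \<Longrightarrow> (\<And>k. \<bar>v k - w k\<bar> \<le> d) \<Longrightarrow> \<bar>f (rearr v) - f (rearr w)\<bar> \<le> e"
    by (rule f_rearr_modulus[OF assms]) blast
  have "\<bar>R (a @ [c * s]) (c * (1 - s)) - R (a @ [c * t]) (c * (1 - t))\<bar> \<le> e"
    if a: "set a \<subseteq> {0..1}" and c: "0 \<le> c" "c \<le> 1" and st: "s \<in> {0..1}" "t \<in> {0..1}" "\<bar>s - t\<bar> \<le> d" for a c s t
    unfolding R_def[of "a @ [c * t]"]
  proof (rule R_diff_le[OF _ brk_integrable])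
    show "AE X in PiM UNIV (\<lambda>_. beta1 \<theta>). \<bar>brk (a @ [c * s]) (c * (1 - s)) X - brk (a @ [c * t]) (c * (1 - t)) X\<bar> \<le> e"
      using AE_unit_null_stick[OF \<theta>_pos]
    proof eventually_elim
      case (elim X)
      have cs: "0 \<le> c * r" "c * r \<le> 1" "0 \<le> c * (1 - r)" "c * (1 - r) \<le> 1" if "r \<in> {0..1}" for r
        using c that by (auto intro!: mult_le_one)
      show ?case
        unfolding brk_def
      proof (rule d(2))
        show "unit_null (append_seq (a @ [c * s]) (\<lambda>k. c * (1 - s) * stick X k))"
          using a cs[OF st(1)] by (intro unit_null_append_seq elim) auto
        show "unit_null (append_seq (a @ [c * t]) (\<lambda>k. c * (1 - t) * stick X k))"
          using a cs[OF st(2)] by (intro unit_null_append_seq elim) auto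
        fix k
        have 1: "\<bar>c * s - c * t\<bar> \<le> d"
        proof -
          have "\<bar>c * s - c * t\<bar> = c * \<bar>s - t\<bar>" using c by (simp add: abs_mult right_diff_distrib[symmetric])
          also have "\<dots> \<le> 1 * \<bar>s - t\<bar>" using c by (intro mult_right_mono) auto
          finally show ?thesis using st by simp
        qed
        have 2: "\<bar>c * (1 - s) * stick X m - c * (1 - t) * stick X m\<bar> \<le> d" for m
        proof -
          have "\<bar>c * (1 - s) * stick X m - c * (1 - t) * stick X m\<bar> = \<bar>c * s - c * t\<bar> * stick X m"
            using unit_nullD(1)[OF elim, of m]
            by (simp add: left_diff_distrib[symmetric] abs_mult right_diff_distrib abs_minus_commute)
          also have "\<dots> \<le> \<bar>c * s - c * t\<bar> * 1"
            using unit_nullD(2)[OF elim, of m] by (intro mult_left_mono) auto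
          finally show ?thesis using 1 by simp
        qed
        show "\<bar>append_seq (a @ [c * s]) (\<lambda>k. c * (1 - s) * stick X k) k -
           append_seq (a @ [c * t]) (\<lambda>k. c * (1 - t) * stick X k) k\<bar> \<le> d"
          using 1 2 d(1) by (auto simp: append_seq_def nth_append)
      qed
    qed
  qed
  then show thesis using d(1) that by blast
qed

text \<open>The weights are nonnegative and average to \<open>h n\<close>, so a pointwise bound
  integrates to one with the factor \<open>h n\<close>; no division occurs.\<close>

lemma Q_diff_le:
  assumes "\<And>\<sigma>. \<sigma> permutes {1..n} \<Longrightarrow> \<bar>cyc a N (cycle_type n \<sigma>) - x\<bar> \<le> e"
  shows "\<bar>Q n a N - h n * x\<bar> \<le> h n * e"
proof -
  have w: "0 \<le> weight \<theta>s (cycle_type n \<sigma>)" if "\<sigma> permutes {1..n}" for \<sigma>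
    using wt_nonneg[of \<theta>s n \<sigma>, OF \<theta>s_nonneg] wt_eq_weight[OF that] by simp
  have "Q n a N - h n * x = perm_avg n (\<lambda>M. weight \<theta>s M * (cyc a N M - x))"
    unfolding Q_def hn_eq_perm_avg right_diff_distrib perm_avg_diff
    by (simp add: perm_avg_cmult[symmetric] mult.commute)
  moreover have "perm_avg n (\<lambda>M. weight \<theta>s M * (cyc a N M - x)) \<le> perm_avg n (\<lambda>M. e * weight \<theta>s M)"
    using assms w by (intro perm_avg_mono) (simp add: mult.commute[of e] mult_left_mono abs_le_iff)
  moreover have "perm_avg n (\<lambda>M. (- e) * weight \<theta>s M) \<le> perm_avg n (\<lambda>M. weight \<theta>s M * (cyc a N M - x))"
  proof (rule perm_avg_mono)
    fix \<sigma> assume \<sigma>: "\<sigma> permutes {1..n}"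
    have "- e \<le> cyc a N (cycle_type n \<sigma>) - x" using assms[OF \<sigma>] by linarith
    from mult_left_mono[OF this w[OF \<sigma>]]
    show "- e * weight \<theta>s (cycle_type n \<sigma>) \<le> weight \<theta>s (cycle_type n \<sigma>) * (cyc a N (cycle_type n \<sigma>) - x)"
      by (simp add: mult.commute)
  qed
  ultimately show ?thesis
    unfolding perm_avg_cmult hn_eq_perm_avg[symmetric] by (simp add: abs_le_iff mult.commute)
qed

lemma comparison_crude: "\<bar>Q n a N - h n * R a c\<bar> \<le> h n * (2 * B)"
proof (rule Q_diff_le)
  fix \<sigma>
  show "\<bar>cyc a N (cycle_type n \<sigma>) - R a c\<bar> \<le> 2 * B"
    using f_bound[of "rearr (append_seq a (\<lambda>k. mset_seq (cycle_type n \<sigma>) k / N))"] R_bound[of a c]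
    by (simp add: cyc_def)
qed

text \<open>Once the part that remains is short, it does not matter how it is broken.\<close>

lemma comparison_short:
  assumes "0 < e"
  obtains d where "0 < d"
    "\<And>a n N. set a \<subseteq> {0..1} \<Longrightarrow> 0 < N \<Longrightarrow> real n / N \<le> d \<Longrightarrow>
      \<bar>Q n a N - h n * R a (real n / N)\<bar> \<le> h n * e"
proof -
  obtain d where d: "0 < d"
    "\<And>v w. unit_null v \<Longrightarrow> unit_null w \<Longrightarrow> (\<And>k. \<bar>v k - w k\<bar> \<le> d) \<Longrightarrow> \<bar>f (rearr v) - f (rearr w)\<bar> \<le> e / 2"
    using f_rearr_modulus[of "e / 2"] assms by (metis half_gt_zero)
  have "\<bar>Q n a N - h n * R a (real n / N)\<bar> \<le> h n * e"
    if a: "set a \<subseteq> {0..1}" and N: "0 < N" and nN: "real n / N \<le> min d 1" for a n N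
  proof (rule Q_diff_le)
    fix \<sigma> assume \<sigma>: "\<sigma> permutes {1..n}"
    \<comment> \<open>Both sides are compared with the removed blocks followed by zeros, each within
      \<open>e / 2\<close>. The form \<open>1 * 0\<close> fits \<open>unit_null_append_seq\<close>
      with scale 1.\<close>
    define x where "x = f (rearr (append_seq a (\<lambda>k. 1 * 0)))"
    have un0: "unit_null (\<lambda>_. 0)" by (simp add: unit_null_def)
    have base: "unit_null (append_seq a (\<lambda>k. 1 * 0))"
      using un0 by (intro unit_null_append_seq[OF a]) auto
    have b: "\<And>x. x \<in># cycle_type n \<sigma> \<Longrightarrow> x \<le> n" using cycle_type_bounds(2)[OF \<sigma>] .
    have "real n \<le> N" using nN N by (simp add: divide_le_eq)
    from unit_null_append_seq[OF a unit_null_mset_seq[OF b this N], where c = 1]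
    have "unit_null (append_seq a (\<lambda>k. mset_seq (cycle_type n \<sigma>) k / N))" by simp
    then have 1: "\<bar>cyc a N (cycle_type n \<sigma>) - x\<bar> \<le> e / 2"
      unfolding cyc_def x_def
    proof (rule d(2)[OF _ base])
      fix k
      have "\<bar>mset_seq (cycle_type n \<sigma>) m / N\<bar> \<le> d" for m
      proof -
        have "mset_seq (cycle_type n \<sigma>) m / N \<le> real n / N"
          using mset_seq_bounds(2)[of "cycle_type n \<sigma>" n, OF b] N by (intro divide_right_mono) auto
        then show ?thesis using nN N mset_seq_bounds(1)[of "cycle_type n \<sigma>" n m, OF b] by simp
      qed
      then show "\<bar>append_seq a (\<lambda>k. mset_seq (cycle_type n \<sigma>) k / N) k - append_seq a (\<lambda>k. 1 * 0) k\<bar> \<le> d"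
        using d(1) by (simp add: append_seq_def)
    qed
    have "\<bar>R a (real n / N) - (\<integral>X. x \<partial>PiM UNIV (\<lambda>_ :: nat. beta1 \<theta>))\<bar> \<le> e / 2"
    proof (rule R_diff_le)
      show "AE X in PiM UNIV (\<lambda>_. beta1 \<theta>). \<bar>brk a (real n / N) X - x\<bar> \<le> e / 2"
        using AE_unit_null_stick[OF \<theta>_pos]
      proof eventually_elim
        case (elim X)
        show ?case
          unfolding brk_def x_def
        proof (rule d(2)[OF _ base])
          show "unit_null (append_seq a (\<lambda>k. real n / N * stick X k))"
            using nN N by (intro unit_null_append_seq[OF a elim]) auto
          fix k
          have "\<bar>real n / N * stick X m\<bar> \<le> d" for m
          proof -
            have "real n / N * stick X m \<le> real n / N * 1"
              using unit_nullD(2)[OF elim] N by (intro mult_left_mono) auto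
            then show ?thesis using nN N unit_nullD(1)[OF elim, of m] by (simp add: abs_mult)
          qed
          then show "\<bar>append_seq a (\<lambda>k. real n / N * stick X k) k - append_seq a (\<lambda>k. 1 * 0) k\<bar> \<le> d"
            using d(1) by (simp add: append_seq_def)
        qed
      qed
    qed simp
    then have 2: "\<bar>R a (real n / N) - x\<bar> \<le> e / 2" using \<beta>s.prob_space by simp
    show "\<bar>cyc a N (cycle_type n \<sigma>) - R a (real n / N)\<bar> \<le> e" using 1 2 by linarith
  qed
  then show thesis using d(1) by (intro that[of "min d 1"]) auto
qed

text \<open>A step of the recursion multiplies the expected remaining length, hence \<open>M\<close>, by a factor
  below 1.\<close>

definition comparable :: "real \<Rightarrow> real \<Rightarrow> bool" where
  "comparable e M \<longleftrightarrow> (\<exists>N0. \<forall>N n a. N0 \<le> N \<longrightarrow> 0 < N \<longrightarrow> real n \<le> N \<longrightarrow> set a \<subseteq> {0..1} \<longrightarrow>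
     \<bar>Q n a N - h n * R a (real n / N)\<bar> \<le> h n * (e + M * (real n / N)))"

text \<open>Short remainders cost \<open>e\<close>. For relative length above \<open>d\<close> the
  crude error \<open>2 * B\<close> is at most \<open>2 * B / d\<close> times that length, which
  gives \<open>M\<close>.\<close>

lemma comparable_init:
  assumes "0 < e"
  obtains M where "0 \<le> M" "comparable e M"
proof -
  obtain d where d: "0 < d" "\<And>a n N. set a \<subseteq> {0..1} \<Longrightarrow> 0 < N \<Longrightarrow> real n / N \<le> d \<Longrightarrow>
      \<bar>Q n a N - h n * R a (real n / N)\<bar> \<le> h n * e"
    by (rule comparison_short[OF assms]) blast
  have "comparable e (2 * B / d)"
    unfolding comparable_def
  proof (intro exI[of _ 0] allI impI)
    fix N :: real and n :: nat and a :: "real list"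
    assume N: "0 < N" and a: "set a \<subseteq> {0..1}"
    show "\<bar>Q n a N - h n * R a (real n / N)\<bar> \<le> h n * (e + 2 * B / d * (real n / N))"
    proof (cases "real n / N \<le> d")
      case True
      have "h n * e \<le> h n * (e + 2 * B / d * (real n / N))"
        using h_nonneg[of n] B_nonneg d(1) N by (intro mult_left_mono) auto
      then show ?thesis using d(2)[OF a N True] by linarith
    next
      case False
      have "2 * B = 2 * B / d * d" using d(1) by simp
      also have "\<dots> \<le> 2 * B / d * (real n / N)"
        using False B_nonneg d(1) by (intro mult_left_mono) auto
      finally have "h n * (2 * B) \<le> h n * (e + 2 * B / d * (real n / N))"
        using h_nonneg[of n] assms by (intro mult_left_mono) auto
      then show ?thesis using comparison_crude[of n a N "real n / N"] by linarith
    qed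
  qed
  then show thesis using B_nonneg d(1) by (intro that) auto
qed

text \<open>For large \<open>n\<close> one cycle and one stick piece are removed: the hypothesis is
  averaged over \<open>p\<close>, and replacing \<open>p\<close> by \<open>beta1\<close> costs
  \<eta>. For bounded \<open>n\<close> the remainder is short relative to \<open>N\<close>, which
  also costs at most \<eta>.\<close>

lemma comparable_step:
  assumes \<rho>: "\<forall>\<^sub>F n in sequentially. (\<Sum>j=1..n. p n j * (1 - real j / real n)) \<le> \<rho>" "0 \<le> \<rho>"
    and e: "0 \<le> e" and M: "0 \<le> M" and comp: "comparable e M" and \<eta>: "0 < \<eta>"
  shows "comparable (e + \<eta>) (\<rho> * M)"
proof -
  obtain N0 where N0: "\<And>N n a. N0 \<le> N \<Longrightarrow> 0 < N \<Longrightarrow> real n \<le> N \<Longrightarrow> set a \<subseteq> {0..1} \<Longrightarrow>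
     \<bar>Q n a N - h n * R a (real n / N)\<bar> \<le> h n * (e + M * (real n / N))"
    using comp unfolding comparable_def by blast
  obtain d where d: "0 < d" "\<And>a n N. set a \<subseteq> {0..1} \<Longrightarrow> 0 < N \<Longrightarrow> real n / N \<le> d \<Longrightarrow>
      \<bar>Q n a N - h n * R a (real n / N)\<bar> \<le> h n * \<eta>"
    by (rule comparison_short[OF \<eta>]) blast
  \<comment> \<open>\<open>sampling_uniform\<close> loses three times the modulus of
    continuity.\<close>
  have "0 < \<eta> / 3" using \<eta> by simp
  from R_modulus[OF this] obtain d' where d': "0 < d'"
    "\<And>a c s t. set a \<subseteq> {0..1} \<Longrightarrow> 0 \<le> c \<Longrightarrow> c \<le> 1 \<Longrightarrow> s \<in> {0..1} \<Longrightarrow> t \<in> {0..1} \<Longrightarrow> \<bar>s - t\<bar> \<le> d' \<Longrightarrow>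
      \<bar>R (a @ [c * s]) (c * (1 - s)) - R (a @ [c * t]) (c * (1 - t))\<bar> \<le> \<eta> / 3"
    by blast
  define good where "good n \<longleftrightarrow> (\<forall>\<Psi>. \<Psi> \<in> borel_measurable borel \<longrightarrow> (\<forall>s. \<bar>\<Psi> s\<bar> \<le> B) \<longrightarrow>
      (\<forall>s\<in>{0..1}. \<forall>t\<in>{0..1}. \<bar>s - t\<bar> \<le> d' \<longrightarrow> \<bar>\<Psi> s - \<Psi> t\<bar> \<le> \<eta> / 3) \<longrightarrow>
      \<bar>(\<Sum>j=1..n. p n j * \<Psi> (real j / real n)) - (\<integral>s. \<Psi> s \<partial>beta1 \<theta>)\<bar> \<le> 3 * (\<eta> / 3))" for n
  have "\<forall>\<^sub>F n in sequentially. good n"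
    unfolding good_def by (rule sampling_uniform[OF \<open>0 < \<eta> / 3\<close> d'(1)])
  with \<rho>(1) eventually_h_pos eventually_gt_at_top[of 0]
  have "\<forall>\<^sub>F n in sequentially. good n \<and> (\<Sum>j=1..n. p n j * (1 - real j / real n)) \<le> \<rho> \<and> 0 < h n \<and> 0 < n"
    by eventually_elim blast
  then obtain n1 where n1': "\<And>n. n1 \<le> n \<Longrightarrow> good n"
      "\<And>n. n1 \<le> n \<Longrightarrow> (\<Sum>j=1..n. p n j * (1 - real j / real n)) \<le> \<rho>"
      "\<And>n. n1 \<le> n \<Longrightarrow> 0 < h n" "\<And>n. n1 \<le> n \<Longrightarrow> 0 < n"
    unfolding eventually_sequentially by blast
  have n1: "\<bar>(\<Sum>j=1..n. p n j * \<Psi> (real j / real n)) - (\<integral>s. \<Psi> s \<partial>beta1 \<theta>)\<bar> \<le> \<eta>"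
    if "n1 \<le> n" "\<Psi> \<in> borel_measurable borel" "\<And>s. \<bar>\<Psi> s\<bar> \<le> B"
      "\<And>s t. s \<in> {0..1} \<Longrightarrow> t \<in> {0..1} \<Longrightarrow> \<bar>s - t\<bar> \<le> d' \<Longrightarrow> \<bar>\<Psi> s - \<Psi> t\<bar> \<le> \<eta> / 3" for n \<Psi>
  proof -
    have "\<bar>(\<Sum>j=1..n. p n j * \<Psi> (real j / real n)) - (\<integral>s. \<Psi> s \<partial>beta1 \<theta>)\<bar> \<le> 3 * (\<eta> / 3)"
      using n1'(1)[OF that(1), unfolded good_def] that(2-4) by blast
    then show ?thesis by simp
  qed
  show ?thesis
    unfolding comparable_def
  \<comment> \<open>With \<open>N \<ge> n1 / d\<close>, every \<open>n < n1\<close> has relative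
    length at most \<open>d\<close>, so \<open>comparison_short\<close> covers it.\<close>
  proof (intro exI[of _ "max N0 (real n1 / d)"] allI impI)
    fix N :: real and n :: nat and a :: "real list"
    assume N: "max N0 (real n1 / d) \<le> N" "0 < N" and nN: "real n \<le> N" and a: "set a \<subseteq> {0..1}"
    define c where "c = real n / N"
    have c: "0 \<le> c" "c \<le> 1" using N nN by (auto simp: c_def)
    show "\<bar>Q n a N - h n * R a (real n / N)\<bar> \<le> h n * (e + \<eta> + \<rho> * M * (real n / N))"
    proof (cases "n1 \<le> n")
      case False
      have "real n \<le> real n1" using False by simp
      also have "\<dots> \<le> d * N" using N d(1) by (simp add: field_simps)
      finally have "real n / N \<le> d" using N by (simp add: field_simps)
      from d(2)[OF a N(2) this] have "\<bar>Q n a N - h n * R a (real n / N)\<bar> \<le> h n * \<eta>" .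
      also have "\<dots> \<le> h n * (e + \<eta> + \<rho> * M * (real n / N))"
        using h_nonneg[of n] e \<rho>(2) M N by (intro mult_left_mono) auto
      finally show ?thesis .
    next
      case True
      have hn: "0 < h n" and n: "0 < n" using n1'(3,4)[OF True] by auto
      define \<Psi> where "\<Psi> s = R (a @ [c * s]) (c * (1 - s))" for s
      have samp: "\<bar>(\<Sum>j=1..n. p n j * \<Psi> (real j / real n)) - R a c\<bar> \<le> \<eta>"
        unfolding R_step[of a c] \<Psi>_def[symmetric]
      proof (rule n1[OF True])
        show "\<Psi> \<in> borel_measurable borel" unfolding \<Psi>_def[abs_def] by (rule R_step_measurable)
        show "\<bar>\<Psi> s\<bar> \<le> B" for s unfolding \<Psi>_def by (rule R_bound)
        show "\<bar>\<Psi> s - \<Psi> t\<bar> \<le> \<eta> / 3" if "s \<in> {0..1}" "t \<in> {0..1}" "\<bar>s - t\<bar> \<le> d'" for s t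
          unfolding \<Psi>_def using a c that by (rule d'(2))
      qed
      have summand: "\<bar>\<theta>s j * Q (n - j) (a @ [real j / N]) N - \<theta>s j * (h (n - j) * \<Psi> (real j / real n))\<bar> \<le>
          \<theta>s j * (h (n - j) * (e + M * (c * (1 - real j / real n))))" if j: "j \<in> {1..n}" for j
      proof -
        \<comment> \<open>Breaking the remainder \<open>c = n / N\<close> at fraction
          \<open>j / n\<close> yields the block \<open>j / N\<close>, the very block that
          \<open>Q_step\<close> puts into the list; the hypothesis therefore compares with \<Psi> at
          \<open>j / n\<close>.\<close>
        have cj: "c * (real j / real n) = real j / N" using n by (simp add: c_def)
        have cj': "c * (1 - real j / real n) = real (n - j) / N"
          unfolding right_diff_distrib cj using j by (simp add: c_def of_nat_diff diff_divide_distrib)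
        have "real j / N \<le> 1" using j nN N by auto
        then have "set (a @ [real j / N]) \<subseteq> {0..1}" using a N by auto
        then have "\<bar>Q (n - j) (a @ [real j / N]) N - h (n - j) * R (a @ [real j / N]) (real (n - j) / N)\<bar>
            \<le> h (n - j) * (e + M * (real (n - j) / N))"
          using N nN by (intro N0) auto
        then have "\<bar>Q (n - j) (a @ [real j / N]) N - h (n - j) * \<Psi> (real j / real n)\<bar>
            \<le> h (n - j) * (e + M * (c * (1 - real j / real n)))"
          unfolding \<Psi>_def cj cj' .
        from mult_left_mono[OF this, of "\<theta>s j"] show ?thesis
          using \<theta>s_nonneg[of j] j by (simp add: abs_mult right_diff_distrib[symmetric])
      qed
      have "\<bar>real n * Q n a N - (\<Sum>j=1..n. \<theta>s j * (h (n - j) * \<Psi> (real j / real n)))\<bar> =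
          \<bar>\<Sum>j=1..n. \<theta>s j * Q (n - j) (a @ [real j / N]) N - \<theta>s j * (h (n - j) * \<Psi> (real j / real n))\<bar>"
        unfolding Q_step[OF N(2)] sum_subtractf[symmetric] ..
      also have "\<dots> \<le> (\<Sum>j=1..n. \<theta>s j * (h (n - j) * (e + M * (c * (1 - real j / real n)))))"
        by (rule order_trans[OF sum_abs]) (rule sum_mono[OF summand])
      finally have main: "\<bar>real n * Q n a N - (\<Sum>j=1..n. \<theta>s j * (h (n - j) * \<Psi> (real j / real n)))\<bar>
          \<le> (\<Sum>j=1..n. \<theta>s j * (h (n - j) * (e + M * (c * (1 - real j / real n)))))" .
      have to_p: "(\<Sum>j=1..n. \<theta>s j * (h (n - j) * g j)) = real n * h n * (\<Sum>j=1..n. p n j * g j)" for g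
        unfolding p_def sum_distrib_left using hn n by (intro sum.cong refl) simp
      have "\<bar>real n * Q n a N - real n * h n * (\<Sum>j=1..n. p n j * \<Psi> (real j / real n))\<bar>
          \<le> real n * h n * (\<Sum>j=1..n. p n j * (e + M * (c * (1 - real j / real n))))"
        using main unfolding to_p .
      also have "(\<Sum>j=1..n. p n j * (e + M * (c * (1 - real j / real n)))) =
          e * (\<Sum>j=1..n. p n j) + M * c * (\<Sum>j=1..n. p n j * (1 - real j / real n))"
        unfolding sum_distrib_left sum.distrib[symmetric] by (intro sum.cong refl) (simp add: algebra_simps)
      \<comment> \<open>The constant \<open>e\<close> is weighted by total mass 1, the linear term
        by the mean remaining fraction, at most \<rho>.\<close>
      also have "real n * h n * \<dots> \<le> real n * h n * (e * 1 + M * c * \<rho>)"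
        using p_sum[OF n hn] n1'(2)[OF True] M c hn e
        by (intro mult_left_mono add_mono mult_left_mono) auto
      finally have "real n * \<bar>Q n a N - h n * (\<Sum>j=1..n. p n j * \<Psi> (real j / real n))\<bar>
          \<le> real n * (h n * (e + M * c * \<rho>))"
        using abs_mult[of "real n" "Q n a N - h n * (\<Sum>j=1..n. p n j * \<Psi> (real j / real n))"]
        by (simp only: right_diff_distrib mult.assoc abs_of_nat mult_1_right)
      then have 1: "\<bar>Q n a N - h n * (\<Sum>j=1..n. p n j * \<Psi> (real j / real n))\<bar> \<le> h n * (e + M * c * \<rho>)"
        using n by (simp add: mult_le_cancel_left)
      have "\<bar>h n * (\<Sum>j=1..n. p n j * \<Psi> (real j / real n)) - h n * R a c\<bar> \<le> h n * \<eta>"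
        using mult_left_mono[OF samp, of "h n"] hn by (simp add: abs_mult right_diff_distrib[symmetric])
      with 1 have "\<bar>Q n a N - h n * R a c\<bar> \<le> h n * (e + M * c * \<rho>) + h n * \<eta>" by linarith
      also have "\<dots> = h n * (e + \<eta> + \<rho> * M * c)" by (simp add: algebra_simps)
      finally show ?thesis unfolding c_def .
    qed
  qed
qed

lemma ranked_expectation_limit: "(\<lambda>n. Q n [] (real n) / h n) \<longlonglongrightarrow> R [] 1"
proof (rule tendstoI)
  fix \<epsilon> :: real assume \<epsilon>: "0 < \<epsilon>"
  obtain \<rho> where \<rho>: "0 < \<rho>" "\<rho> < 1"
    "\<forall>\<^sub>F n in sequentially. (\<Sum>j=1..n. p n j * (1 - real j / real n)) \<le> \<rho>"
    by (rule p_contraction)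
  have "0 < \<epsilon> / 4" using \<epsilon> by simp
  from comparable_init[OF this] obtain M where M: "0 \<le> M" "comparable (\<epsilon> / 4) M" by blast
  have iter: "comparable (\<epsilon> / 4 + real k * \<eta>) (\<rho> ^ k * M)" if \<eta>: "0 < \<eta>" for k \<eta>
  proof (induction k)
    case (Suc k)
    have "comparable (\<epsilon> / 4 + real k * \<eta> + \<eta>) (\<rho> * (\<rho> ^ k * M))"
      using \<rho> \<epsilon> \<eta> M by (intro comparable_step[OF \<rho>(3) _ _ _ Suc.IH \<eta>]) auto
    then show ?case by (simp add: algebra_simps)
  qed (use M in simp)
  have "(\<lambda>k. \<rho> ^ k * M) \<longlonglongrightarrow> 0 * M"
    using \<rho> by (intro tendsto_mult tendsto_const LIMSEQ_power_zero) auto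
  then have "\<forall>\<^sub>F k in sequentially. \<rho> ^ k * M < \<epsilon> / 4"
    using \<epsilon> by (intro order_tendstoD(2)) auto
  then obtain k where k: "\<rho> ^ k * M < \<epsilon> / 4" by (auto simp: eventually_sequentially)
  \<comment> \<open>The number \<open>k\<close> of steps is fixed first, by the decay of
    \<open>\<rho> ^ k * M\<close>; then \<eta> is chosen so that all steps together add at most
    \<open>\<epsilon> / 4\<close>. The total error stays below
    \<open>3 * \<epsilon> / 4\<close>.\<close>
  define \<eta> where "\<eta> = \<epsilon> / (4 * (real k + 1))"
  have \<eta>: "0 < \<eta>" "real k * \<eta> \<le> \<epsilon> / 4" using \<epsilon> by (auto simp: \<eta>_def field_simps)
  from iter[OF \<eta>(1), of k] obtain N0 where N0: "\<And>N n a. N0 \<le> N \<Longrightarrow> 0 < N \<Longrightarrow> real n \<le> N \<Longrightarrow> set a \<subseteq> {0..1} \<Longrightarrow>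
     \<bar>Q n a N - h n * R a (real n / N)\<bar> \<le> h n * (\<epsilon> / 4 + real k * \<eta> + \<rho> ^ k * M * (real n / N))"
    unfolding comparable_def by blast
  have "\<forall>\<^sub>F n in sequentially. N0 \<le> real n" by real_asymp
  then show "\<forall>\<^sub>F n in sequentially. dist (Q n [] (real n) / h n) (R [] 1) < \<epsilon>"
    using eventually_gt_at_top[of 0] eventually_h_pos
  proof eventually_elim
    case (elim n)
    have "\<bar>Q n [] (real n) - h n * R [] 1\<bar> \<le> h n * (\<epsilon> / 4 + real k * \<eta> + \<rho> ^ k * M)"
      using N0[of "real n" n "[]"] elim by simp
    also have "\<dots> < h n * \<epsilon>"
      using \<eta>(2) k \<epsilon> elim by (intro mult_strict_left_mono) auto
    finally have "\<bar>Q n [] (real n) - h n * R [] 1\<bar> / h n < \<epsilon>"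
      using elim by (simp add: pos_divide_less_eq mult.commute)
    moreover have "Q n [] (real n) / h n - R [] 1 = (Q n [] (real n) - h n * R [] 1) / h n"
      using elim by (simp add: diff_divide_distrib)
    ultimately show ?case using elim by (simp add: dist_real_def abs_divide)
  qed
qed

end

lemma ranked_cycle_lengths_converge:
  assumes nonneg: "\<And>j. 1 \<le> j \<Longrightarrow> 0 \<le> \<theta>s j" and lim: "\<theta>s \<longlonglongrightarrow> \<theta>" and pos: "0 < \<theta>"
  shows "converges_weakly (\<lambda>n. distr (Pn \<theta>s n) (PiM UNIV (\<lambda>_. borel))
                    (\<lambda>\<sigma> i. real (Lcyc n \<sigma> (Suc i)) / real n)) (PD \<theta>)"
  unfolding converges_weakly_def
proof (intro allI impI, elim conjE)
  fix f :: "(nat \<Rightarrow> real) \<Rightarrow> real"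
  assume cont: "continuous_on UNIV f" and "bounded (range f)"
  then obtain B where "\<And>x. \<bar>f x\<bar> \<le> B" unfolding bounded_iff by auto
  then interpret ranked_test \<theta>s \<theta> f B
    using assms cont by unfold_locales auto
  let ?L = "\<lambda>n \<sigma> i. real (Lcyc n \<sigma> (Suc i)) / real n"
  have "\<forall>\<^sub>F n in sequentially. Q n [] (real n) / hn \<theta>s n =
      (\<integral>x. f x \<partial>distr (Pn \<theta>s n) (PiM UNIV (\<lambda>_. borel)) (?L n))"
    using eventually_gt_at_top[of 0]
  proof eventually_elim
    case (elim n)
    have "(\<integral>x. f x \<partial>distr (Pn \<theta>s n) (PiM UNIV (\<lambda>_. borel)) (?L n)) = (\<integral>\<sigma>. f (?L n \<sigma>) \<partial>Pn \<theta>s n)"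
      by (rule integral_distr[OF measurable_Pn f_measurable]) (simp add: space_PiM)
    also have "\<dots> = perm_avg n (\<lambda>M. weight \<theta>s M * cyc [] (real n) M) / hn \<theta>s n"
    proof (rule integral_Pn[OF nonneg])
      fix \<sigma>
      \<comment> \<open>The cycle lengths are already listed in nonincreasing order, so ranking
        leaves them unchanged.\<close>
      have "rearr (\<lambda>k. mset_seq (cycle_type n \<sigma>) k / real n) = ?L n \<sigma>"
        using elim by (intro ext) (simp add: rearr_mset_seq Lcyc_eq_mset_seq)
      then show "f (?L n \<sigma>) = cyc [] (real n) (cycle_type n \<sigma>)" by (simp add: cyc_def)
    qed
    finally show ?case by (simp add: Q_def)
  qed
  moreover have "R [] 1 = (\<integral>x. f x \<partial>PD \<theta>)"
  proof -
    have "(\<lambda>X. rearr (stick X)) \<in> measurable (PiM UNIV (\<lambda>_. beta1 \<theta>)) (PiM UNIV (\<lambda>_. borel))"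
      using measurable_compose[OF stick_measurable[of 1 \<theta>] measurable_rearr] by simp
    from integral_distr[OF this f_measurable] show ?thesis
      by (simp add: PD_def R_def brk_def)
  qed
  ultimately show "(\<lambda>n. \<integral>x. f x \<partial>distr (Pn \<theta>s n) (PiM UNIV (\<lambda>_. borel)) (?L n)) \<longlonglongrightarrow> (\<integral>x. f x \<partial>PD \<theta>)"
    using Lim_transform_eventually[OF ranked_expectation_limit] by simp
qed

theorem theorem6p1:
  fixes \<theta>s :: "nat \<Rightarrow> real" and \<theta> :: real
  assumes nonneg: "\<And>j. 1 \<le> j \<Longrightarrow> 0 \<le> \<theta>s j"
    and lim: "\<theta>s \<longlonglongrightarrow> \<theta>"
    and pos: "0 < \<theta>"
  shows
    "converges_weakly (\<lambda>n. distr (Pn \<theta>s n) (PiM UNIV (\<lambda>_. count_space UNIV)) (\<lambda>\<sigma> j. Rcyc n (Suc j) \<sigma>))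
        (PiM UNIV (\<lambda>j. poisson_measure (\<theta>s (Suc j) / real (Suc j))))
     \<and> (\<lambda>n. (\<integral>\<sigma>. real (Kcyc n \<sigma>) \<partial>Pn \<theta>s n) / ln (real n)) \<longlonglongrightarrow> \<theta>
     \<and> converges_weakly (\<lambda>n. distr (Pn \<theta>s n) (PiM UNIV (\<lambda>_. borel))
                    (\<lambda>\<sigma> i. real (Lcyc n \<sigma> (Suc i)) / real n))
        (PD \<theta>)"
  using cycle_counts_converge[OF nonneg lim pos] mean_cycle_number_asymp[OF nonneg lim pos]
    ranked_cycle_lengths_converge[OF nonneg lim pos]
  by blast

end
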